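(* Assume that $Y_1,\dots,Y_n$ are observed in the multivariate convolution model $Y_i=X_i+\varepsilon_i$ in $\mathbb{R}^d$, where $\varepsilon_1$ is a non degenerate Gaussian random vector (that is, its covariance matrix is not equal to zero) with known distribution $\mu_\varepsilon$. Let $A$ be an invertible $d\times d$ matrix such that the coordinates of $A\varepsilon_1$ are independent. Let $M>0$, $p\ge 1$ and $a>1$. Then: 1. There exists a constant $C>0$ such that for any estimator $\tilde\mu_n$ of the measure $\mu$, $$\liminf_{n\to\infty}\ (\log n)^{p/2}\sup_{\mu\in\mathcal{D}_A(M,p,a)}\mathbb{E}_{(\mu\star\mu_\varepsilon)^{\otimes n}}\big(W_p^p(\tilde\mu_n,\mu)\big)\ \ge\ C.$$ 2. One can build an estimator $\hat\mu_n$ of $\mu$ such that $$\sup_{n\ge 1}\ \sup_{\mu\in\mathcal{D}_A(M,p,a)}(\log n)^{p/2}\,\mathbb{E}_{(\mu\star\mu_\varepsilon)^{\otimes n}}\big(W_p^p(\hat\mu_n,\mu)\big)\ \le\ K$$ for some positive constant $K$.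
   Context: Convolution model: $Y_i=X_i+\varepsilon_i$, $i=1,\dots,n$, in $\mathbb{R}^d$, where the $X_i$ are i.i.d. with unknown distribution $\mu$, the $\varepsilon_i$ are i.i.d. with known distribution $\mu_\varepsilon$, and $(X_i)$ and $(\varepsilon_i)$ are independent, so that the $Y_i$ are i.i.d. with distribution $\mu\star\mu_\varepsilon$ (convolution). $\mathbb{E}_{(\mu\star\mu_\varepsilon)^{\otimes n}}$ is the expectation when $(Y_1,\dots,Y_n)$ has law $(\mu\star\mu_\varepsilon)^{\otimes n}$. An estimator of $\mu$ is, for each $n$, a measurable function of $(Y_1,\dots,Y_n)$ (which may depend on the known $\mu_\varepsilon$ but not on $\mu$) with values in the set of probability measures on $\mathbb{R}^d$. For $p\ge1$, $W_p(\mu,\mu')=\inf_{\pi\in\Pi(\mu,\mu')}\left(\int_{\mathbb{R}^d\times\mathbb{R}^d}\|x-y\|^p\,\pi(dx,dy)\right)^{1/p}$, where $\Pi(\mu,\mu')$ is the set of probability measures on $\mathbb{R}^d\times\mathbb{R}^d$ with marginals $\mu$ and $\mu'$ and $\|\cdot\|$ is the Euclidean norm. For a $d\times d$ matrix $A$ and constants $M>0$, $p\ge1$, $a>1$, $\mathcal{D}_A(M,p,a)$ is the set of probability measures $\mu$ on $\mathbb{R}^d$ such that, with $X_1\sim\mu$, $$\sup_{1\le j\le d}\mathbb{E}_\mu\Big(\big(1+|(AX_1)_j|^{2p+a}\big)\prod_{1\le\ell\le d,\ \ell\ne j}\big(1+|(AX_1)_\ell|^{a}\big)\Big)\le M.$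$
   Formalization: Part 1 is stated only for M > 1: for M < 1 the class D_A(M,p,a) is empty, and for M = 1 it contains only the point mass at 0, so the lower bound with C > 0 fails there; part 2 is stated for all M > 0. *)

theory Defs
  imports "HOL-Probability.Probability"
begin

text \<open>Real powers on \<^typ>\<open>ennreal\<close>, with the value at infinity appropriate to a positive exponent.\<close>

definition epowr :: "ennreal \<Rightarrow> real \<Rightarrow> ennreal" where
  "epowr x s = (if x = \<infinity> then \<infinity> else ennreal (enn2real x powr s))"

text \<open>\<^term>\<open>space (prob_algebra borel)\<close> is the set of all Borel probability measures.\<close>

definition couplings ::
  "'a::euclidean_space measure \<Rightarrow> 'a measure \<Rightarrow> ('a \<times> 'a) measure set" where
  "couplings \<mu> \<nu> =
     {\<pi> \<in> space (prob_algebra borel). distr \<pi> borel fst = \<mu> \<and> distr \<pi> borel snd = \<nu>}"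

text \<open>The distance is not restricted to measures with finite moments, so it may be infinite.\<close>

definition wasserstein ::
  "real \<Rightarrow> 'a::euclidean_space measure \<Rightarrow> 'a measure \<Rightarrow> ennreal" where
  "wasserstein p \<mu> \<nu> =
     (INF \<pi>\<in>couplings \<mu> \<nu>. epowr (\<integral>\<^sup>+(x, y). ennreal (norm (x - y) powr p) \<partial>\<pi>) (1 / p))"

text \<open>Point masses count as (degenerate) one-dimensional Gaussian laws; a random vector is
  Gaussian if all its linear functionals are, so singular covariances and nonzero means are
  allowed.\<close>

definition gaussian_real :: "real measure \<Rightarrow> bool" where
  "gaussian_real \<nu> \<longleftrightarrow>
     (\<exists>m. \<nu> = return borel m) \<or>
     (\<exists>m \<sigma>. \<sigma> > 0 \<and> \<nu> = density lborel (\<lambda>x. ennreal (normal_density m \<sigma> x)))"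

definition gaussian_vector :: "'a::euclidean_space measure \<Rightarrow> bool" where
  "gaussian_vector \<nu> \<longleftrightarrow>
     \<nu> \<in> space (prob_algebra borel) \<and> (\<forall>u. gaussian_real (distr \<nu> borel (\<lambda>x. u \<bullet> x)))"

definition covariance_matrix :: "(real ^ 'n) measure \<Rightarrow> real ^ 'n ^ 'n" where
  "covariance_matrix \<nu> =
     (\<chi> i j. \<integral>x. (x $ i - (\<integral>y. y $ i \<partial>\<nu>)) * (x $ j - (\<integral>y. y $ j \<partial>\<nu>)) \<partial>\<nu>)"

text \<open>As every factor of the integrand is at least 1, this class is empty for \<open>M < 1\<close>,
  and for \<open>M = 1\<close> (with \<open>A\<close> invertible) it contains only the point mass at 0.\<close>

definition moment_class ::
  "real ^ 'n ^ 'n \<Rightarrow> real \<Rightarrow> real \<Rightarrow> real \<Rightarrow> (real ^ 'n) measure set" where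
  "moment_class A M p a =
     {\<mu> \<in> space (prob_algebra borel).
        (SUP j. \<integral>\<^sup>+x. ennreal ((1 + \<bar>(A *v x) $ j\<bar> powr (2 * p + a)) *
                  (\<Prod>l\<in>UNIV - {j}. 1 + \<bar>(A *v x) $ l\<bar> powr a)) \<partial>\<mu>) \<le> ennreal M}"

text \<open>A sample of size \<open>n\<close> is a function on \<open>{1..n}\<close>.\<close>

definition estimator :: "(nat \<Rightarrow> (nat \<Rightarrow> 'a::euclidean_space) \<Rightarrow> 'a measure) \<Rightarrow> bool" where
  "estimator T \<longleftrightarrow>
     (\<forall>n\<ge>1. T n \<in> measurable (PiM {1..n} (\<lambda>_. borel)) (prob_algebra borel))"

definition risk ::
  "real \<Rightarrow> 'a::ordered_euclidean_space measure \<Rightarrow>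
     (nat \<Rightarrow> (nat \<Rightarrow> 'a) \<Rightarrow> 'a measure) \<Rightarrow> nat \<Rightarrow> 'a measure \<Rightarrow> ennreal" where
  "risk p \<mu>\<^sub>\<epsilon> T n \<mu> =
     (\<integral>\<^sup>+y. epowr (wasserstein p (T n y) \<mu>) p \<partial>PiM {1..n} (\<lambda>_. convolution \<mu> \<mu>\<^sub>\<epsilon>))"

end

theory Submission
  imports Defs
begin

text \<open>Gaussian noise of standard deviation \<open>\<sigma>\<close> damps the frequency \<open>t\<close> of the law \<open>\<mu>\<close> by the factor
  \<open>exp (- (\<sigma> * t)\<^sup>2 / 2)\<close>. With \<open>n\<close> observations the statistical error is of order \<open>1 / sqrt n\<close>, so only
  frequencies up to order \<open>sqrt (ln n)\<close> can be recovered, and \<open>\<mu>\<close> is determined up to displacements of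
  order \<open>1 / sqrt (ln n)\<close>. This is the rate \<open>(ln n) powr (- p / 2)\<close> for the \<open>p\<close>-th power of the distance. Both
  bounds are proved in the coordinates \<open>A *v x\<close>, in which the noise has independent components.

  \<^bold>\<open>Upper bound.\<close> The estimator is supported on a finite grid. Powers of Dirichlet kernels centred at
  the grid points give a partition of unity \<open>\<psi> i\<close> made of trigonometric polynomials which are concentrated
  near the grid points (\<open>sum_jackson\<close>, \<open>jackson_moment\<close>; the sums over the grid are all evaluated by
  Parseval's identity). Moving \<open>x\<close> to the grid point \<open>i\<close> with probability \<open>\<psi> i x\<close> costs the desired rate
  (\<open>smoothing_cost\<close>). A trigonometric polynomial is deconvolved exactly, by division of its finitely many
  Fourier coefficients by the characteristic function of the noise. Thus the weight \<open>\<integral>x. \<psi> i x \<partial>\<mu>\<close> of the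
  grid point \<open>i\<close> is estimated without bias by a sample mean of a function bounded by \<open>n powr (1 / 4)\<close>,
  if the highest frequency is a small multiple of \<open>sqrt (ln n)\<close>. The number of grid points and their
  diameter are powers of \<open>ln n\<close>, so the errors of the weights contribute less than the smoothing. The two
  errors are combined by one explicit coupling (\<open>wasserstein_le_smoothing_plus_weights\<close>).

  \<^bold>\<open>Lower bound.\<close> Along a direction in which the noise is not degenerate, take a normal law of
  small variance and the law with the same density multiplied by \<open>1 + sin (\<omega> * z)\<close>. After the convolution
  the densities of the observations differ by a factor \<open>1 + O(exp (- (\<tau> * \<omega>)\<^sup>2 / 2))\<close>
  (\<open>modulated_normal_domination\<close>). For a suitable \<open>\<omega>\<close> of order \<open>sqrt (ln n)\<close> the factor is at least
  \<open>1 - 1 / (2 n)\<close>, so that by Bernoulli's inequality the law of the second sample dominates half the law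
  of the first (\<open>PiM_domination\<close>). No estimator tells the two apart (\<open>two_point_risk_bound\<close>), whereas the
  1-Lipschitz function \<open>sin (\<omega> * z) / \<omega>\<close> shows that their distance is of order \<open>1 / \<omega>\<close>.\<close>

section \<open>Trigonometric polynomials on a grid\<close>

definition trig_poly :: "nat \<Rightarrow> (nat \<Rightarrow> real) \<Rightarrow> real \<Rightarrow> complex" where
  "trig_poly G b u = (\<Sum>j<G. of_real (b j) * cis (real j * u))"

text \<open>The offset puts the grid into \<open>[-pi, pi)\<close>, centred at \<open>0\<close>, around which the moment conditions
  concentrate the estimated law.\<close>

definition grid :: "nat \<Rightarrow> nat \<Rightarrow> real" where
  "grid G i = 2 * pi * real i / real G - pi"

lemma norm_trig_poly_square:
  "complex_of_real ((cmod (trig_poly G b u))\<^sup>2) =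
     (\<Sum>j<G. \<Sum>k<G. of_real (b j * b k) * cis ((real j - real k) * u))"
proof -
  have "complex_of_real ((cmod (trig_poly G b u))\<^sup>2) = trig_poly G b u * cnj (trig_poly G b u)"
    by (metis complex_norm_square of_real_power)
  also have "\<dots> = (\<Sum>j<G. \<Sum>k<G. of_real (b j) * cis (real j * u) * (of_real (b k) * cis (- (real k * u))))"
    by (simp add: trig_poly_def sum_product cis_cnj)
  also have "\<dots> = (\<Sum>j<G. \<Sum>k<G. of_real (b j * b k) * cis ((real j - real k) * u))"
  proof (intro sum.cong refl)
    fix j k
    have "cis ((real j - real k) * u) = cis (real j * u) * cis (- (real k * u))"
      by (simp add: cis_mult left_diff_distrib)
    then show "of_real (b j) * cis (real j * u) * (of_real (b k) * cis (- (real k * u))) =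
      of_real (b j * b k) * cis ((real j - real k) * u)" by simp
  qed
  finally show ?thesis .
qed

lemma sum_roots_of_unity:
  assumes "j < G" "k < G" "j \<noteq> k"
  shows "(\<Sum>i<G. cis ((real j - real k) * (2 * pi * real i / real G))) = 0"
proof -
  define w where "w = cis ((real j - real k) * (2 * pi / real G))"
  have G: "G > 0" using assms by auto
  have "w \<noteq> 1"
  proof
    assume "w = 1"
    then have "cos ((real j - real k) * (2 * pi / real G)) = 1"
      by (metis cis.sel(1) one_complex.sel(1) w_def)
    then obtain l :: int where "(real j - real k) * (2 * pi / real G) = of_int l * 2 * pi"
      using cos_one_2pi_int by blast
    then have "(2 * pi) * (real j - real k) = (2 * pi) * (real G * of_int l)" using G by (simp add: field_simps)
    then have "real j - real k = real G * of_int l" by (metis mult_cancel_left pi_neq_zero zero_neq_numeral mult_eq_0_iff)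
    then have *: "int j - int k = int G * l" by (metis of_int_eq_iff of_int_diff of_int_mult of_int_of_nat_eq)
    then have "\<bar>int G * l\<bar> < int G" using assms by linarith
    then have "l = 0" using G by (simp add: abs_mult)
    with * assms show False by simp
  qed
  have "w ^ G = 1"
  proof -
    have "w ^ G = cis (2 * pi * of_int (int j - int k))"
      unfolding w_def Complex.DeMoivre by (rule arg_cong[of _ _ cis]) (use G in \<open>simp add: field_simps\<close>)
    also have "\<dots> = 1" by (rule cis_multiple_2pi) simp
    finally show ?thesis .
  qed
  have "(\<Sum>i<G. cis ((real j - real k) * (2 * pi * real i / real G))) = (\<Sum>i<G. w ^ i)"
    by (intro sum.cong refl) (simp add: w_def Complex.DeMoivre algebra_simps)
  also have "\<dots> = 0" using \<open>w \<noteq> 1\<close> \<open>w ^ G = 1\<close> by (simp add: geometric_sum)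
  finally show ?thesis .
qed

text \<open>The frequencies \<open>j - k\<close> in \<open>\<bar>F\<bar>\<^sup>2\<close> are smaller in absolute value than the number \<open>G\<close> of grid
  points, so the grid average kills all of them except \<open>0\<close>. Hence the sum does not depend on \<open>u\<close>: the
  shifted copies of \<open>\<bar>F\<bar>\<^sup>2\<close> form, up to a constant, a partition of unity.\<close>

lemma parseval_grid:
  "(\<Sum>i<G. (cmod (trig_poly G b (u - grid G i)))\<^sup>2) = real G * (\<Sum>j<G. (b j)\<^sup>2)"
proof -
  let ?f = "\<lambda>i j k. of_real (b j * b k) * cis ((real j - real k) * (u - grid G i)) :: complex"
  have "complex_of_real (\<Sum>i<G. (cmod (trig_poly G b (u - grid G i)))\<^sup>2) =
    (\<Sum>i<G. \<Sum>j<G. \<Sum>k<G. ?f i j k)"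
    unfolding of_real_sum norm_trig_poly_square ..
  also have "\<dots> = (\<Sum>j<G. \<Sum>i<G. \<Sum>k<G. ?f i j k)"
    by (rule sum.swap)
  also have "\<dots> = (\<Sum>j<G. \<Sum>k<G. \<Sum>i<G. ?f i j k)"
    by (intro sum.cong refl sum.swap)
  also have "\<dots> = (\<Sum>j<G. \<Sum>k<G. if k = j then of_real (real G * (b j)\<^sup>2) else 0)"
  proof (intro sum.cong refl)
    fix j k assume "j \<in> {..<G}" "k \<in> {..<G}"
    then have jk: "j < G" "k < G" by auto
    have "(\<Sum>i<G. ?f i j k) =
      (\<Sum>i<G. of_real (b j * b k) * cis ((real j - real k) * (u + pi)) *
         cis ((real k - real j) * (2 * pi * real i / real G)))"
    proof (intro sum.cong refl)
      fix i
      have "(real j - real k) * (u - grid G i) =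
          (real j - real k) * (u + pi) + (real k - real j) * (2 * pi * real i / real G)"
        unfolding grid_def by (simp only: left_diff_distrib right_diff_distrib distrib_left)
      then show "?f i j k =
        of_real (b j * b k) * cis ((real j - real k) * (u + pi)) *
         cis ((real k - real j) * (2 * pi * real i / real G))"
        by (simp only: cis_mult[symmetric] mult.assoc)
    qed
    also have "\<dots> = of_real (b j * b k) * cis ((real j - real k) * (u + pi)) *
        (\<Sum>i<G. cis ((real k - real j) * (2 * pi * real i / real G)))"
      by (simp add: sum_distrib_left)
    also have "\<dots> = (if k = j then of_real (real G * (b j)\<^sup>2) else 0)"
      using sum_roots_of_unity[of k G j] jk by (auto simp: power2_eq_square)
    finally show "(\<Sum>i<G. ?f i j k) =
      (if k = j then of_real (real G * (b j)\<^sup>2) else 0)" .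
  qed
  also have "\<dots> = complex_of_real (real G * (\<Sum>j<G. (b j)\<^sup>2))"
    by (simp add: sum_distrib_left)
  finally show ?thesis by (simp only: of_real_eq_iff)
qed

definition dirichlet :: "nat \<Rightarrow> real \<Rightarrow> complex" where
  "dirichlet N u = (\<Sum>j<N. cis (real j * u))"

lemma trig_poly_mult_dirichlet:
  assumes "\<And>j. b j \<ge> 0"
  shows "\<exists>c. (\<forall>j. c j \<ge> 0) \<and> (\<forall>u. trig_poly G b u * dirichlet N u = trig_poly (G + N) c u)"
proof -
  define S where "S l = {(j, k). j < G \<and> k < N \<and> j + k = l}" for l
  define c where "c l = (\<Sum>x\<in>S l. b (fst x))" for l
  have "trig_poly G b u * dirichlet N u = trig_poly (G + N) c u" for u
  proof -
    have "trig_poly G b u * dirichlet N u =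
        (\<Sum>x\<in>{..<G}\<times>{..<N}. of_real (b (fst x)) * cis (real (fst x + snd x) * u))"
      unfolding trig_poly_def dirichlet_def sum_product sum.cartesian_product
      by (intro sum.cong refl) (auto simp: cis_mult mult.assoc distrib_right)
    also have "\<dots> = (\<Sum>l<G+N. \<Sum>x | x \<in> {..<G}\<times>{..<N} \<and> fst x + snd x = l.
         of_real (b (fst x)) * cis (real (fst x + snd x) * u))"
      by (rule sum.group[symmetric]) auto
    also have "\<dots> = (\<Sum>l<G+N. of_real (c l) * cis (real l * u))"
    proof (intro sum.cong refl)
      fix l
      have "(\<Sum>x | x \<in> {..<G}\<times>{..<N} \<and> fst x + snd x = l.
           of_real (b (fst x)) * cis (real (fst x + snd x) * u)) =
         (\<Sum>x\<in>S l. of_real (b (fst x)) * cis (real l * u))"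
        by (rule sum.cong) (auto simp: S_def)
      also have "\<dots> = of_real (c l) * cis (real l * u)"
        by (simp add: c_def sum_distrib_right)
      finally show "(\<Sum>x | x \<in> {..<G}\<times>{..<N} \<and> fst x + snd x = l.
         of_real (b (fst x)) * cis (real (fst x + snd x) * u)) = of_real (c l) * cis (real l * u)" .
    qed
    finally show ?thesis by (simp add: trig_poly_def)
  qed
  moreover have "c l \<ge> 0" for l unfolding c_def by (intro sum_nonneg) (auto simp: assms)
  ultimately show ?thesis by blast
qed

text \<open>As the coefficients are nonnegative, the sum of their absolute values is the value of the
  polynomial at \<open>0\<close>. It controls the size of the deconvolved kernels.\<close>

lemma dirichlet_power_trig_poly:
  "\<exists>b. (\<forall>j. b j \<ge> 0) \<and> (\<forall>u. dirichlet N u ^ Suc m = trig_poly (Suc m * N) b u)"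
proof (induction m)
  case 0
  show ?case by (intro exI[of _ "\<lambda>_. 1"]) (simp add: dirichlet_def trig_poly_def)
next
  case (Suc m)
  then obtain b where b: "\<And>j. b j \<ge> 0" "\<And>u. dirichlet N u ^ Suc m = trig_poly (Suc m * N) b u"
    by blast
  obtain c where c: "\<And>j. c j \<ge> 0"
    "\<And>u. trig_poly (Suc m * N) b u * dirichlet N u = trig_poly (Suc m * N + N) c u"
    using trig_poly_mult_dirichlet[of b "Suc m * N" N] b(1) by blast
  have "dirichlet N u ^ Suc (Suc m) = trig_poly (Suc (Suc m) * N) c u" for u
    using c(2)[of u] b(2)[of u] by (simp add: algebra_simps)
  then show ?case using c(1) by blast
qed

text \<open>The geometric sum trades a factor of the Dirichlet kernel against the chord
  \<open>\<bar>cis u - 1\<bar>\<close>, which is a smooth substitute for the distance on the circle.\<close>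

lemma dirichlet_telescope: "dirichlet N u * (cis u - 1) = cis (real N * u) - 1"
proof (induction N)
  case (Suc N)
  have "dirichlet (Suc N) u * (cis u - 1) = cis (real N * u) - 1 + cis (real N * u) * (cis u - 1)"
    unfolding Suc[symmetric] by (simp add: dirichlet_def algebra_simps)
  also have "\<dots> = cis (real (Suc N) * u) - 1"
  proof -
    have "cis (real (Suc N) * u) = cis (real N * u) * cis u" by (simp add: cis_mult distrib_right add.commute)
    then show ?thesis by (simp add: right_diff_distrib)
  qed
  finally show ?case .
qed (simp add: dirichlet_def)

lemma dirichlet_times_chord_le: "cmod (dirichlet N u) * cmod (cis u - 1) \<le> 2"
proof -
  have "cmod (dirichlet N u) * cmod (cis u - 1) = cmod (cis (real N * u) - 1)"
    by (metis dirichlet_telescope norm_mult)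
  also have "\<dots> \<le> cmod (cis (real N * u)) + cmod 1" by (rule norm_triangle_ineq4)
  finally show ?thesis by simp
qed

lemma sum_dirichlet_square_grid:
  assumes "N \<le> G"
  shows "(\<Sum>i<G. (cmod (dirichlet N (u - grid G i)))\<^sup>2) = real G * real N"
proof -
  define b where "b j = (if j < N then 1 else 0 :: real)" for j
  have "dirichlet N v = trig_poly G b v" for v
    unfolding dirichlet_def trig_poly_def
    by (rule sum.mono_neutral_cong_left) (use assms in \<open>auto simp: b_def\<close>)
  moreover have "(\<Sum>j<G. (b j)\<^sup>2) = (\<Sum>j<N. 1)"
    by (rule sum.mono_neutral_cong_right) (use assms in \<open>auto simp: b_def\<close>)
  ultimately show ?thesis using parseval_grid[of G b u] by simp
qed

text \<open>The chord vanishes again at \<open>2 pi\<close>, so it bounds the distance only away from there. The range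
  \<open>3 pi / 2\<close> is what is needed to compare a point of \<open>[-pi / 2, pi / 2]\<close> with a grid point of
  \<open>[-pi, pi)\<close>: this is why the grid covers twice the region of interest.\<close>

lemma chord_lower_bound:
  assumes "\<bar>t\<bar> \<le> 3 * pi / 2"
  shows "\<bar>t\<bar> \<le> 3 * pi / 2 * cmod (cis t - 1)"
proof -
  define s where "s = \<bar>t\<bar> / 2"
  have s: "0 \<le> s" "s \<le> 3 * pi / 4" using assms by (auto simp: s_def)
  have chord: "cmod (cis t - 1) = 2 * sin s"
  proof -
    have "(cmod (cis t - 1))\<^sup>2 = (cos t - 1)\<^sup>2 + (sin t)\<^sup>2" by (simp add: cmod_power2)
    also have "\<dots> = 2 - 2 * cos t" using sin_cos_squared_add[of t] by (simp add: power2_eq_square algebra_simps)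
    also have "cos t = cos (2 * s)" by (simp add: s_def)
    also have "2 - 2 * cos (2 * s) = (2 * sin s)\<^sup>2" 
      by (simp add: cos_double_sin power_mult_distrib)
    finally have "(cmod (cis t - 1))\<^sup>2 = (2 * sin s)\<^sup>2" .
    moreover have "sin s \<ge> 0" using s pi_gt_zero by (intro sin_ge_zero) auto
    ultimately show ?thesis by (intro power2_eq_imp_eq[of _ "2 * sin s"]) auto
  qed
  have "sin s \<ge> 2 * s / (3 * pi)"
  proof (cases "s \<le> pi / 6")
    case True
    have "s / 2 \<le> sin s"
    proof -
      have "(\<lambda>x. sin x - x / 2) 0 \<le> (\<lambda>x. sin x - x / 2) s"
      proof (rule DERIV_nonneg_imp_nondecreasing[OF s(1)])
        fix x assume x: "0 \<le> x" "x \<le> s"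
        have "cos (pi / 3) \<le> cos x" using x True by (intro cos_monotone_0_pi_le) auto
        then have "cos x - 1 / 2 \<ge> 0" by (simp add: cos_60)
        moreover have "((\<lambda>x. sin x - x / 2) has_real_derivative cos x - 1 / 2) (at x)"
          by (auto intro!: derivative_eq_intros)
        ultimately show "\<exists>y. ((\<lambda>x. sin x - x / 2) has_real_derivative y) (at x) \<and> 0 \<le> y" by blast
      qed
      then show ?thesis by simp
    qed
    moreover have "2 * s / (3 * pi) \<le> s / 2" using mult_left_mono[of 4 "pi * 3" s] s(1) pi_gt3 by (simp add: field_simps)
    ultimately show ?thesis by linarith
  next
    case False
    have "1 / 2 \<le> sin s"
    proof (cases "s \<le> pi / 2")
      case True
      then show ?thesis using False sin_monotone_2pi_le[of "pi/6" s] by (simp add: sin_30)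
    next
      case F2: False
      have "sin (pi / 6) \<le> sin (pi - s)" using F2 s by (intro sin_monotone_2pi_le) auto
      then show ?thesis by (simp add: sin_30)
    qed
    moreover have "2 * s / (3 * pi) \<le> 1 / 2" using s by (simp add: field_simps)
    ultimately show ?thesis by linarith
  qed
  then have "2 * s \<le> 3 * pi * sin s" by (simp add: field_simps)
  then show ?thesis using chord by (simp add: s_def)
qed

section \<open>Jackson kernels and their deconvolution\<close>

definition jackson_coeff :: "nat \<Rightarrow> nat \<Rightarrow> nat \<Rightarrow> real" where
  "jackson_coeff m N = (SOME b. (\<forall>j. b j \<ge> 0) \<and>
     (\<forall>u. dirichlet N u ^ Suc m = trig_poly (Suc m * N) b u))"

text \<open>By Parseval's identity this is the sum of \<open>\<bar>dirichlet N\<bar> ^ (2 * Suc m)\<close> over the shifted grid.\<close>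

definition jackson_mass :: "nat \<Rightarrow> nat \<Rightarrow> real" where
  "jackson_mass m N = real (Suc m * N) * (\<Sum>j<Suc m * N. (jackson_coeff m N j)\<^sup>2)"

text \<open>Jackson's kernel centred at the \<open>i\<close>-th grid point, scaled so that the kernels of all grid
  points add up to 1. There are \<open>Suc m * N\<close> grid points, one for each Fourier coefficient of
  \<open>dirichlet N ^ Suc m\<close>.\<close>

definition jackson :: "nat \<Rightarrow> nat \<Rightarrow> nat \<Rightarrow> real \<Rightarrow> real" where
  "jackson m N i u = (cmod (dirichlet N (u - grid (Suc m * N) i))) ^ (2 * Suc m) / jackson_mass m N"

lemma
  shows jackson_coeff_nonneg: "jackson_coeff m N j \<ge> 0"
    and dirichlet_power_eq: "dirichlet N u ^ Suc m = trig_poly (Suc m * N) (jackson_coeff m N) u"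
  using someI_ex[OF dirichlet_power_trig_poly[of N m]] unfolding jackson_coeff_def by blast+

lemma norm_dirichlet_power:
  "(cmod (dirichlet N u)) ^ (2 * Suc m) = (cmod (trig_poly (Suc m * N) (jackson_coeff m N) u))\<^sup>2"
  unfolding dirichlet_power_eq[symmetric] by (simp only: norm_power power_mult[symmetric] mult.commute)

lemma sum_dirichlet_power_grid:
  "(\<Sum>i<Suc m * N. (cmod (dirichlet N (u - grid (Suc m * N) i))) ^ (2 * Suc m)) = jackson_mass m N"
  unfolding norm_dirichlet_power jackson_mass_def by (rule parseval_grid)

lemma sum_jackson_coeff: "(\<Sum>j<Suc m * N. jackson_coeff m N j) = real N ^ Suc m"
proof -
  have "complex_of_real (\<Sum>j<Suc m * N. jackson_coeff m N j) = trig_poly (Suc m * N) (jackson_coeff m N) 0"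
    by (simp add: trig_poly_def)
  also have "\<dots> = dirichlet N 0 ^ Suc m" by (simp only: dirichlet_power_eq)
  also have "\<dots> = complex_of_real (real N ^ Suc m)" by (simp add: dirichlet_def)
  finally show ?thesis by (simp only: of_real_eq_iff)
qed

text \<open>The mass does not depend on the shift, so it may be evaluated at a grid point, where the
  kernel centred there already contributes its maximum.\<close>

lemma jackson_mass_lower: 
  assumes "N > 0"
  shows "real N ^ (2 * Suc m) \<le> jackson_mass m N"
proof -
  let ?f = "\<lambda>i. (cmod (dirichlet N (grid (Suc m * N) 0 - grid (Suc m * N) i))) ^ (2 * Suc m)"
  have "real N ^ (2 * Suc m) = ?f 0" by (simp add: dirichlet_def)
  also have "\<dots> \<le> (\<Sum>i<Suc m * N. ?f i)"
    by (rule member_le_sum) (use assms in auto)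
  finally show ?thesis by (simp only: sum_dirichlet_power_grid)
qed

lemma jackson_mass_pos: "N > 0 \<Longrightarrow> jackson_mass m N > 0"
  using jackson_mass_lower[of N m] by (meson less_le_trans of_nat_0_less_iff zero_less_power)

lemma jackson_nonneg: "jackson m N i u \<ge> 0"
  unfolding jackson_def jackson_mass_def by (intro divide_nonneg_nonneg mult_nonneg_nonneg sum_nonneg) auto

lemma sum_jackson: "N > 0 \<Longrightarrow> (\<Sum>i<Suc m * N. jackson m N i u) = 1"
  using jackson_mass_pos[of N m]
  unfolding jackson_def sum_divide_distrib[symmetric] sum_dirichlet_power_grid by simp

text \<open>Each pair of Dirichlet factors absorbs one squared chord; after \<open>m\<close> pairs are used up, the last
  pair is summed by Parseval. So the weights concentrate at distance \<open>1 / N\<close> from \<open>u\<close>, in the sense of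
  moments of order \<open>2 m\<close>.\<close>

lemma sum_jackson_chord:
  assumes "N > 0"
  shows "(\<Sum>i<Suc m * N. jackson m N i u * cmod (cis (u - grid (Suc m * N) i) - 1) ^ (2 * m))
     \<le> 4 ^ m * real (Suc m) / real N ^ (2 * m)"
proof -
  let ?D = "\<lambda>i. cmod (dirichlet N (u - grid (Suc m * N) i))"
  let ?c = "\<lambda>i. cmod (cis (u - grid (Suc m * N) i) - 1)"
  have "?D i ^ (2 * Suc m) * ?c i ^ (2 * m) \<le> 4 ^ m * (?D i)\<^sup>2" for i
  proof -
    have "?D i ^ (2 * Suc m) * ?c i ^ (2 * m) = (?D i * ?c i) ^ (2 * m) * (?D i)\<^sup>2"
      by (simp add: power_mult_distrib power2_eq_square)
    also have "\<dots> \<le> 2 ^ (2 * m) * (?D i)\<^sup>2"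
      by (intro mult_right_mono power_mono dirichlet_times_chord_le) auto
    finally show ?thesis by (simp add: power_mult)
  qed
  then have "(\<Sum>i<Suc m * N. ?D i ^ (2 * Suc m) * ?c i ^ (2 * m)) \<le> (\<Sum>i<Suc m * N. 4 ^ m * (?D i)\<^sup>2)"
    by (rule sum_mono)
  also have "\<dots> = 4 ^ m * (real (Suc m * N) * real N)"
    by (subst sum_distrib_left[symmetric], subst sum_dirichlet_square_grid) auto
  finally have *: "(\<Sum>i<Suc m * N. ?D i ^ (2 * Suc m) * ?c i ^ (2 * m)) \<le> 4 ^ m * (real (Suc m * N) * real N)" .
  have "(\<Sum>i<Suc m * N. jackson m N i u * ?c i ^ (2 * m)) =
    (\<Sum>i<Suc m * N. ?D i ^ (2 * Suc m) * ?c i ^ (2 * m)) / jackson_mass m N"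
    unfolding jackson_def sum_divide_distrib by simp
  also have "\<dots> \<le> 4 ^ m * (real (Suc m * N) * real N) / real N ^ (2 * Suc m)"
    by (rule frac_le[OF _ * _ jackson_mass_lower[OF assms]]) (use assms in auto)
  also have "\<dots> = 4 ^ m * real (Suc m) / real N ^ (2 * m)"
    using assms by (simp add: field_simps)
  finally show ?thesis .
qed

definition jackson_const :: "nat \<Rightarrow> real" where
  "jackson_const m = 1 + (3 * pi / 2) ^ (2 * m) * 4 ^ m * real (Suc m)"

lemma abs_grid_le: 
  assumes "i < G" shows "\<bar>grid G i\<bar> \<le> pi"
proof -
  have "real i / real G \<le> 1" using assms by (simp add: divide_le_eq)
  then have "pi * (real i / real G) \<le> pi * 1" by (intro mult_left_mono) auto
  moreover have "0 \<le> pi * (real i / real G)" by simp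
  ultimately show ?thesis unfolding grid_def by (simp add: abs_le_iff)
qed

text \<open>Moments of order \<open>p \<le> 2 m\<close> follow from \<open>x powr p \<le> 1 + x ^ (2 * m)\<close>, applied to \<open>N\<close> times the
  distance.\<close>

lemma jackson_moment:
  assumes N: "N > 0" and u: "\<bar>u\<bar> \<le> pi / 2" and p: "0 < p" "p \<le> 2 * real m"
  shows "(\<Sum>i<Suc m * N. jackson m N i u * \<bar>u - grid (Suc m * N) i\<bar> powr p)
     \<le> jackson_const m / real N powr p"
proof -
  let ?G = "Suc m * N"
  let ?c = "\<lambda>i. cmod (cis (u - grid ?G i) - 1)" and ?d = "\<lambda>i. \<bar>u - grid ?G i\<bar>"
  have pw: "(real N * ?d i) powr p \<le>
    1 + real N ^ (2 * m) * ((3 * pi / 2) ^ (2 * m) * ?c i ^ (2 * m))"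
    if "i < ?G" for i
  proof -
    let ?t = "?d i"
    have "?t \<le> 3 * pi / 2" using u abs_grid_le[OF that] by linarith
    then have t: "?t \<le> 3 * pi / 2 * ?c i" by (rule chord_lower_bound)
    have "(real N * ?t) powr p \<le> 1 + (real N * ?t) ^ (2 * m)"
    proof (cases "real N * ?t \<le> 1")
      case True
      then have "(real N * ?t) powr p \<le> 1" using p by (simp add: powr_le1)
      then show ?thesis by (simp add: add_increasing2)
    next
      case False
      then have "(real N * ?t) powr p \<le> (real N * ?t) powr real (2 * m)"
        using p by (intro powr_mono) auto
      then show ?thesis using False by (subst (asm) powr_realpow) auto
    qed
    also have "(real N * ?t) ^ (2 * m) = real N ^ (2 * m) * ?t ^ (2 * m)" by (simp only: power_mult_distrib)
    also have "?t ^ (2 * m) \<le> (3 * pi / 2 * ?c i) ^ (2 * m)"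
      by (intro power_mono t) auto
    also have "\<dots> = (3 * pi / 2) ^ (2 * m) * ?c i ^ (2 * m)"
      by (simp only: power_mult_distrib)
    finally show ?thesis by (simp add: mult_left_mono)
  qed
  have "real N powr p * (\<Sum>i<?G. jackson m N i u * ?d i powr p) =
    (\<Sum>i<?G. jackson m N i u * (real N * ?d i) powr p)"
    unfolding sum_distrib_left by (simp add: powr_mult mult.left_commute)
  also have "\<dots> \<le> (\<Sum>i<?G. jackson m N i u * (1 + real N ^ (2 * m) * ((3 * pi / 2) ^ (2 * m) *
        ?c i ^ (2 * m))))"
    by (intro sum_mono mult_left_mono pw jackson_nonneg) auto
  also have "\<dots> = (\<Sum>i<?G. jackson m N i u) + real N ^ (2 * m) * ((3 * pi / 2) ^ (2 * m) * 
     (\<Sum>i<?G. jackson m N i u * ?c i ^ (2 * m)))"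
    by (simp only: distrib_left sum.distrib sum_distrib_left mult_1_right mult_1_left mult_ac)
  also have "\<dots> \<le> 1 + real N ^ (2 * m) * ((3 * pi / 2) ^ (2 * m) * (4 ^ m * real (Suc m) / real N ^ (2 * m)))"
    unfolding sum_jackson[OF N]
    by (intro add_left_mono mult_left_mono sum_jackson_chord N) auto
  also have "\<dots> = jackson_const m" using N by (simp add: jackson_const_def)
  finally show ?thesis using N by (simp add: field_simps)
qed

definition jackson_weight :: "nat \<Rightarrow> nat \<Rightarrow> nat \<Rightarrow> nat \<Rightarrow> real" where
  "jackson_weight m N j k = jackson_coeff m N j * jackson_coeff m N k / jackson_mass m N"

lemma jackson_weight_nonneg: "jackson_weight m N j k \<ge> 0"
  unfolding jackson_weight_def jackson_mass_def
  by (intro divide_nonneg_nonneg mult_nonneg_nonneg sum_nonneg jackson_coeff_nonneg) auto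

lemma sum_jackson_weight_le: 
  assumes "N > 0" shows "(\<Sum>j<Suc m * N. \<Sum>k<Suc m * N. jackson_weight m N j k) \<le> 1"
proof -
  have "(\<Sum>j<Suc m * N. \<Sum>k<Suc m * N. jackson_weight m N j k) =
    (\<Sum>j<Suc m * N. jackson_coeff m N j)\<^sup>2 / jackson_mass m N"
    unfolding jackson_weight_def sum_divide_distrib[symmetric] power2_eq_square sum_product ..
  also have "\<dots> = real N ^ (2 * Suc m) / jackson_mass m N"
    unfolding sum_jackson_coeff by (simp only: power_mult[symmetric] mult.commute)
  also have "\<dots> \<le> 1" using jackson_mass_lower[OF assms, of m] jackson_mass_pos[OF assms, of m] by simp
  finally show ?thesis .
qed

lemma jackson_fourier:
  "complex_of_real (jackson m N i u) = (\<Sum>j<Suc m * N. \<Sum>k<Suc m * N.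
     of_real (jackson_weight m N j k) * cis ((real j - real k) * (u - grid (Suc m * N) i)))"
  unfolding jackson_def norm_dirichlet_power of_real_divide norm_trig_poly_square
    sum_divide_distrib jackson_weight_def by simp

text \<open>The inverse filter: each Fourier coefficient of Jackson's kernel on the scale \<open>1 / \<theta>\<close> is divided
  by the characteristic function \<open>cf\<close> of the noise at its frequency.\<close>

definition deconv_jackson ::
  "(real \<Rightarrow> complex) \<Rightarrow> nat \<Rightarrow> nat \<Rightarrow> real \<Rightarrow> nat \<Rightarrow> real \<Rightarrow> complex" where
  "deconv_jackson cf m N \<theta> i z = (\<Sum>j<Suc m * N. \<Sum>k<Suc m * N.
     of_real (jackson_weight m N j k) *
     cis ((real j - real k) * (\<theta> * z - grid (Suc m * N) i)) / cf ((real j - real k) * \<theta>))"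

lemma borel_measurable_cis [measurable]: "cis \<in> borel_measurable borel"
  by (intro borel_measurable_continuous_onI continuous_intros)

lemma deconv_jackson_measurable [measurable]:
  "deconv_jackson cf m N \<theta> i \<in> borel_measurable borel"
  unfolding deconv_jackson_def by measurable

text \<open>Averaging \<open>cis (t * (z + e))\<close> over the noise multiplies it by the characteristic function at
  \<open>t\<close>, which undoes the division.\<close>

lemma deconv_jackson_integral:
  assumes "prob_space \<nu>" and [measurable_cong]: "sets \<nu> = sets borel"
    and nz: "\<And>t. char \<nu> t \<noteq> 0"
  shows "(\<integral>e. deconv_jackson (char \<nu>) m N \<theta> i (z + e) \<partial>\<nu>) = of_real (jackson m N i (\<theta> * z))"
proof -
  interpret prob_space \<nu> by fact
  have int: "integrable \<nu> (\<lambda>e. cis (a + t * e))" for a t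
    by (rule integrable_const_bound[of _ 1]) auto
  have char: "(\<integral>e. cis (a + t * e) \<partial>\<nu>) = cis a * char \<nu> t" for a t
    unfolding char_def cis_mult[symmetric] by (simp add: cis_conv_exp)
  have "(\<integral>e. deconv_jackson (char \<nu>) m N \<theta> i (z + e) \<partial>\<nu>) =
    (\<integral>e. (\<Sum>j<Suc m * N. \<Sum>k<Suc m * N. of_real (jackson_weight m N j k) *
     (cis ((real j - real k) * (\<theta> * z - grid (Suc m * N) i) + (real j - real k) * \<theta> * e) /
        char \<nu> ((real j - real k) * \<theta>))) \<partial>\<nu>)"
    unfolding deconv_jackson_def
    by (intro Bochner_Integration.integral_cong refl sum.cong) (simp add: algebra_simps)
  also have "\<dots> = (\<Sum>j<Suc m * N. \<Sum>k<Suc m * N. of_real (jackson_weight m N j k) *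
     (cis ((real j - real k) * (\<theta> * z - grid (Suc m * N) i)) * char \<nu> ((real j - real k) * \<theta>) /
        char \<nu> ((real j - real k) * \<theta>)))"
    by (subst Bochner_Integration.integral_sum | simp add: int char nz)+
  also have "\<dots> = of_real (jackson m N i (\<theta> * z))"
    unfolding jackson_fourier nonzero_mult_div_cancel_right[OF nz] ..
  finally show ?thesis .
qed

text \<open>The absolute values of the coefficients of Jackson's kernel have total at most 1, so the price of the
  deconvolution is the inverse of the noise characteristic function at the highest frequency.\<close>

lemma deconv_jackson_bound:
  assumes N: "N > 0" and cf: "\<And>t. exp (- (s * t\<^sup>2)) \<le> cmod (cf t)" and s: "s \<ge> 0"
  shows "cmod (deconv_jackson cf m N \<theta> i z) \<le> exp (s * (real (Suc m * N) * \<theta>)\<^sup>2)"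
proof -
  let ?G = "Suc m * N"
  let ?E = "exp (s * (real ?G * \<theta>)\<^sup>2)"
  have "cmod (deconv_jackson cf m N \<theta> i z) \<le>
     (\<Sum>j<?G. \<Sum>k<?G. jackson_weight m N j k * ?E)"
    unfolding deconv_jackson_def
  proof (intro sum_norm_le)
    fix j k assume jk: "j \<in> {..<?G}" "k \<in> {..<?G}"
    have jk': "\<bar>real j - real k\<bar> \<le> real ?G" 
      using jk by (simp only: lessThan_iff)
    have "((real j - real k) * \<theta>)\<^sup>2 \<le> (real ?G * \<theta>)\<^sup>2"
      unfolding power_mult_distrib using power_mono[OF jk', of 2] by (intro mult_right_mono) simp_all
    then have "exp (- (s * (real ?G * \<theta>)\<^sup>2)) \<le> exp (- (s * ((real j - real k) * \<theta>)\<^sup>2))"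
      using s by (simp add: mult_left_mono)
    also note cf
    finally have "1 / cmod (cf ((real j - real k) * \<theta>)) \<le> 1 / exp (- (s * (real ?G * \<theta>)\<^sup>2))"
      by (intro divide_left_mono) (auto intro!: mult_pos_pos intro: less_le_trans[OF exp_gt_zero])
    then have inv: "1 / cmod (cf ((real j - real k) * \<theta>)) \<le> ?E"
      by (simp add: exp_minus field_simps)
    show "cmod (of_real (jackson_weight m N j k) *
        cis ((real j - real k) * (\<theta> * z - grid ?G i)) / cf ((real j - real k) * \<theta>))
      \<le> jackson_weight m N j k * ?E"
      using mult_left_mono[OF inv jackson_weight_nonneg[of m N j k]] jackson_weight_nonneg[of m N j k]
      by (simp add: norm_mult norm_divide del: mult_Suc of_nat_mult)
  qed
  also have "\<dots> = (\<Sum>j<?G. \<Sum>k<?G. jackson_weight m N j k) * ?E"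
    by (simp only: sum_distrib_right)
  also have "\<dots> \<le> 1 * ?E"
    by (intro mult_right_mono sum_jackson_weight_le N) auto
  finally show ?thesis by simp
qed

section \<open>Couplings with a finitely supported law\<close>

definition finite_dist :: "'i set \<Rightarrow> ('i \<Rightarrow> real) \<Rightarrow> ('i \<Rightarrow> 'a::euclidean_space) \<Rightarrow> 'a measure" where
  "finite_dist I w z = distr (point_measure I (\<lambda>i. ennreal (w i))) borel z"

lemma epowr_mono: "x \<le> y \<Longrightarrow> s \<ge> 0 \<Longrightarrow> epowr x s \<le> epowr y s"
  unfolding epowr_def
  by (auto simp: less_top intro!: ennreal_leI powr_mono2 enn2real_mono)

lemma epowr_epowr_inverse: "p > 0 \<Longrightarrow> epowr (epowr x (1 / p)) p = x"
  by (cases x) (auto simp: epowr_def powr_powr)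

lemma emeasure_finite_dist:
  assumes "finite I" "A \<in> sets borel" "\<And>i. i \<in> I \<Longrightarrow> w i \<ge> 0"
  shows "emeasure (finite_dist I w z) A = ennreal (\<Sum>i\<in>I. w i * indicator A (z i))"
proof -
  have "emeasure (finite_dist I w z) A = emeasure (point_measure I (\<lambda>i. ennreal (w i))) (z -` A \<inter> I)"
    unfolding finite_dist_def using assms by (subst emeasure_distr) (auto simp: space_point_measure)
  also have "\<dots> = (\<Sum>i\<in>z -` A \<inter> I. ennreal (w i))"
    using assms by (subst emeasure_point_measure_finite2) auto
  also have "\<dots> = (\<Sum>i\<in>I. ennreal (w i * indicator A (z i)))"
    using assms by (intro sum.mono_neutral_cong_left) (auto simp: indicator_def)
  also have "\<dots> = ennreal (\<Sum>i\<in>I. w i * indicator A (z i))"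
    using assms by (intro sum_ennreal) auto
  finally show ?thesis .
qed

lemma finite_dist_prob:
  assumes "finite I" "\<And>i. i \<in> I \<Longrightarrow> w i \<ge> 0" "(\<Sum>i\<in>I. w i) = 1"
  shows "prob_space (finite_dist I w z)"
proof (rule prob_spaceI)
  have "space (finite_dist I w z) = UNIV" by (simp add: finite_dist_def)
  then show "emeasure (finite_dist I w z) (space (finite_dist I w z)) = 1"
    using assms by (simp add: emeasure_finite_dist)
qed

text \<open>What makes a random weighting of fixed points a measurable map into the space of probability
  measures, hence an estimator.\<close>

lemma finite_dist_measurable:
  fixes z :: "'i \<Rightarrow> 'a::euclidean_space"
  assumes "finite I" and [measurable]: "\<And>i. i \<in> I \<Longrightarrow> (\<lambda>y. w y i) \<in> borel_measurable M"
    and "\<And>y i. y \<in> space M \<Longrightarrow> i \<in> I \<Longrightarrow> w y i \<ge> 0"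
    and "\<And>y. y \<in> space M \<Longrightarrow> (\<Sum>i\<in>I. w y i) = 1"
  shows "(\<lambda>y. finite_dist I (w y) z) \<in> measurable M (prob_algebra borel)"
proof (rule measurable_prob_algebra_generated[where \<Omega>=UNIV and G="sets borel"])
  show "sets (borel :: 'a measure) = sigma_sets UNIV (sets borel)"
    using sets.sigma_sets_eq[of "borel :: 'a measure"] by simp
  show "Int_stable (sets (borel :: 'a measure))" by (rule sets.Int_stable)
  show "sets borel \<subseteq> Pow (UNIV :: 'a set)" by simp
  show "prob_space (finite_dist I (w y) z)" if "y \<in> space M" for y
    using assms that by (intro finite_dist_prob) auto
  show "sets (finite_dist I (w y) z) = sets borel" for y by (simp add: finite_dist_def)
  fix A :: "'a set" assume A: "A \<in> sets borel"
  have "(\<lambda>y. emeasure (finite_dist I (w y) z) A) \<in> borel_measurable M \<longleftrightarrow>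
    (\<lambda>y. ennreal (\<Sum>i\<in>I. w y i * indicator A (z i))) \<in> borel_measurable M"
    by (intro measurable_cong emeasure_finite_dist assms A)
  also have "\<dots>" by measurable
  finally show "(\<lambda>y. emeasure (finite_dist I (w y) z) A) \<in> borel_measurable M" .
qed

text \<open>The weights \<open>\<kappa> i x\<close> are read as a Markov kernel that moves \<open>x\<close> to the point \<open>z i\<close> with
  probability \<open>\<kappa> i x\<close>; together with \<open>\<mu>\<close> it is a coupling.\<close>

lemma wasserstein_le_kernel_cost:
  fixes z :: "'i \<Rightarrow> 'a::euclidean_space"
  assumes "prob_space \<mu>" and sets: "sets \<mu> = sets borel" and p: "p > 0"
    and I: "finite I"
    and [measurable]: "\<And>i. i \<in> I \<Longrightarrow> \<kappa> i \<in> borel_measurable borel"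
    and nonneg: "\<And>i x. i \<in> I \<Longrightarrow> \<kappa> i x \<ge> 0"
    and sum1: "\<And>x. (\<Sum>i\<in>I. \<kappa> i x) = 1"
    and w: "\<And>i. i \<in> I \<Longrightarrow> (\<integral>x. \<kappa> i x \<partial>\<mu>) = w i"
  shows "epowr (wasserstein p (finite_dist I w z) \<mu>) p
      \<le> (\<integral>\<^sup>+x. ennreal (\<Sum>i\<in>I. \<kappa> i x * norm (z i - x) powr p) \<partial>\<mu>)"
proof -
  interpret prob_space \<mu> by fact
  note [measurable_cong] = sets
  define \<pi>0 where "\<pi>0 = density (count_space I \<Otimes>\<^sub>M \<mu>) (\<lambda>(i, x). ennreal (\<kappa> i x))"
  define \<pi> where "\<pi> = distr \<pi>0 borel (\<lambda>(i, x). (z i, x))"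
  have [measurable]: "(\<lambda>(i, x). ennreal (\<kappa> i x)) \<in> borel_measurable (count_space I \<Otimes>\<^sub>M \<mu>)"
    by (rule measurable_pair_measure_countable1) (use I in \<open>auto intro: countable_finite\<close>)
  have meas_z: "(\<lambda>(i, x). (z i, x)) \<in> measurable (count_space I \<Otimes>\<^sub>M \<mu>) (borel \<Otimes>\<^sub>M borel)"
  proof -
    have "(\<lambda>v. z (fst v)) \<in> measurable (count_space I \<Otimes>\<^sub>M \<mu>) borel"
      by (rule measurable_compose[OF measurable_fst]) simp
    moreover have "snd \<in> measurable (count_space I \<Otimes>\<^sub>M \<mu>) borel"
      using measurable_snd[of "count_space I" \<mu>] measurable_cong_sets[OF refl sets] by blast
    ultimately show ?thesis unfolding split_def by (rule measurable_Pair)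
  qed
  then have meas_z' [measurable]: "(\<lambda>(i, x). (z i, x)) \<in> measurable (count_space I \<Otimes>\<^sub>M \<mu>) borel"
    by (simp add: borel_prod)
  have integral_\<pi>: "(\<integral>\<^sup>+v. f v \<partial>\<pi>) = (\<Sum>i\<in>I. \<integral>\<^sup>+x. ennreal (\<kappa> i x) * f (z i, x) \<partial>\<mu>)"
    if [measurable]: "f \<in> borel_measurable borel" for f :: "'a \<times> 'a \<Rightarrow> ennreal"
  proof -
    have "(\<integral>\<^sup>+v. f v \<partial>\<pi>) = (\<integral>\<^sup>+v. f (case v of (i, x) \<Rightarrow> (z i, x)) \<partial>\<pi>0)"
      unfolding \<pi>_def \<pi>0_def by (rule nn_integral_distr) measurable
    also have "\<dots> = (\<integral>\<^sup>+v. (case v of (i, x) \<Rightarrow> ennreal (\<kappa> i x)) * f (case v of (i, x) \<Rightarrow> (z i, x)) \<partial>(count_space I \<Otimes>\<^sub>M \<mu>))"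
      unfolding \<pi>0_def by (rule nn_integral_density) measurable
    also have "\<dots> = (\<integral>\<^sup>+i. \<integral>\<^sup>+x. ennreal (\<kappa> i x) * f (z i, x) \<partial>\<mu> \<partial>count_space I)"
      by (subst nn_integral_fst[symmetric]) (simp_all)
    also have "\<dots> = (\<Sum>i\<in>I. \<integral>\<^sup>+x. ennreal (\<kappa> i x) * f (z i, x) \<partial>\<mu>)"
      using I by (rule nn_integral_count_space_finite)
    finally show ?thesis .
  qed
  have \<kappa>_le1: "\<kappa> i x \<le> 1" if "i \<in> I" for i x
    using member_le_sum[of i I "\<lambda>i. \<kappa> i x"] that I nonneg sum1[of x] by auto
  have int: "integrable \<mu> (\<kappa> i)" if "i \<in> I" for i
    using that nonneg \<kappa>_le1 by (intro integrable_const_bound[of _ 1]) auto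
  have nn_w: "(\<integral>\<^sup>+x. ennreal (\<kappa> i x) \<partial>\<mu>) = ennreal (w i)" if "i \<in> I" for i
    using nn_integral_eq_integral[OF int] that nonneg w by simp
  have w_nonneg: "w i \<ge> 0" if "i \<in> I" for i
    using w[OF that] nonneg that by (metis Bochner_Integration.integral_nonneg)
  have snd_marg: "(\<Sum>i\<in>I. \<integral>\<^sup>+x. ennreal (\<kappa> i x) * g x \<partial>\<mu>) = (\<integral>\<^sup>+x. g x \<partial>\<mu>)"
    if [measurable]: "g \<in> borel_measurable borel" for g :: "'a \<Rightarrow> ennreal"
  proof -
    have "(\<Sum>i\<in>I. \<integral>\<^sup>+x. ennreal (\<kappa> i x) * g x \<partial>\<mu>) = (\<integral>\<^sup>+x. (\<Sum>i\<in>I. ennreal (\<kappa> i x) * g x) \<partial>\<mu>)"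
      by (rule nn_integral_sum[symmetric]) measurable
    also have "\<dots> = (\<integral>\<^sup>+x. g x \<partial>\<mu>)"
      by (intro nn_integral_cong) (simp add: sum_distrib_right[symmetric] sum_ennreal nonneg sum1)
    finally show ?thesis .
  qed
  have "sets \<pi> = sets borel" by (simp add: \<pi>_def)
  have "distr \<pi> borel snd = \<mu>"
  proof (rule measure_eqI)
    fix A :: "'a set" assume "A \<in> sets (distr \<pi> borel snd)"
    then have [measurable]: "A \<in> sets borel" by simp
    have "emeasure (distr \<pi> borel snd) A = (\<integral>\<^sup>+v. indicator A v \<partial>distr \<pi> borel snd)"
      by (rule nn_integral_indicator[symmetric]) simp
    also have "\<dots> = (\<integral>\<^sup>+v. indicator A (snd v) \<partial>\<pi>)"
      by (rule nn_integral_distr) (simp_all add: \<pi>_def borel_measurable_continuous_onI continuous_on_snd continuous_on_id)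
    also have "\<dots> = (\<Sum>i\<in>I. \<integral>\<^sup>+x. ennreal (\<kappa> i x) * indicator A x \<partial>\<mu>)"
      by (subst integral_\<pi>) (simp_all add: borel_prod[symmetric])
    also have "\<dots> = (\<integral>\<^sup>+x. indicator A x \<partial>\<mu>)" by (rule snd_marg) simp
    finally show "emeasure (distr \<pi> borel snd) A = emeasure \<mu> A" by (simp add: sets)
  qed (simp add: sets)
  have "distr \<pi> borel fst = finite_dist I w z"
  proof (rule measure_eqI)
    fix A :: "'a set" assume "A \<in> sets (distr \<pi> borel fst)"
    then have [measurable]: "A \<in> sets borel" by simp
    have "emeasure (distr \<pi> borel fst) A = (\<integral>\<^sup>+v. indicator A v \<partial>distr \<pi> borel fst)"
      by (rule nn_integral_indicator[symmetric]) simp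
    also have "\<dots> = (\<integral>\<^sup>+v. indicator A (fst v) \<partial>\<pi>)"
      by (rule nn_integral_distr) (simp_all add: \<pi>_def borel_measurable_continuous_onI continuous_on_fst continuous_on_id)
    also have "\<dots> = (\<Sum>i\<in>I. \<integral>\<^sup>+x. ennreal (\<kappa> i x) * indicator A (z i) \<partial>\<mu>)"
      by (subst integral_\<pi>) (simp_all add: borel_prod[symmetric])
    also have "\<dots> = (\<Sum>i\<in>I. ennreal (w i * indicator A (z i)))"
      by (intro sum.cong refl) 
         (auto simp: nn_integral_multc nn_w ennreal_mult w_nonneg indicator_def)
    also have "\<dots> = emeasure (finite_dist I w z) A"
      using I w_nonneg by (simp add: emeasure_finite_dist sum_ennreal)
    finally show "emeasure (distr \<pi> borel fst) A = emeasure (finite_dist I w z) A" .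
  qed (simp add: finite_dist_def)
  have "prob_space \<pi>"
  proof (rule prob_spaceI)
    have "emeasure \<pi> (space \<pi>) = (\<integral>\<^sup>+v. 1 \<partial>\<pi>)" by simp
    also have "\<dots> = (\<Sum>i\<in>I. \<integral>\<^sup>+x. ennreal (\<kappa> i x) * 1 \<partial>\<mu>)" by (rule integral_\<pi>) simp
    also have "\<dots> = (\<integral>\<^sup>+x. 1 \<partial>\<mu>)" by (rule snd_marg) simp
    finally show "emeasure \<pi> (space \<pi>) = 1" by (simp add: emeasure_space_1)
  qed
  have "\<pi> \<in> couplings (finite_dist I w z) \<mu>"
    unfolding couplings_def by (simp add: space_prob_algebra) (intro conjI; fact)
  then have "wasserstein p (finite_dist I w z) \<mu> \<le>
      epowr (\<integral>\<^sup>+(x, y). ennreal (norm (x - y) powr p) \<partial>\<pi>) (1 / p)"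
    unfolding wasserstein_def by (rule INF_lower)
  then have "epowr (wasserstein p (finite_dist I w z) \<mu>) p \<le>
      epowr (epowr (\<integral>\<^sup>+(x, y). ennreal (norm (x - y) powr p) \<partial>\<pi>) (1 / p)) p"
    using p by (intro epowr_mono) auto
  also have "\<dots> = (\<integral>\<^sup>+(x, y). ennreal (norm (x - y) powr p) \<partial>\<pi>)"
    using p by (rule epowr_epowr_inverse)
  also have "\<dots> = (\<Sum>i\<in>I. \<integral>\<^sup>+x. ennreal (\<kappa> i x) * ennreal (norm (z i - x) powr p) \<partial>\<mu>)"
    by (subst integral_\<pi>) (simp_all add: borel_prod[symmetric])
  also have "\<dots> = (\<integral>\<^sup>+x. (\<Sum>i\<in>I. ennreal (\<kappa> i x) * ennreal (norm (z i - x) powr p)) \<partial>\<mu>)"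
    by (rule nn_integral_sum[symmetric]) measurable
  also have "\<dots> = (\<integral>\<^sup>+x. ennreal (\<Sum>i\<in>I. \<kappa> i x * norm (z i - x) powr p) \<partial>\<mu>)"
    by (intro nn_integral_cong, subst sum_ennreal[symmetric]) (auto simp: ennreal_mult nonneg)
  finally show ?thesis .
qed

lemma powr_add_le:
  fixes a b p :: real
  assumes "a \<ge> 0" "b \<ge> 0" "p \<ge> 0"
  shows "(a + b) powr p \<le> 2 powr p * (a powr p + b powr p)"
proof -
  have "(a + b) powr p \<le> (2 * max a b) powr p" using assms by (intro powr_mono2) auto
  also have "\<dots> = 2 powr p * max a b powr p" using assms by (simp add: powr_mult)
  also have "max a b powr p \<le> a powr p + b powr p" by (auto simp: max_def)
  finally show ?thesis by simp
qed

text \<open>First \<open>x\<close> is sent to the node \<open>z i\<close> with probability \<open>\<psi> i x\<close>, which gives node \<open>i\<close> the mass \<open>q i\<close>, the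
  integral of \<open>\<psi> i\<close>. If \<open>q i > w i\<close>, the fraction \<open>f i\<close> of the mass that is in excess is taken away and
  redistributed over the nodes with \<open>w k > q k\<close> in the proportions \<open>\<rho>\<close>. Both steps are done by the single
  kernel \<open>\<kappa>\<close>, so the distance is bounded by the cost of one coupling: the smoothing cost, and the
  diameter for the redistributed mass, which is at most \<open>\<Sum> \<bar>w i - q i\<bar>\<close>.\<close>

lemma wasserstein_le_smoothing_plus_weights:
  fixes z :: "'i \<Rightarrow> 'a::euclidean_space"
  assumes prob: "prob_space \<mu>" and sets: "sets \<mu> = sets borel" and p: "p > 0"
    and I: "finite I"
    and meas [measurable]: "\<And>i. i \<in> I \<Longrightarrow> \<psi> i \<in> borel_measurable borel"
    and nonneg: "\<And>i x. i \<in> I \<Longrightarrow> \<psi> i x \<ge> 0"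
    and sum1: "\<And>x. (\<Sum>i\<in>I. \<psi> i x) = 1"
    and w: "\<And>i. i \<in> I \<Longrightarrow> w i \<ge> 0" "(\<Sum>i\<in>I. w i) = 1"
    and D: "\<And>i k. i \<in> I \<Longrightarrow> k \<in> I \<Longrightarrow> norm (z k - z i) \<le> D" "D \<ge> 0"
  shows "epowr (wasserstein p (finite_dist I w z) \<mu>) p
      \<le> ennreal (1 + 2 powr p) * (\<integral>\<^sup>+x. ennreal (\<Sum>i\<in>I. \<psi> i x * norm (z i - x) powr p) \<partial>\<mu>)
        + ennreal (2 powr p * D powr p * (\<Sum>i\<in>I. \<bar>w i - (\<integral>x. \<psi> i x \<partial>\<mu>)\<bar>))"
proof -
  interpret prob_space \<mu> by fact
  note [measurable_cong] = sets
  have \<psi>_le1: "\<psi> i x \<le> 1" if "i \<in> I" for i x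
    using member_le_sum[of i I "\<lambda>i. \<psi> i x"] that I nonneg sum1[of x] by auto
  have int: "integrable \<mu> (\<psi> i)" if "i \<in> I" for i
    using that nonneg \<psi>_le1 by (intro integrable_const_bound[of _ 1]) auto
  define q where "q i = (\<integral>x. \<psi> i x \<partial>\<mu>)" for i
  have q_nonneg: "q i \<ge> 0" if "i \<in> I" for i
    unfolding q_def using nonneg that by (metis Bochner_Integration.integral_nonneg)
  have q_sum: "(\<Sum>i\<in>I. q i) = 1"
    unfolding q_def by (subst Bochner_Integration.integral_sum[symmetric]) (auto simp: int sum1 prob_space)
  define f where "f i = (q i - min (q i) (w i)) / q i" for i
  define \<tau> where "\<tau> = (\<Sum>i\<in>I. q i - min (q i) (w i))"
  define \<rho> where "\<rho> k = (w k - min (q k) (w k)) / \<tau>" for k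
  define \<kappa> where "\<kappa> k x = \<psi> k x * (1 - f k) + (\<Sum>i\<in>I. \<psi> i x * f i) * \<rho> k" for k x
  have \<tau>_eq: "\<tau> = (\<Sum>i\<in>I. w i - min (q i) (w i))"
    unfolding \<tau>_def sum_subtractf by (simp add: w q_sum)
  have \<tau>_nonneg: "\<tau> \<ge> 0" unfolding \<tau>_def by (intro sum_nonneg) auto
  have f: "0 \<le> f i" "f i \<le> 1" "q i * f i = q i - min (q i) (w i)" if "i \<in> I" for i
    using q_nonneg[OF that] w(1)[OF that] unfolding f_def
    by (auto simp: divide_simps min_def)
  have \<rho>: "\<rho> k \<ge> 0" for k unfolding \<rho>_def using \<tau>_nonneg by auto
  have \<tau>\<rho>: "\<tau> * \<rho> k = w k - min (q k) (w k)" if "k \<in> I" for k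
  proof (cases "\<tau> = 0")
    case True
    then have "w k - min (q k) (w k) = 0"
      using that I sum_nonneg_eq_0_iff[of I "\<lambda>i. w i - min (q i) (w i)"] unfolding \<tau>_eq by auto
    then show ?thesis using True by simp
  qed (simp add: \<rho>_def)
  have \<rho>_sum: "(\<Sum>k\<in>I. \<rho> k) = 1" if "\<tau> \<noteq> 0"
    unfolding \<rho>_def sum_divide_distrib[symmetric] \<tau>_eq[symmetric] using that by simp
  have \<rho>_sum_le: "(\<Sum>k\<in>I. \<rho> k) \<le> 1"
    using \<rho>_sum by (cases "\<tau> = 0") (auto simp: \<rho>_def)
  have f_zero: "f i = 0" if "\<tau> = 0" "i \<in> I" for i
    using that I sum_nonneg_eq_0_iff[of I "\<lambda>i. q i - min (q i) (w i)"] unfolding \<tau>_def f_def by auto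
  have "epowr (wasserstein p (finite_dist I w z) \<mu>) p
      \<le> (\<integral>\<^sup>+x. ennreal (\<Sum>i\<in>I. \<kappa> i x * norm (z i - x) powr p) \<partial>\<mu>)"
  proof (rule wasserstein_le_kernel_cost[OF prob sets p I])
    show "\<kappa> i \<in> borel_measurable borel" if "i \<in> I" for i unfolding \<kappa>_def using that by measurable
    show "\<kappa> i x \<ge> 0" if "i \<in> I" for i x
      unfolding \<kappa>_def using that f \<rho> nonneg
      by (intro add_nonneg_nonneg mult_nonneg_nonneg sum_nonneg) auto
    show "(\<Sum>i\<in>I. \<kappa> i x) = 1" for x
    proof -
      have "(\<Sum>i\<in>I. \<kappa> i x) = (\<Sum>i\<in>I. \<psi> i x) - (\<Sum>i\<in>I. \<psi> i x * f i) + (\<Sum>i\<in>I. \<psi> i x * f i) * (\<Sum>k\<in>I. \<rho> k)"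
        unfolding \<kappa>_def sum.distrib sum_distrib_left[symmetric] by (simp add: right_diff_distrib sum_subtractf)
      also have "\<dots> = 1" using \<rho>_sum f_zero sum1 by (cases "\<tau> = 0") auto
      finally show ?thesis .
    qed
    show "(\<integral>x. \<kappa> k x \<partial>\<mu>) = w k" if "k \<in> I" for k
    proof -
      have "(\<integral>x. \<kappa> k x \<partial>\<mu>) = q k * (1 - f k) + (\<Sum>i\<in>I. q i * f i) * \<rho> k"
        unfolding \<kappa>_def q_def using that
        by (simp add: int Bochner_Integration.integral_add Bochner_Integration.integral_sum)
      also have "(\<Sum>i\<in>I. q i * f i) = \<tau>" unfolding \<tau>_def by (intro sum.cong refl f)
      also have "q k * (1 - f k) = q k - q k * f k" by (simp add: right_diff_distrib)
      finally show ?thesis using \<tau>\<rho>[OF that] f(3)[OF that] by simp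
    qed
  qed
  also have "\<dots> \<le> (\<integral>\<^sup>+x. ennreal (1 + 2 powr p) * ennreal (\<Sum>i\<in>I. \<psi> i x * norm (z i - x) powr p)
        + ennreal (2 powr p * D powr p * (\<Sum>i\<in>I. \<psi> i x * f i)) \<partial>\<mu>)"
  proof (rule nn_integral_mono)
    fix x
    let ?S = "\<Sum>i\<in>I. \<psi> i x * norm (z i - x) powr p"
    let ?b = "\<lambda>i. 2 powr p * (norm (z i - x) powr p + D powr p)"
    have S0: "?S \<ge> 0" using nonneg by (intro sum_nonneg) auto
    have "(\<Sum>k\<in>I. \<kappa> k x * norm (z k - x) powr p) =
      (\<Sum>k\<in>I. \<psi> k x * (1 - f k) * norm (z k - x) powr p) +
      (\<Sum>i\<in>I. \<psi> i x * f i * (\<Sum>k\<in>I. \<rho> k * norm (z k - x) powr p))"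
      unfolding \<kappa>_def distrib_right sum.distrib sum_distrib_right[symmetric]
      by (simp add: sum_distrib_left mult.assoc)
    also have "(\<Sum>k\<in>I. \<psi> k x * (1 - f k) * norm (z k - x) powr p) \<le> ?S"
      using nonneg f by (intro sum_mono mult_right_mono) (auto intro: mult_left_le)
    also have "(\<Sum>i\<in>I. \<psi> i x * f i * (\<Sum>k\<in>I. \<rho> k * norm (z k - x) powr p)) \<le>
        (\<Sum>i\<in>I. \<psi> i x * f i * ?b i)"
    proof (intro sum_mono mult_left_mono)
      fix i assume i: "i \<in> I"
      have "(\<Sum>k\<in>I. \<rho> k * norm (z k - x) powr p) \<le>
          (\<Sum>k\<in>I. \<rho> k * ?b i)"
      proof (intro sum_mono mult_left_mono \<rho>)
        fix k assume k: "k \<in> I"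
        have "norm (z k - x) \<le> norm (z i - x) + D"
          using norm_triangle_ineq[of "z i - x" "z k - z i"] D(1)[OF i k] by simp
        then have "norm (z k - x) powr p \<le> (norm (z i - x) + D) powr p"
          using p by (intro powr_mono2) auto
        also have "\<dots> \<le> ?b i"
          using p D(2) by (intro powr_add_le) auto
        finally show "norm (z k - x) powr p \<le> ?b i" .
      qed
      also have "\<dots> = (\<Sum>k\<in>I. \<rho> k) * ?b i"
        by (rule sum_distrib_right[symmetric])
      also have "\<dots> \<le> 1 * ?b i"
        by (intro mult_right_mono \<rho>_sum_le) auto
      finally show "(\<Sum>k\<in>I. \<rho> k * norm (z k - x) powr p) \<le> ?b i"
        by simp
    qed (use nonneg f in auto)
    also have "\<dots> = 2 powr p * (\<Sum>i\<in>I. f i * (\<psi> i x * norm (z i - x) powr p)) +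
        2 powr p * D powr p * (\<Sum>i\<in>I. \<psi> i x * f i)"
      by (simp add: sum_distrib_left sum.distrib[symmetric] algebra_simps)
    also have "(\<Sum>i\<in>I. f i * (\<psi> i x * norm (z i - x) powr p)) \<le> ?S"
      using nonneg f by (intro sum_mono mult_left_le_one_le) auto
    finally have "(\<Sum>k\<in>I. \<kappa> k x * norm (z k - x) powr p) \<le>
       (1 + 2 powr p) * ?S + 2 powr p * D powr p * (\<Sum>i\<in>I. \<psi> i x * f i)"
      by (simp add: distrib_right)
    then have "ennreal (\<Sum>k\<in>I. \<kappa> k x * norm (z k - x) powr p) \<le>
       ennreal ((1 + 2 powr p) * ?S + 2 powr p * D powr p * (\<Sum>i\<in>I. \<psi> i x * f i))"
      by (rule ennreal_leI)
    also have "\<dots> = ennreal (1 + 2 powr p) * ennreal ?S + ennreal (2 powr p * D powr p * (\<Sum>i\<in>I. \<psi> i x * f i))"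
      using S0 nonneg f by (subst ennreal_plus) (auto simp: ennreal_mult intro!: mult_nonneg_nonneg sum_nonneg)
    finally show "ennreal (\<Sum>k\<in>I. \<kappa> k x * norm (z k - x) powr p) \<le>
        ennreal (1 + 2 powr p) * ennreal ?S + ennreal (2 powr p * D powr p * (\<Sum>i\<in>I. \<psi> i x * f i))" .
  qed
  also have "\<dots> = ennreal (1 + 2 powr p) * (\<integral>\<^sup>+x. ennreal (\<Sum>i\<in>I. \<psi> i x * norm (z i - x) powr p) \<partial>\<mu>)
        + (\<integral>\<^sup>+x. ennreal (2 powr p * D powr p * (\<Sum>i\<in>I. \<psi> i x * f i)) \<partial>\<mu>)"
    by (subst nn_integral_add) (auto simp: nn_integral_cmult)
  also have "(\<integral>\<^sup>+x. ennreal (2 powr p * D powr p * (\<Sum>i\<in>I. \<psi> i x * f i)) \<partial>\<mu>) =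
      ennreal (\<integral>x. 2 powr p * D powr p * (\<Sum>i\<in>I. \<psi> i x * f i) \<partial>\<mu>)"
    using nonneg f by (intro nn_integral_eq_integral AE_I2 mult_nonneg_nonneg sum_nonneg) (auto simp: int)
  also have "(\<integral>x. 2 powr p * D powr p * (\<Sum>i\<in>I. \<psi> i x * f i) \<partial>\<mu>) = 2 powr p * D powr p * (\<Sum>i\<in>I. q i * f i)"
    by (simp add: int q_def Bochner_Integration.integral_sum)
  also have "\<dots> \<le> 2 powr p * D powr p * (\<Sum>i\<in>I. \<bar>w i - q i\<bar>)"
    by (intro mult_left_mono sum_mono) (auto simp: f)
  finally show ?thesis by (simp add: q_def add_left_mono ennreal_leI)
qed

text \<open>If all estimated weights are nonpositive the uniform weights are a default value. The error bound
  survives: the weights are then wrong by a constant amount, but so were the estimates.\<close>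

definition normalized_weights :: "'i set \<Rightarrow> ('i \<Rightarrow> real) \<Rightarrow> 'i \<Rightarrow> real" where
  "normalized_weights I v i = (if (\<Sum>k\<in>I. max 0 (v k)) = 0 then 1 / real (card I)
     else max 0 (v i) / (\<Sum>k\<in>I. max 0 (v k)))"

lemma normalized_weights_nonneg: "normalized_weights I v i \<ge> 0"
  unfolding normalized_weights_def by (auto intro!: divide_nonneg_nonneg sum_nonneg)

lemma sum_normalized_weights: "finite I \<Longrightarrow> I \<noteq> {} \<Longrightarrow> (\<Sum>i\<in>I. normalized_weights I v i) = 1"
  by (cases "(\<Sum>k\<in>I. max 0 (v k)) = 0") (simp_all add: normalized_weights_def flip: sum_divide_distrib)

text \<open>Replacing the estimates by their positive parts brings them closer to the nonnegative \<open>q\<close>.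
  The normalization changes them by the defect \<open>\<bar>1 - s\<bar>\<close> of their sum \<open>s\<close> in total, which is at most the
  error already made because \<open>q\<close> sums to 1.\<close>

lemma normalized_weights_error:
  assumes I: "finite I" "I \<noteq> {}" and q: "\<And>i. i \<in> I \<Longrightarrow> q i \<ge> 0" "(\<Sum>i\<in>I. q i) = 1"
  shows "(\<Sum>i\<in>I. \<bar>normalized_weights I v i - q i\<bar>) \<le> 2 * (\<Sum>i\<in>I. \<bar>v i - q i\<bar>)"
proof -
  define v' where "v' i = max 0 (v i)" for i
  define s where "s = (\<Sum>i\<in>I. v' i)"
  let ?w = "normalized_weights I v"
  have v': "\<bar>v' i - q i\<bar> \<le> \<bar>v i - q i\<bar>" if "i \<in> I" for i
    using q(1)[OF that] by (auto simp: v'_def)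
  have s0: "s \<ge> 0" unfolding s_def v'_def by (intro sum_nonneg) auto
  have "\<bar>1 - s\<bar> = \<bar>\<Sum>i\<in>I. q i - v' i\<bar>" by (simp add: s_def sum_subtractf q)
  also have "\<dots> \<le> (\<Sum>i\<in>I. \<bar>q i - v' i\<bar>)" by (rule sum_abs)
  also have "\<dots> \<le> (\<Sum>i\<in>I. \<bar>v i - q i\<bar>)" using v' by (intro sum_mono) (simp add: abs_minus_commute)
  finally have s1: "\<bar>1 - s\<bar> \<le> (\<Sum>i\<in>I. \<bar>v i - q i\<bar>)" .
  have wv: "(\<Sum>i\<in>I. \<bar>?w i - v' i\<bar>) = \<bar>1 - s\<bar>"
  proof (cases "s = 0")
    case True
    then have "v' i = 0" if "i \<in> I" for i
      using that I sum_nonneg_eq_0_iff[of I v'] by (auto simp: s_def v'_def)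
    then have "(\<Sum>i\<in>I. \<bar>?w i - v' i\<bar>) = (\<Sum>i\<in>I. ?w i)" by (simp add: normalized_weights_nonneg)
    then show ?thesis using True sum_normalized_weights[OF I] by simp
  next
    case False
    then have w: "?w i = v' i / s" for i by (simp add: normalized_weights_def s_def v'_def)
    have "\<bar>?w i - v' i\<bar> = \<bar>1 - s\<bar> * (v' i / s)" for i
    proof -
      have "?w i - v' i = (1 - s) * (v' i / s)" using False by (simp add: w field_simps)
      moreover have "v' i / s \<ge> 0" using s0 by (simp add: v'_def)
      ultimately show ?thesis by (simp only: abs_mult abs_of_nonneg)
    qed
    then have "(\<Sum>i\<in>I. \<bar>?w i - v' i\<bar>) = \<bar>1 - s\<bar> * (\<Sum>i\<in>I. v' i / s)" by (simp add: sum_distrib_left)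
    also have "(\<Sum>i\<in>I. v' i / s) = 1" using False by (simp add: sum_divide_distrib[symmetric] s_def)
    finally show ?thesis by simp
  qed
  have "(\<Sum>i\<in>I. \<bar>?w i - q i\<bar>) \<le> (\<Sum>i\<in>I. \<bar>?w i - v' i\<bar> + \<bar>v i - q i\<bar>)"
  proof (intro sum_mono)
    fix i assume "i \<in> I"
    from v'[OF this] show "\<bar>?w i - q i\<bar> \<le> \<bar>?w i - v' i\<bar> + \<bar>v i - q i\<bar>" by linarith
  qed
  then show ?thesis using wv s1 by (simp add: sum.distrib)
qed

lemma normalized_weights_measurable [measurable]:
  assumes [measurable]: "\<And>i. (\<lambda>y. v y i) \<in> borel_measurable M"
  shows "(\<lambda>y. normalized_weights I (v y) i) \<in> borel_measurable M"
  unfolding normalized_weights_def by measurable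

section \<open>The mean deviation of a sample mean\<close>

text \<open>The variance of the sample mean is at most \<open>B\<^sup>2 / n\<close>, because the cross terms of independent
  centred variables vanish; the mean absolute deviation is at most the standard deviation.\<close>

lemma sample_mean_L1_deviation:
  fixes g :: "'a::topological_space \<Rightarrow> real"
  assumes "prob_space Q" and sets: "sets Q = sets borel"
    and [measurable]: "g \<in> borel_measurable borel"
    and B: "\<And>x. \<bar>g x\<bar> \<le> B" "B > 0" and n: "n \<ge> 1"
  shows "(\<integral>\<^sup>+y. ennreal \<bar>(\<Sum>i\<in>{1..n}. g (y i)) / real n - (\<integral>x. g x \<partial>Q)\<bar> \<partial>PiM {1..n} (\<lambda>_. Q))
    \<le> ennreal (B / sqrt (real n))"
proof -
  interpret Q: prob_space Q by fact
  note [measurable_cong] = sets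
  interpret P: product_prob_space "\<lambda>_. Q" "{1..n}" ..
  let ?P = "PiM {1..n} (\<lambda>_. Q)"
  define e where "e = (\<integral>x. g x \<partial>Q)"
  define h where "h x = g x - e" for x
  have [measurable]: "h \<in> borel_measurable borel" unfolding h_def by measurable
  have ig: "integrable Q g" by (rule Q.integrable_const_bound[of _ B]) (use B in auto)
  have ig2: "integrable Q (\<lambda>x. (g x)\<^sup>2)"
  proof (rule Q.integrable_const_bound[of _ "B\<^sup>2"])
    show "AE x in Q. norm ((g x)\<^sup>2) \<le> B\<^sup>2"
      using B by (auto simp: abs_le_square_iff[symmetric])
  qed simp
  have e_le: "\<bar>e\<bar> \<le> B"
  proof -
    have "\<bar>e\<bar> \<le> (\<integral>x. \<bar>g x\<bar> \<partial>Q)" unfolding e_def by (rule integral_abs_bound)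
    also have "\<dots> \<le> B" by (rule Q.integral_le_const) (use ig B in auto)
    finally show ?thesis .
  qed
  have h_bound: "\<bar>h x\<bar> \<le> 2 * B" for x using B(1)[of x] e_le unfolding h_def by linarith
  have ih: "integrable Q h" unfolding h_def using ig by simp
  have h_mean: "(\<integral>x. h x \<partial>Q) = 0" unfolding h_def using ig by (simp add: e_def Q.prob_space)
  have h_sq: "(\<integral>x. h x * h x \<partial>Q) \<le> B\<^sup>2"
  proof -
    have "(\<integral>x. h x * h x \<partial>Q) = (\<integral>x. (g x)\<^sup>2 \<partial>Q) - e\<^sup>2"
      using Q.variance_eq[OF ig ig2] unfolding h_def e_def by (simp add: power2_eq_square)
    also have "\<dots> \<le> (\<integral>x. (g x)\<^sup>2 \<partial>Q)" by simp
    also have "\<dots> \<le> B\<^sup>2"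
      by (rule Q.integral_le_const[OF ig2]) (use B in \<open>auto simp: abs_le_square_iff[symmetric]\<close>)
    finally show ?thesis .
  qed
  have int_hh: "integrable ?P (\<lambda>y. h (y i) * h (y j))" if "i \<in> {1..n}" "j \<in> {1..n}" for i j
  proof (rule P.integrable_const_bound[of _ "(2 * B) * (2 * B)"])
    have "norm (h (y i) * h (y j)) \<le> 2 * B * (2 * B)" for y
      unfolding real_norm_def abs_mult using B(2) by (intro mult_mono h_bound) auto
    then show "AE y in ?P. norm (h (y i) * h (y j)) \<le> 2 * B * (2 * B)" by (intro AE_I2)
  qed (use that in measurable)
  have cross: "(\<integral>y. h (y i) * h (y j) \<partial>?P) = (if i = j then (\<integral>x. h x * h x \<partial>Q) else 0)"
    if ij: "i \<in> {1..n}" "j \<in> {1..n}" for i j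
  proof -
    define f where "f k x = (if k = i then h x else 1) * (if k = j then h x else 1)" for k x
    have if': "integrable Q (f k)" for k
    proof (rule Q.integrable_const_bound[of _ "(2 * B + 1) * (2 * B + 1)"])
      have "\<bar>f k x\<bar> \<le> (2 * B + 1) * (2 * B + 1)" for x
        unfolding f_def abs_mult using h_bound[of x] B(2) by (intro mult_mono) auto
      then show "AE x in Q. norm (f k x) \<le> (2 * B + 1) * (2 * B + 1)" by simp
    qed (unfold f_def, measurable)
    have "(\<integral>y. h (y i) * h (y j) \<partial>?P) = (\<integral>y. (\<Prod>k\<in>{1..n}. f k (y k)) \<partial>?P)"
      using ij by (intro Bochner_Integration.integral_cong refl) (simp add: f_def prod.distrib prod.delta)
    also have "\<dots> = (\<Prod>k\<in>{1..n}. \<integral>x. f k x \<partial>Q)"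
      by (rule P.product_integral_prod) (auto simp: if')
    also have "\<dots> = (if i = j then (\<integral>x. h x * h x \<partial>Q) else 0)"
    proof (cases "i = j")
      case True
      have "(\<integral>x. f k x \<partial>Q) = (if k = j then (\<integral>x. h x * h x \<partial>Q) else 1)" for k
        using True by (simp add: f_def Q.prob_space)
      then show ?thesis using True ij by (simp add: prod.delta)
    next
      case False
      then have "(\<integral>x. f i x \<partial>Q) = 0" by (simp add: f_def h_mean)
      then show ?thesis using False ij by (auto simp: prod_zero_iff)
    qed
    finally show ?thesis .
  qed
  let ?S = "\<lambda>y. \<Sum>i\<in>{1..n}. h (y i)"
  have S2: "(?S y)\<^sup>2 = (\<Sum>i\<in>{1..n}. \<Sum>j\<in>{1..n}. h (y i) * h (y j))" for y
    by (simp add: power2_eq_square sum_product)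
  have iS2: "integrable ?P (\<lambda>y. (?S y)\<^sup>2)" unfolding S2 using int_hh by (intro Bochner_Integration.integrable_sum) auto
  have "(\<integral>y. (?S y)\<^sup>2 \<partial>?P) = (\<Sum>i\<in>{1..n}. \<Sum>j\<in>{1..n}. (\<integral>y. h (y i) * h (y j) \<partial>?P))"
    unfolding S2
    by (subst Bochner_Integration.integral_sum,
        intro Bochner_Integration.integrable_sum int_hh, assumption+)
      (intro sum.cong refl Bochner_Integration.integral_sum int_hh, assumption+)
  also have "\<dots> = (\<Sum>i\<in>{1..n}. \<Sum>j\<in>{1..n}. (if i = j then (\<integral>x. h x * h x \<partial>Q) else 0))"
    by (intro sum.cong refl cross) auto
  also have "\<dots> = real n * (\<integral>x. h x * h x \<partial>Q)" by simp
  also have "\<dots> \<le> real n * B\<^sup>2" by (intro mult_left_mono h_sq) auto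
  finally have ES2: "(\<integral>y. (?S y)\<^sup>2 \<partial>?P) \<le> real n * B\<^sup>2" .
  have mean: "(\<Sum>i\<in>{1..n}. g (y i)) / real n - e = ?S y / real n" for y
    using n by (simp add: h_def sum_subtractf field_simps)
  define c where "c = B * sqrt (real n)"
  have c: "c > 0" using B n by (simp add: c_def)
  have "(\<integral>\<^sup>+y. ennreal \<bar>(\<Sum>i\<in>{1..n}. g (y i)) / real n - e\<bar> \<partial>?P) \<le>
      (\<integral>\<^sup>+y. ennreal (((?S y)\<^sup>2 / c + c) / (2 * real n)) \<partial>?P)"
  proof (intro nn_integral_mono ennreal_leI)
    fix y
    \<comment> \<open>\<open>2 c |S| \<le> S\<^sup>2 + c\<^sup>2\<close>\<close>
    have "0 \<le> (\<bar>?S y\<bar> - c)\<^sup>2" by simp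
    then have "2 * c * \<bar>?S y\<bar> \<le> (?S y)\<^sup>2 + c * c" by (simp add: power2_eq_square algebra_simps)
    then have "\<bar>?S y\<bar> \<le> ((?S y)\<^sup>2 / c + c) / 2" using c by (simp add: field_simps)
    then show "\<bar>(\<Sum>i\<in>{1..n}. g (y i)) / real n - e\<bar> \<le> ((?S y)\<^sup>2 / c + c) / (2 * real n)"
      unfolding mean using n by (simp add: field_simps)
  qed
  also have "\<dots> = ennreal (\<integral>y. ((?S y)\<^sup>2 / c + c) / (2 * real n) \<partial>?P)"
    using c by (intro nn_integral_eq_integral AE_I2 divide_nonneg_nonneg add_nonneg_nonneg)
      (auto simp del: One_nat_def intro!: Bochner_Integration.integrable_add integrable_divide iS2)
  also have "(\<integral>y. ((?S y)\<^sup>2 / c + c) / (2 * real n) \<partial>?P) = ((\<integral>y. (?S y)\<^sup>2 \<partial>?P) / c + c) / (2 * real n)"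
    by (subst Bochner_Integration.integral_divide_zero, subst Bochner_Integration.integral_add)
       (intro integrable_divide iS2, simp_all add: P.P.prob_space del: One_nat_def)
  also have "\<dots> \<le> (real n * B\<^sup>2 / c + c) / (2 * real n)"
    using ES2 c by (intro divide_right_mono add_right_mono) auto
  also have "\<dots> = B / sqrt (real n)"
  proof -
    have "real n = sqrt (real n) * sqrt (real n)" by simp
    then have "real n * B\<^sup>2 / c = c" using B(2) n c unfolding c_def power2_eq_square
      by (simp add: field_simps)
    moreover have "c / real n = B / sqrt (real n)" using n by (simp add: c_def field_simps)
    ultimately show ?thesis by simp
  qed
  finally show ?thesis unfolding e_def by (simp add: ennreal_leI)
qed

section \<open>Smoothing in several dimensions\<close>

text \<open>A normal variable is an affine image of a standard one.\<close>

lemma char_normal: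
  assumes "\<sigma> > 0"
  shows "char (density lborel (\<lambda>x. ennreal (normal_density m \<sigma> x))) t
    = cis (t * m) * of_real (exp (- (\<sigma> * t)\<^sup>2 / 2))"
proof -
  interpret S: prob_space std_normal_distribution by (rule prob_space_normal_density) simp
  have "distributed std_normal_distribution lborel (\<lambda>x. x) std_normal_density"
    by (auto simp: distributed_def distr_id2)
  then have "distributed std_normal_distribution lborel (\<lambda>x. m + \<sigma> * x) (normal_density (m + \<sigma> * 0) (\<bar>\<sigma>\<bar> * 1))"
    by (rule S.normal_density_affine) (use assms in auto)
  then have "distr std_normal_distribution lborel (\<lambda>x. m + \<sigma> * x) = density lborel (normal_density m \<sigma>)"
    using assms by (simp add: distributed_def)
  then have "char (density lborel (\<lambda>x. ennreal (normal_density m \<sigma> x))) t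
     = (CLINT x|distr std_normal_distribution lborel (\<lambda>x. m + \<sigma> * x). iexp (t * x))"
    by (simp add: char_def)
  also have "\<dots> = (CLINT x|std_normal_distribution. iexp (t * (m + \<sigma> * x)))"
    by (rule integral_distr) auto
  also have "\<dots> = (CLINT x|std_normal_distribution. cis (t * m) * iexp ((\<sigma> * t) * x))"
    by (intro Bochner_Integration.integral_cong refl) (simp add: cis_conv_exp exp_add[symmetric] algebra_simps)
  also have "\<dots> = cis (t * m) * char std_normal_distribution (\<sigma> * t)"
    by (simp add: char_def)
  finally show ?thesis by (simp add: char_std_normal_distribution)
qed

text \<open>All that the upper bound uses about the law of a noise coordinate: its characteristic function
  has no zeros and decays at most like a Gaussian. A point mass has \<open>s = 0\<close>.\<close>

lemma gaussian_char_lower_bound: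
  assumes "gaussian_real \<nu>"
  shows "\<exists>s\<ge>0. \<forall>t. exp (- (s * t\<^sup>2)) \<le> cmod (char \<nu> t)"
  using assms unfolding gaussian_real_def
proof (elim disjE exE conjE)
  fix m assume "\<nu> = return borel m"
  then have "char \<nu> t = iexp (t * m)" for t by (simp add: char_def integral_return)
  then have "cmod (char \<nu> t) = 1" for t by simp
  then show ?thesis by (intro exI[of _ 0]) simp
next
  fix m \<sigma> assume "\<sigma> > 0" "\<nu> = density lborel (\<lambda>x. ennreal (normal_density m \<sigma> x))"
  then have "cmod (char \<nu> t) = exp (- (\<sigma>\<^sup>2 / 2 * t\<^sup>2))" for t
    by (simp add: char_normal norm_mult power_mult_distrib)
  then show ?thesis by (intro exI[of _ "\<sigma>\<^sup>2 / 2"]) simp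
qed

lemma
  fixes A :: "real^'n^'n"
  assumes "invertible A"
  shows matrix_inv_left_cancel: "matrix_inv A *v (A *v x) = x"
    and matrix_inv_right_cancel: "A *v (matrix_inv A *v x) = x"
proof -
  have "A ** matrix_inv A = mat 1 \<and> matrix_inv A ** A = mat 1"
    using assms unfolding invertible_def matrix_inv_def by (rule someI_ex)
  then show "matrix_inv A *v (A *v x) = x" "A *v (matrix_inv A *v x) = x"
    by (simp_all add: matrix_vector_mul_assoc)
qed

definition cells :: "nat \<Rightarrow> ('n::finite \<Rightarrow> nat) set" where
  "cells G = (PiE UNIV (\<lambda>_. {..<G}))"

lemma finite_cells [simp]: "finite (cells G)"
  unfolding cells_def by (rule finite_PiE) auto

lemma card_cells: "card (cells G :: ('n::finite \<Rightarrow> nat) set) = G ^ CARD('n)"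
  unfolding cells_def by (subst card_PiE) auto

lemma cellsD: "i \<in> cells G \<Longrightarrow> i l < G"
  unfolding cells_def by auto

lemma sum_cells_prod:
  fixes f :: "'n::finite \<Rightarrow> nat \<Rightarrow> real"
  shows "(\<Sum>i\<in>cells G. \<Prod>l\<in>UNIV. f l (i l)) = (\<Prod>l\<in>UNIV. \<Sum>k<G. f l k)"
  unfolding cells_def by (rule prod_sum_PiE[symmetric]) auto

text \<open>A product of one-dimensional partitions of unity is one in several dimensions, and its marginals
  are the factors.\<close>

lemma sum_cells_marginal:
  fixes f :: "'n::finite \<Rightarrow> nat \<Rightarrow> real"
  assumes "\<And>l. (\<Sum>k<G. f l k) = 1"
  shows "(\<Sum>i\<in>cells G. (\<Prod>l\<in>UNIV. f l (i l)) * g (i l0)) = (\<Sum>k<G. f l0 k * g k)"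
proof -
  have "(\<Sum>i\<in>cells G. (\<Prod>l\<in>UNIV. f l (i l)) * g (i l0)) =
    (\<Sum>i\<in>cells G. \<Prod>l\<in>UNIV. f l (i l) * (if l = l0 then g (i l) else 1))"
    by (intro sum.cong refl) (simp add: prod.distrib)
  also have "\<dots> = (\<Prod>l\<in>UNIV. \<Sum>k<G. f l k * (if l = l0 then g k else 1))"
    by (rule sum_cells_prod)
  also have "\<dots> = (\<Prod>l\<in>UNIV. if l = l0 then (\<Sum>k<G. f l0 k * g k) else 1)"
    by (intro prod.cong refl) (auto simp: assms)
  finally show ?thesis by simp
qed

definition box_weight :: "nat \<Rightarrow> nat \<Rightarrow> real \<Rightarrow> real^'n^'n \<Rightarrow> ('n \<Rightarrow> nat) \<Rightarrow> real^'n \<Rightarrow> real" where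
  "box_weight m N \<theta> A i x = (\<Prod>l\<in>UNIV. jackson m N (i l) (\<theta> * (A *v x) $ l))"

definition node :: "nat \<Rightarrow> nat \<Rightarrow> real \<Rightarrow> real^'n^'n \<Rightarrow> ('n \<Rightarrow> nat) \<Rightarrow> real^'n" where
  "node m N \<theta> A i = matrix_inv A *v (\<chi> l. grid (Suc m * N) (i l) / \<theta>)"

lemma box_weight_nonneg: "box_weight m N \<theta> A i x \<ge> 0"
  unfolding box_weight_def by (intro prod_nonneg) (auto simp: jackson_nonneg)

lemma sum_box_weight: "N > 0 \<Longrightarrow> (\<Sum>i\<in>cells (Suc m * N). box_weight m N \<theta> A i x) = 1"
  unfolding box_weight_def by (subst sum_cells_prod) (simp only: sum_jackson prod.neutral_const)

lemma matrix_component_measurable [measurable]: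
  "(\<lambda>x. (A *v x) $ l) \<in> borel_measurable (borel :: (real^'n) measure)"
  by (intro borel_measurable_continuous_onI continuous_intros linear_continuous_on
      bounded_linear_intros) (auto intro: matrix_vector_mul_bounded_linear)

lemma jackson_measurable [measurable]: "jackson m N k \<in> borel_measurable borel"
  unfolding jackson_def dirichlet_def by measurable

lemma box_weight_measurable [measurable]: "box_weight m N \<theta> A i \<in> borel_measurable borel"
  unfolding box_weight_def by measurable

text \<open>For \<open>\<bar>\<theta> * t\<bar> \<le> pi / 2\<close> this is the concentration of Jackson's kernel. Farther out the periodic
  kernel may send \<open>t\<close> to the other end of the grid, but then the distance is at most \<open>3 \<bar>t\<bar>\<close> and, as
  \<open>1 \<le> \<theta> * \<bar>t\<bar>\<close>, the moment of order \<open>2 p\<close> of the law provides the missing factor \<open>\<theta> powr p\<close>.\<close>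

lemma jackson_scaled_moment:
  assumes N: "N > 0" and \<theta>: "\<theta> > 0" and p: "1 \<le> p" "p \<le> 2 * real m" and a: "a > 0"
  shows "(\<Sum>k<Suc m * N. jackson m N k (\<theta> * t) * \<bar>grid (Suc m * N) k / \<theta> - t\<bar> powr p)
    \<le> jackson_const m / (\<theta> * real N) powr p + 3 powr p * \<theta> powr p * (1 + \<bar>t\<bar> powr (2 * p + a))"
proof -
  let ?G = "Suc m * N"
  let ?S = "\<Sum>k<?G. jackson m N k (\<theta> * t) * \<bar>grid ?G k / \<theta> - t\<bar> powr p"
  have sc: "\<bar>grid ?G k / \<theta> - t\<bar> powr p = \<bar>\<theta> * t - grid ?G k\<bar> powr p / \<theta> powr p" for k
  proof -
    have "\<bar>grid ?G k / \<theta> - t\<bar> = \<bar>\<theta> * t - grid ?G k\<bar> / \<theta>"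
    proof -
      have "grid ?G k / \<theta> - t = (grid ?G k - \<theta> * t) / \<theta>" using \<theta> by (simp add: field_simps)
      then show ?thesis using \<theta> by (simp add: abs_minus_commute)
    qed
    then show ?thesis using \<theta> by (simp add: powr_divide)
  qed
  have c0: "jackson_const m \<ge> 0" unfolding jackson_const_def by simp
  show ?thesis
  proof (cases "\<bar>\<theta> * t\<bar> \<le> pi / 2")
    case True
    have "?S =
      (\<Sum>k<?G. jackson m N k (\<theta> * t) * \<bar>\<theta> * t - grid ?G k\<bar> powr p) / \<theta> powr p"
      unfolding sc sum_divide_distrib by simp
    also have "\<dots> \<le> (jackson_const m / real N powr p) / \<theta> powr p"
      using p by (intro divide_right_mono jackson_moment N True) auto
    also have "\<dots> = jackson_const m / (\<theta> * real N) powr p"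
      using \<theta> by (simp add: powr_mult mult.commute)
    finally show ?thesis by (simp add: add_increasing2)
  next
    case False
    have t: "\<bar>t\<bar> * \<theta> > pi / 2" using False \<theta> by (simp add: abs_mult mult.commute)
    have t1: "1 \<le> \<theta> * \<bar>t\<bar>" using t pi_gt3 by (simp add: mult.commute)
    have "?S \<le>
       (\<Sum>k<?G. jackson m N k (\<theta> * t) * (3 * \<bar>t\<bar>) powr p)"
    proof (intro sum_mono mult_left_mono jackson_nonneg powr_mono2)
      fix k assume "k \<in> {..<?G}"
      then have "\<bar>grid ?G k\<bar> \<le> pi" by (intro abs_grid_le) auto
      then have "\<bar>grid ?G k\<bar> \<le> 2 * (\<bar>t\<bar> * \<theta>)" using t by linarith
      then have "\<bar>grid ?G k / \<theta>\<bar> \<le> 2 * \<bar>t\<bar>" using \<theta> by (simp add: divide_le_eq)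
      then show "\<bar>grid ?G k / \<theta> - t\<bar> \<le> 3 * \<bar>t\<bar>" by linarith
    qed (use p in auto)
    also have "\<dots> = (3 * \<bar>t\<bar>) powr p"
      unfolding sum_distrib_right[symmetric] sum_jackson[OF N] by simp
    also have "\<dots> = 3 powr p * (\<bar>t\<bar> powr p * 1)" by (simp add: powr_mult)
    also have "1 \<le> (\<theta> * \<bar>t\<bar>) powr p" using t1 p by (intro ge_one_powr_ge_zero) auto
    also have "3 powr p * (\<bar>t\<bar> powr p * (\<theta> * \<bar>t\<bar>) powr p) = 3 powr p * \<theta> powr p * \<bar>t\<bar> powr (2 * p)"
      using \<theta> by (simp add: powr_mult powr_add[symmetric])
    also have "\<bar>t\<bar> powr (2 * p) \<le> 1 + \<bar>t\<bar> powr (2 * p + a)"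
    proof (cases "\<bar>t\<bar> \<le> 1")
      case True
      then have "\<bar>t\<bar> powr (2 * p) \<le> 1" using p by (intro powr_le1) auto
      then show ?thesis by (simp add: add_increasing2)
    next
      case False
      then have "\<bar>t\<bar> powr (2 * p) \<le> \<bar>t\<bar> powr (2 * p + a)" using a by (intro powr_mono) auto
      then show ?thesis by simp
    qed
    finally have *: "?S \<le>
       3 powr p * \<theta> powr p * (1 + \<bar>t\<bar> powr (2 * p + a))"
      by (simp add: mult_left_mono)
    show ?thesis using * c0 by (simp add: add_increasing)
  qed
qed

lemma norm_powr_le_sum_components:
  fixes v :: "real^'n"
  assumes p: "p \<ge> 0"
  shows "norm v powr p \<le> real CARD('n) powr p * (\<Sum>l\<in>UNIV. \<bar>v $ l\<bar> powr p)"
proof -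
  define b where "b = Max (range (\<lambda>l. \<bar>v $ l\<bar>))"
  have "b \<in> range (\<lambda>l. \<bar>v $ l\<bar>)" unfolding b_def by (rule Max_in) auto
  then obtain l0 where l0: "b = \<bar>v $ l0\<bar>" by auto
  have "norm v \<le> (\<Sum>l\<in>UNIV. \<bar>v $ l\<bar>)" by (rule norm_le_l1_cart)
  also have "\<dots> \<le> (\<Sum>l\<in>(UNIV::'n set). b)" unfolding b_def by (intro sum_mono Max_ge) auto
  finally have "norm v \<le> real CARD('n) * b" by simp
  then have "norm v powr p \<le> (real CARD('n) * b) powr p" using p by (intro powr_mono2) auto
  also have "\<dots> = real CARD('n) powr p * \<bar>v $ l0\<bar> powr p" by (simp add: powr_mult l0)
  also have "\<bar>v $ l0\<bar> powr p \<le> (\<Sum>l\<in>UNIV. \<bar>v $ l\<bar> powr p)"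
    by (rule member_le_sum) auto
  finally show ?thesis by (simp add: mult_left_mono)
qed

lemma moment_class_coordinate:
  assumes "\<mu> \<in> moment_class A M p a"
  shows "(\<integral>\<^sup>+x. ennreal (1 + \<bar>(A *v x) $ l\<bar> powr (2 * p + a)) \<partial>\<mu>) \<le> ennreal M"
proof -
  have "(\<integral>\<^sup>+x. ennreal (1 + \<bar>(A *v x) $ l\<bar> powr (2 * p + a)) \<partial>\<mu>) \<le>
     (\<integral>\<^sup>+x. ennreal ((1 + \<bar>(A *v x) $ l\<bar> powr (2 * p + a)) *
                  (\<Prod>k\<in>UNIV - {l}. 1 + \<bar>(A *v x) $ k\<bar> powr a)) \<partial>\<mu>)"
  proof (intro nn_integral_mono ennreal_leI)
    fix x
    have "1 \<le> (\<Prod>k\<in>UNIV - {l}. 1 + \<bar>(A *v x) $ k\<bar> powr a)" by (intro prod_ge_1) auto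
    then show "1 + \<bar>(A *v x) $ l\<bar> powr (2 * p + a) \<le> (1 + \<bar>(A *v x) $ l\<bar> powr (2 * p + a)) *
        (\<Prod>k\<in>UNIV - {l}. 1 + \<bar>(A *v x) $ k\<bar> powr a)"
      using mult_left_mono[of 1 _ "1 + \<bar>(A *v x) $ l\<bar> powr (2 * p + a)"] by simp
  qed
  also have "\<dots> \<le> (SUP j. \<integral>\<^sup>+x. ennreal ((1 + \<bar>(A *v x) $ j\<bar> powr (2 * p + a)) *
                  (\<Prod>l\<in>UNIV - {j}. 1 + \<bar>(A *v x) $ l\<bar> powr a)) \<partial>\<mu>)"
    by (rule SUP_upper) simp
  also have "\<dots> \<le> ennreal M" using assms by (simp add: moment_class_def)
  finally show ?thesis .
qed

lemma moment_classD: "\<mu> \<in> moment_class A M p a \<Longrightarrow> prob_space \<mu> \<and> sets \<mu> = sets borel"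
  by (simp add: moment_class_def space_prob_algebra)

text \<open>The bias of the estimator: the cost of moving the mass of \<open>\<mu>\<close> to the nodes, one coordinate of
  \<open>A *v x\<close> at a time.\<close>

lemma smoothing_cost:
  fixes A :: "real^'n^'n"
  assumes A: "invertible A" and \<mu>: "\<mu> \<in> moment_class A M p a"
    and N: "N > 0" and \<theta>: "\<theta> > 0" and p: "1 \<le> p" "p \<le> 2 * real m" and a: "a > 0" and M: "M \<ge> 0"
    and L: "L \<ge> 0" "\<And>v. norm (matrix_inv A *v v) \<le> L * norm v"
  shows "(\<integral>\<^sup>+x. ennreal (\<Sum>i\<in>cells (Suc m * N). box_weight m N \<theta> A i x *
        norm (node m N \<theta> A i - x) powr p) \<partial>\<mu>)
    \<le> ennreal ((L * real CARD('n)) powr p * real CARD('n) *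
        (jackson_const m / (\<theta> * real N) powr p + 3 powr p * \<theta> powr p * M))"
proof -
  let ?G = "Suc m * N" and ?d = "real CARD('n)"
  have prob: "prob_space \<mu>" and [measurable_cong]: "sets \<mu> = sets borel"
    using moment_classD[OF \<mu>] by auto
  interpret prob_space \<mu> by fact
  define c1 where "c1 = jackson_const m / (\<theta> * real N) powr p"
  define c2 where "c2 = 3 powr p * \<theta> powr p"
  have c: "c1 \<ge> 0" "c2 \<ge> 0" by (simp_all add: c1_def c2_def jackson_const_def)
  let ?c = "\<lambda>x. \<Sum>i\<in>cells ?G. box_weight m N \<theta> A i x * norm (node m N \<theta> A i - x) powr p" and ?r = "\<lambda>l x. \<bar>(A *v x) $ l\<bar> powr (2 * p + a)"
  have bound: "?c x \<le>
     (L * ?d) powr p * (\<Sum>l\<in>UNIV. c1 + c2 * (1 + ?r l x))" for x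
  proof -
    let ?t = "\<lambda>l. (A *v x) $ l"
    have "norm (node m N \<theta> A i - x) powr p \<le>
       (L * ?d) powr p * (\<Sum>l\<in>UNIV. \<bar>grid ?G (i l) / \<theta> - ?t l\<bar> powr p)" for i
    proof -
      have "x = matrix_inv A *v (A *v x)"
        by (simp add: matrix_inv_left_cancel[OF A])
      then have "node m N \<theta> A i - x = matrix_inv A *v ((\<chi> l. grid ?G (i l) / \<theta>) - A *v x)"
        unfolding node_def matrix_vector_mult_diff_distrib by simp
      then have "norm (node m N \<theta> A i - x) powr p \<le> (L * norm ((\<chi> l. grid ?G (i l) / \<theta>) - A *v x)) powr p"
        using p by (simp add: powr_mono2 L)
      also have "\<dots> = L powr p * norm ((\<chi> l. grid ?G (i l) / \<theta>) - A *v x) powr p"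
        using L by (simp add: powr_mult)
      also have "\<dots> \<le> L powr p * (?d powr p * (\<Sum>l\<in>UNIV. \<bar>((\<chi> l. grid ?G (i l) / \<theta>) - A *v x) $ l\<bar> powr p))"
        using p by (intro mult_left_mono norm_powr_le_sum_components) auto
      finally show ?thesis using L by (simp add: powr_mult mult.assoc)
    qed
    then have "?c x \<le>
      (\<Sum>i\<in>cells ?G. box_weight m N \<theta> A i x * ((L * ?d) powr p *
         (\<Sum>l\<in>UNIV. \<bar>grid ?G (i l) / \<theta> - ?t l\<bar> powr p)))"
      by (intro sum_mono mult_left_mono box_weight_nonneg)
    also have "\<dots> = (L * ?d) powr p * (\<Sum>l\<in>UNIV. \<Sum>i\<in>cells ?G. box_weight m N \<theta> A i x *
        \<bar>grid ?G (i l) / \<theta> - ?t l\<bar> powr p)"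
      by (subst sum.swap) (simp add: sum_distrib_left mult_ac)
    also have "\<dots> = (L * ?d) powr p * (\<Sum>l\<in>UNIV. \<Sum>k<?G. jackson m N k (\<theta> * ?t l) *
        \<bar>grid ?G k / \<theta> - ?t l\<bar> powr p)"
      unfolding box_weight_def
      by (subst sum_cells_marginal[where f="\<lambda>l k. jackson m N k (\<theta> * ?t l)"]) (simp_all only: sum_jackson N refl)
    also have "\<dots> \<le> (L * ?d) powr p * (\<Sum>l\<in>UNIV. c1 + c2 * (1 + \<bar>?t l\<bar> powr (2 * p + a)))"
      unfolding c1_def c2_def
      by (intro mult_left_mono sum_mono jackson_scaled_moment N \<theta> p a) auto
    finally show ?thesis .
  qed
  have "(\<integral>\<^sup>+x. ennreal (?c x) \<partial>\<mu>) \<le>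
     (\<integral>\<^sup>+x. ennreal ((L * ?d) powr p) * (\<Sum>l\<in>UNIV. ennreal c1 + ennreal c2 * ennreal (1 + ?r l x)) \<partial>\<mu>)"
  proof (intro nn_integral_mono)
    fix x
    have eq: "ennreal (c1 + c2 * (1 + ?r l x)) =
      ennreal c1 + ennreal c2 * ennreal (1 + ?r l x)" for l
      using c by (subst ennreal_plus) (auto simp: ennreal_mult intro!: mult_nonneg_nonneg)
    have "ennreal (?c x) \<le>
      ennreal ((L * ?d) powr p * (\<Sum>l\<in>UNIV. c1 + c2 * (1 + ?r l x)))"
      by (intro ennreal_leI bound)
    also have "\<dots> = ennreal ((L * ?d) powr p) * (\<Sum>l\<in>UNIV. ennreal (c1 + c2 * (1 + ?r l x)))"
      using c by (subst sum_ennreal) (auto intro!: ennreal_mult sum_nonneg add_nonneg_nonneg mult_nonneg_nonneg)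
    finally show "ennreal (?c x) \<le>
      ennreal ((L * ?d) powr p) * (\<Sum>l\<in>UNIV. ennreal c1 + ennreal c2 * ennreal (1 + ?r l x))"
      unfolding eq .
  qed
  also have "\<dots> = ennreal ((L * ?d) powr p) * (\<Sum>l\<in>UNIV. ennreal c1 + ennreal c2 *
      (\<integral>\<^sup>+x. ennreal (1 + ?r l x) \<partial>\<mu>))"
    by (simp add: nn_integral_cmult nn_integral_sum nn_integral_add emeasure_space_1)
  also have "\<dots> \<le> ennreal ((L * ?d) powr p) * (\<Sum>l\<in>(UNIV::'n set). ennreal c1 + ennreal c2 * ennreal M)"
    by (intro mult_left_mono sum_mono add_left_mono moment_class_coordinate[OF \<mu>]) auto
  also have "\<dots> = ennreal ((L * ?d) powr p) * (\<Sum>l\<in>(UNIV::'n set). ennreal (c1 + c2 * M))"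
    using c M by (simp add: ennreal_plus[symmetric] ennreal_mult[symmetric] del: ennreal_plus)
  also have "\<dots> = ennreal ((L * ?d) powr p) * ennreal (\<Sum>l\<in>(UNIV::'n set). c1 + c2 * M)"
    using c M by (subst sum_ennreal) auto
  also have "\<dots> = ennreal ((L * ?d) powr p * ?d * (c1 + c2 * M))"
    using c M by (subst ennreal_mult[symmetric]) (auto simp: mult.assoc)
  finally show ?thesis by (simp add: c1_def c2_def)
qed

section \<open>The grid estimator and its risk\<close>

definition noise_char :: "(real^'n) measure \<Rightarrow> real^'n^'n \<Rightarrow> 'n \<Rightarrow> real \<Rightarrow> complex" where
  "noise_char \<nu> A l = char (distr \<nu> borel (\<lambda>x. (A *v x) $ l))"

definition box_kernel ::
  "(real^'n) measure \<Rightarrow> nat \<Rightarrow> nat \<Rightarrow> real \<Rightarrow> real^'n^'n \<Rightarrow> ('n \<Rightarrow> nat) \<Rightarrow> real^'n \<Rightarrow> complex" where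
  "box_kernel \<nu> m N \<theta> A i y =
     (\<Prod>l\<in>UNIV. deconv_jackson (noise_char \<nu> A l) m N \<theta> (i l) ((A *v y) $ l))"

definition cell_estimate ::
  "(real^'n) measure \<Rightarrow> nat \<Rightarrow> nat \<Rightarrow> real \<Rightarrow> real^'n^'n \<Rightarrow> nat \<Rightarrow> (nat \<Rightarrow> real^'n) \<Rightarrow> ('n \<Rightarrow> nat) \<Rightarrow> real" where
  "cell_estimate \<nu> m N \<theta> A n y i = (\<Sum>j\<in>{1..n}. Re (box_kernel \<nu> m N \<theta> A i (y j))) / real n"

definition grid_estimator ::
  "(real^'n) measure \<Rightarrow> nat \<Rightarrow> nat \<Rightarrow> real \<Rightarrow> real^'n^'n \<Rightarrow> nat \<Rightarrow> (nat \<Rightarrow> real^'n) \<Rightarrow> (real^'n) measure" where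
  "grid_estimator \<nu> m N \<theta> A n y = finite_dist (cells (Suc m * N))
     (normalized_weights (cells (Suc m * N)) (cell_estimate \<nu> m N \<theta> A n y)) (node m N \<theta> A)"

lemma box_kernel_measurable [measurable]: "box_kernel \<nu> m N \<theta> A i \<in> borel_measurable borel"
  unfolding box_kernel_def by measurable

lemma cell_estimate_measurable [measurable]:
  "(\<lambda>y. cell_estimate \<nu> m N \<theta> A n y i) \<in> borel_measurable (PiM {1..n} (\<lambda>_. borel))"
  unfolding cell_estimate_def by measurable

lemma cells_nonempty: "G > 0 \<Longrightarrow> cells G \<noteq> {}"
  unfolding cells_def by (auto simp: PiE_eq_empty_iff)

lemma grid_estimator_measurable:
  assumes "N > 0"
  shows "grid_estimator \<nu> m N \<theta> A n \<in> measurable (PiM {1..n} (\<lambda>_. borel)) (prob_algebra borel)"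
  unfolding grid_estimator_def
  by (rule finite_dist_measurable)
     (use assms in \<open>auto simp: normalized_weights_nonneg sum_normalized_weights cells_nonempty simp del: One_nat_def mult_Suc\<close>)

lemma convolution_prob:
  assumes "prob_space \<mu>" "sets \<mu> = sets borel" "prob_space \<nu>" "sets \<nu> = sets borel"
  shows "prob_space (\<mu> \<star> \<nu>)"
proof -
  interpret M: prob_space \<mu> by fact
  interpret N: prob_space \<nu> by fact
  interpret pair_prob_space \<mu> \<nu> ..
  note [measurable_cong] = assms(2,4)
  show ?thesis unfolding convolution_def by (rule prob_space_distr) measurable
qed

text \<open>The constant \<open>s\<close> measures how fast the characteristic functions of the coordinates of \<open>A *v \<epsilon>\<close>
  decay. Coordinates without noise are included.\<close>

locale decoupled_noise =
  fixes \<mu>\<^sub>\<epsilon> :: "(real^'n) measure" and A :: "real^'n^'n" and s :: real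
  assumes prob_noise: "prob_space \<mu>\<^sub>\<epsilon>" and sets_noise: "sets \<mu>\<^sub>\<epsilon> = sets borel"
    and invertible_A: "invertible A"
    and indep: "prob_space.indep_vars \<mu>\<^sub>\<epsilon> (\<lambda>_. borel) (\<lambda>j x. (A *v x) $ j) UNIV"
    and s_nonneg: "s \<ge> 0"
    and char_lower: "\<And>l t. exp (- (s * t\<^sup>2)) \<le> cmod (noise_char \<mu>\<^sub>\<epsilon> A l t)"
begin

lemma noise_char_nonzero: "noise_char \<mu>\<^sub>\<epsilon> A l t \<noteq> 0"
  using char_lower[of t l] by (metis exp_gt_zero norm_zero not_le)

lemma box_kernel_bound:
  assumes "N > 0"
  shows "cmod (box_kernel \<mu>\<^sub>\<epsilon> m N \<theta> A i y) \<le> exp (s * (real (Suc m * N) * \<theta>)\<^sup>2) ^ CARD('n)"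
proof -
  have "cmod (box_kernel \<mu>\<^sub>\<epsilon> m N \<theta> A i y) =
     (\<Prod>l\<in>UNIV. cmod (deconv_jackson (noise_char \<mu>\<^sub>\<epsilon> A l) m N \<theta> (i l) ((A *v y) $ l)))"
    by (simp add: box_kernel_def prod_norm)
  also have "\<dots> \<le> (\<Prod>l\<in>(UNIV::'n set). exp (s * (real (Suc m * N) * \<theta>)\<^sup>2))"
    by (intro prod_mono conjI norm_ge_zero deconv_jackson_bound assms char_lower s_nonneg)
  finally show ?thesis by simp
qed

text \<open>Independence of the noise coordinates splits the average of the product into the one-dimensional
  averages.\<close>

lemma box_kernel_unbiased:
  assumes "N > 0"
  shows "(\<integral>e. box_kernel \<mu>\<^sub>\<epsilon> m N \<theta> A i (x + e) \<partial>\<mu>\<^sub>\<epsilon>) = of_real (box_weight m N \<theta> A i x)"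
proof -
  interpret prob_space \<mu>\<^sub>\<epsilon> by (rule prob_noise)
  note [measurable_cong] = sets_noise
  let ?f = "\<lambda>l z. deconv_jackson (noise_char \<mu>\<^sub>\<epsilon> A l) m N \<theta> (i l) ((A *v x) $ l + z)"
  have "(\<integral>e. box_kernel \<mu>\<^sub>\<epsilon> m N \<theta> A i (x + e) \<partial>\<mu>\<^sub>\<epsilon>) = (\<integral>e. (\<Prod>l\<in>UNIV. ?f l ((A *v e) $ l)) \<partial>\<mu>\<^sub>\<epsilon>)"
    unfolding box_kernel_def by (simp add: matrix_vector_right_distrib)
  also have "\<dots> = (\<Prod>l\<in>UNIV. \<integral>e. ?f l ((A *v e) $ l) \<partial>\<mu>\<^sub>\<epsilon>)"
  proof (rule indep_vars_lebesgue_integral)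
    show "indep_vars (\<lambda>_. borel) (\<lambda>l e. ?f l ((A *v e) $ l)) UNIV"
      by (rule indep_vars_compose2[OF indep]) measurable
    show "integrable \<mu>\<^sub>\<epsilon> (\<lambda>e. ?f l ((A *v e) $ l))" for l
    proof (rule integrable_const_bound)
      show "AE e in \<mu>\<^sub>\<epsilon>. cmod (?f l ((A *v e) $ l)) \<le> exp (s * (real (Suc m * N) * \<theta>)\<^sup>2)"
        by (intro AE_I2 deconv_jackson_bound assms char_lower s_nonneg)
    qed measurable
  qed simp
  also have "\<dots> = (\<Prod>l\<in>UNIV. of_real (jackson m N (i l) (\<theta> * (A *v x) $ l)))"
  proof (intro prod.cong refl)
    fix l
    let ?\<nu> = "distr \<mu>\<^sub>\<epsilon> borel (\<lambda>x. (A *v x) $ l)"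
    have "(\<integral>e. ?f l ((A *v e) $ l) \<partial>\<mu>\<^sub>\<epsilon>) = (\<integral>z. ?f l z \<partial>?\<nu>)"
      by (rule integral_distr[symmetric]) measurable
    also have "\<dots> = of_real (jackson m N (i l) (\<theta> * (A *v x) $ l))"
      unfolding noise_char_def
      by (rule deconv_jackson_integral)
         (use noise_char_nonzero[of l, unfolded noise_char_def] in \<open>auto intro!: prob_space_distr\<close>)
    finally show "(\<integral>e. ?f l ((A *v e) $ l) \<partial>\<mu>\<^sub>\<epsilon>) = of_real (jackson m N (i l) (\<theta> * (A *v x) $ l))" .
  qed
  finally show ?thesis by (simp add: box_weight_def)
qed

lemma box_kernel_expectation:
  assumes \<mu>: "prob_space \<mu>" "sets \<mu> = sets borel" and N: "N > 0"
  shows "(\<integral>y. Re (box_kernel \<mu>\<^sub>\<epsilon> m N \<theta> A i y) \<partial>(\<mu> \<star> \<mu>\<^sub>\<epsilon>)) = (\<integral>x. box_weight m N \<theta> A i x \<partial>\<mu>)"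
proof -
  interpret M: prob_space \<mu> by fact
  interpret E: prob_space \<mu>\<^sub>\<epsilon> by (rule prob_noise)
  interpret pair_prob_space \<mu> \<mu>\<^sub>\<epsilon> ..
  note [measurable_cong] = assms(2) sets_noise
  let ?B = "exp (s * (real (Suc m * N) * \<theta>)\<^sup>2) ^ CARD('n)"
  let ?k = "box_kernel \<mu>\<^sub>\<epsilon> m N \<theta> A i"
  have int: "integrable \<mu>\<^sub>\<epsilon> (\<lambda>e. ?k (x + e))" for x
    by (rule E.integrable_const_bound[where B="?B"])
       (intro AE_I2 box_kernel_bound N, measurable)
  have "(\<integral>y. Re (?k y) \<partial>(\<mu> \<star> \<mu>\<^sub>\<epsilon>)) = (\<integral>v. Re (?k (fst v + snd v)) \<partial>(\<mu> \<Otimes>\<^sub>M \<mu>\<^sub>\<epsilon>))"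
    unfolding convolution_def by (subst integral_distr) (simp_all add: split_def)
  also have "\<dots> = (\<integral>x. \<integral>e. Re (?k (x + e)) \<partial>\<mu>\<^sub>\<epsilon> \<partial>\<mu>)"
  proof (subst integral_fst'[symmetric])
    show "integrable (\<mu> \<Otimes>\<^sub>M \<mu>\<^sub>\<epsilon>) (\<lambda>v. Re (?k (fst v + snd v)))"
    proof (rule integrable_const_bound[where B="?B"])
      show "AE v in \<mu> \<Otimes>\<^sub>M \<mu>\<^sub>\<epsilon>. norm (Re (?k (fst v + snd v))) \<le> ?B"
        using box_kernel_bound[OF N] abs_Re_le_cmod by (intro AE_I2) (metis order_trans real_norm_def)
    qed measurable
  qed simp
  also have "\<dots> = (\<integral>x. box_weight m N \<theta> A i x \<partial>\<mu>)"
    using box_kernel_unbiased[OF N, of m \<theta> i] by (simp add: int)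
  finally show ?thesis .
qed

text \<open>Bias plus stochastic error for fixed \<open>N\<close> and \<open>\<theta>\<close>. The nodes lie within distance of order
  \<open>1 / \<theta>\<close> from each other, and there are \<open>(Suc m * N) ^ CARD('n)\<close> weights, each estimated with error
  \<open>B / sqrt n\<close>, where \<open>B\<close> bounds the deconvolved kernels.\<close>

lemma grid_estimator_risk:
  assumes \<mu>: "\<mu> \<in> moment_class A M p a" and N: "N > 0" and \<theta>: "\<theta> > 0"
    and p: "1 \<le> p" "p \<le> 2 * real m" and a: "a > 0" and M: "M \<ge> 0"
    and L: "L \<ge> 0" "\<And>v. norm (matrix_inv A *v v) \<le> L * norm v" and n: "n \<ge> 1"
    and T: "T n = grid_estimator \<mu>\<^sub>\<epsilon> m N \<theta> A n"
  shows "risk p \<mu>\<^sub>\<epsilon> T n \<mu> \<le> ennreal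
    ((1 + 2 powr p) * ((L * real CARD('n)) powr p * real CARD('n) *
        (jackson_const m / (\<theta> * real N) powr p + 3 powr p * \<theta> powr p * M)) +
     2 powr p * (2 * pi * L * real CARD('n) / \<theta>) powr p *
       (2 * (real (Suc m * N) ^ CARD('n) *
          (exp (s * (real (Suc m * N) * \<theta>)\<^sup>2) ^ CARD('n) / sqrt (real n)))))"
proof -
  let ?I = "cells (Suc m * N) :: ('n \<Rightarrow> nat) set" and ?Q = "\<mu> \<star> \<mu>\<^sub>\<epsilon>"
  let ?d = "real CARD('n)" and ?\<psi> = "box_weight m N \<theta> A" and ?z = "node m N \<theta> A"
  define B where "B = exp (s * (real (Suc m * N) * \<theta>)\<^sup>2) ^ CARD('n)"
  define D where "D = 2 * pi * L * ?d / \<theta>"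
  define S where "S = (L * ?d) powr p * ?d * (jackson_const m / (\<theta> * real N) powr p + 3 powr p * \<theta> powr p * M)"
  define v where "v y i = cell_estimate \<mu>\<^sub>\<epsilon> m N \<theta> A n y i" for y i
  define q where "q i = (\<integral>x. box_weight m N \<theta> A i x \<partial>\<mu>)" for i
  have prob: "prob_space \<mu>" and sets: "sets \<mu> = sets borel" using moment_classD[OF \<mu>] by auto
  interpret M: prob_space \<mu> by fact
  note [measurable_cong] = sets
  interpret Q: prob_space ?Q by (rule convolution_prob[OF prob sets prob_noise sets_noise])
  have I: "finite ?I" "?I \<noteq> {}" using N by (auto simp: cells_nonempty)
  have S0: "S \<ge> 0" using M by (simp add: S_def jackson_const_def)
  have sumq: "(\<Sum>i\<in>?I. q i) = 1" and q0: "q i \<ge> 0" for i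
  proof -
    have "integrable \<mu> (?\<psi> i)" if "i \<in> ?I" for i
    proof (rule M.integrable_const_bound[of _ 1])
      have "?\<psi> i x \<le> 1" for x
        using member_le_sum[of i ?I "\<lambda>i. ?\<psi> i x"] that
        by (simp add: box_weight_nonneg sum_box_weight[OF N] del: mult_Suc)
      then show "AE x in \<mu>. norm (?\<psi> i x) \<le> 1" by (simp add: box_weight_nonneg)
    qed measurable
    then show "(\<Sum>i\<in>?I. q i) = 1"
      unfolding q_def
      by (subst Bochner_Integration.integral_sum[symmetric]) (simp_all only: sum_box_weight[OF N], simp add: M.prob_space)
    show "q i \<ge> 0" by (simp add: q_def box_weight_nonneg)
  qed
  have D: "norm (node m N \<theta> A k - node m N \<theta> A i) \<le> D" if "i \<in> ?I" "k \<in> ?I" for i k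
  proof -
    let ?w = "(\<chi> l. grid (Suc m * N) (k l) / \<theta>) - (\<chi> l. grid (Suc m * N) (i l) / \<theta>) :: real^'n"
    have "norm ?w \<le> (\<Sum>l\<in>UNIV. \<bar>?w $ l\<bar>)" by (rule norm_le_l1_cart)
    also have "\<dots> \<le> (\<Sum>l\<in>(UNIV::'n set). 2 * pi / \<theta>)"
    proof (rule sum_mono)
      fix l
      have "\<bar>grid (Suc m * N) (k l)\<bar> \<le> pi" "\<bar>grid (Suc m * N) (i l)\<bar> \<le> pi"
        using that by (auto intro!: abs_grid_le dest: cellsD simp del: mult_Suc)
      then have "\<bar>grid (Suc m * N) (k l) - grid (Suc m * N) (i l)\<bar> \<le> 2 * pi" by linarith
      then show "\<bar>?w $ l\<bar> \<le> 2 * pi / \<theta>"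
        using \<theta> by (simp add: divide_right_mono flip: diff_divide_distrib)
    qed
    finally have w: "norm ?w \<le> ?d * (2 * pi / \<theta>)" by simp
    have "norm (node m N \<theta> A k - node m N \<theta> A i) = norm (matrix_inv A *v ?w)"
      by (simp add: node_def matrix_vector_mult_diff_distrib)
    also have "\<dots> \<le> L * norm ?w" by (rule L)
    also have "\<dots> \<le> L * (?d * (2 * pi / \<theta>))" using w L(1) by (rule mult_left_mono)
    finally show ?thesis by (simp add: D_def mult_ac)
  qed
  have pointwise: "epowr (wasserstein p (T n y) \<mu>) p \<le>
     ennreal ((1 + 2 powr p) * S) + ennreal (2 powr p * D powr p * 2) * (\<Sum>i\<in>?I. ennreal \<bar>v y i - q i\<bar>)" for y
  proof -
    let ?w = "normalized_weights ?I (v y)"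
    have Tn: "T n y = finite_dist ?I ?w (?z)"
      unfolding T grid_estimator_def v_def ..
    have "epowr (wasserstein p (T n y) \<mu>) p \<le>
      ennreal (1 + 2 powr p) * (\<integral>\<^sup>+x. ennreal (\<Sum>i\<in>?I. ?\<psi> i x * norm (?z i - x) powr p) \<partial>\<mu>)
        + ennreal (2 powr p * D powr p * (\<Sum>i\<in>?I. \<bar>?w i - (\<integral>x. ?\<psi> i x \<partial>\<mu>)\<bar>))"
      unfolding Tn
    proof (rule wasserstein_le_smoothing_plus_weights[OF prob sets _ I(1)])
      show "(\<Sum>i\<in>?I. ?\<psi> i x) = 1" for x by (rule sum_box_weight[OF N])
      show "sum ?w ?I = 1" by (rule sum_normalized_weights[OF I])
      show "D \<ge> 0" using L \<theta> by (simp add: D_def)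
    qed (use p D in \<open>auto simp: box_weight_nonneg normalized_weights_nonneg\<close>)
    also have "\<dots> \<le> ennreal (1 + 2 powr p) * ennreal S +
       ennreal (2 powr p * D powr p * (2 * (\<Sum>i\<in>?I. \<bar>v y i - q i\<bar>)))"
      unfolding S_def q_def[symmetric]
      by (intro add_mono mult_left_mono ennreal_leI smoothing_cost[OF invertible_A \<mu> N \<theta> p a M L]
            normalized_weights_error I q0 sumq) auto
    also have "ennreal (1 + 2 powr p) * ennreal S = ennreal ((1 + 2 powr p) * S)"
      using S0 by (intro ennreal_mult[symmetric]) auto
    also have "ennreal (2 powr p * D powr p * (2 * (\<Sum>i\<in>?I. \<bar>v y i - q i\<bar>))) =
      ennreal (2 powr p * D powr p * 2) * ennreal (\<Sum>i\<in>?I. \<bar>v y i - q i\<bar>)"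
      by (subst ennreal_mult[symmetric]) (auto intro!: sum_nonneg simp: mult.assoc)
    also have "ennreal (\<Sum>i\<in>?I. \<bar>v y i - q i\<bar>) = (\<Sum>i\<in>?I. ennreal \<bar>v y i - q i\<bar>)"
      by (rule sum_ennreal[symmetric]) auto
    finally show ?thesis .
  qed
  let ?P = "PiM {1..n} (\<lambda>_. ?Q)"
  interpret P: product_prob_space "\<lambda>_. ?Q" "{1..n}" ..
  have v_meas [measurable]: "(\<lambda>y. v y i) \<in> borel_measurable ?P" for i
  proof -
    have "sets ?P = sets (PiM {1..n} (\<lambda>_. borel))" by (intro sets_PiM_cong) auto
    then show ?thesis unfolding v_def using cell_estimate_measurable measurable_cong_sets by blast
  qed
  have dev: "(\<integral>\<^sup>+y. ennreal \<bar>v y i - q i\<bar> \<partial>?P) \<le> ennreal (B / sqrt (real n))" for i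
  proof -
    let ?k = "box_kernel \<mu>\<^sub>\<epsilon> m N \<theta> A i"
    have "q i = (\<integral>y. Re (?k y) \<partial>?Q)"
      unfolding q_def by (rule box_kernel_expectation[OF prob sets N, symmetric])
    moreover have "(\<integral>\<^sup>+y. ennreal \<bar>(\<Sum>j\<in>{1..n}. Re (?k (y j))) / real n -
        (\<integral>y. Re (?k y) \<partial>?Q)\<bar> \<partial>?P) \<le> ennreal (B / sqrt (real n))"
    proof (rule sample_mean_L1_deviation[OF Q.prob_space_axioms])
      show "\<bar>Re (?k y)\<bar> \<le> B" for y
        unfolding B_def using box_kernel_bound[OF N] abs_Re_le_cmod order_trans by metis
      show "B > 0" by (simp add: B_def)
    qed (use n in auto)
    ultimately show ?thesis unfolding v_def cell_estimate_def by simp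
  qed
  have "risk p \<mu>\<^sub>\<epsilon> T n \<mu> \<le> (\<integral>\<^sup>+y. ennreal ((1 + 2 powr p) * S) +
      ennreal (2 powr p * D powr p * 2) * (\<Sum>i\<in>?I. ennreal \<bar>v y i - q i\<bar>) \<partial>?P)"
    unfolding risk_def by (rule nn_integral_mono) (rule pointwise)
  also have "\<dots> = ennreal ((1 + 2 powr p) * S) +
      ennreal (2 powr p * D powr p * 2) * (\<Sum>i\<in>?I. \<integral>\<^sup>+y. ennreal \<bar>v y i - q i\<bar> \<partial>?P)"
    by (subst nn_integral_add; (subst nn_integral_cmult)?; (subst nn_integral_sum)?)
       (simp_all add: P.P.emeasure_space_1 del: One_nat_def mult_Suc)
  also have "\<dots> \<le> ennreal ((1 + 2 powr p) * S) +
      ennreal (2 powr p * D powr p * 2) * (\<Sum>i\<in>?I. ennreal (B / sqrt (real n)))"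
    by (intro add_left_mono mult_left_mono sum_mono dev) auto
  also have "(\<Sum>i\<in>?I. ennreal (B / sqrt (real n))) = ennreal (\<Sum>i\<in>?I. B / sqrt (real n))"
    by (rule sum_ennreal) (simp add: B_def)
  also have "(\<Sum>i\<in>?I. B / sqrt (real n)) = real (Suc m * N) ^ CARD('n) * (B / sqrt (real n))"
    by (simp add: card_cells del: mult_Suc)
  also have "ennreal ((1 + 2 powr p) * S) + ennreal (2 powr p * D powr p * 2) *
      ennreal (real (Suc m * N) ^ CARD('n) * (B / sqrt (real n))) =
    ennreal ((1 + 2 powr p) * S + 2 powr p * D powr p * (2 * (real (Suc m * N) ^ CARD('n) * (B / sqrt (real n)))))"
    using S0 unfolding B_def
    by (subst ennreal_mult[symmetric], simp, simp, subst ennreal_plus[symmetric]) (simp_all add: mult.assoc)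
  finally show ?thesis unfolding S_def B_def D_def .
qed

end

lemma poly_times_exp_bound:
  fixes x k :: real
  assumes "x \<ge> 0" "k \<ge> 1"
  shows "(x + 2) powr k * exp (- (x / 4)) \<le> (8 * k) powr k"
proof -
  have "8 * k * (1 + x / (4 * k)) = 8 * k + 2 * x" using assms by (simp add: field_simps)
  then have "x + 2 \<le> 8 * k * (1 + x / (4 * k))" using assms by linarith
  also have "\<dots> \<le> 8 * k * exp (x / (4 * k))"
    using assms exp_ge_add_one_self[of "x / (4 * k)"] by (intro mult_left_mono) auto
  finally have "(x + 2) powr k \<le> (8 * k * exp (x / (4 * k))) powr k"
    using assms by (intro powr_mono2) auto
  also have "\<dots> = (8 * k) powr k * exp (x / 4)"
    using assms by (simp add: powr_mult powr_def[of "exp _"])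
  finally show ?thesis by (simp add: exp_minus field_simps)
qed

context decoupled_noise
begin

text \<open>The resolution \<open>\<theta> * N = \<beta> * sqrt (ln n)\<close> is the finest that the noise permits, up to the
  choice of \<open>\<beta>\<close>, which is so small that the
  deconvolved kernels stay below \<open>n powr (1 / 4)\<close>, and the stochastic error, a power of \<open>ln n\<close> times
  \<open>n powr (- 1 / 4)\<close>, is negligible. With \<open>N\<close> of order \<open>ln n\<close> also \<open>\<theta>\<close> is of order \<open>1 / sqrt (ln n)\<close>,
  so the truncation error has the same order as the smoothing error.\<close>

lemma log_rate_estimator:
  assumes M: "M > 0" and p: "p \<ge> 1" and a: "a > 1"
  shows "\<exists>T. estimator T \<and> (\<exists>K>0. (SUP n\<in>{1..}. SUP \<mu>\<in>moment_class A M p a.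
    ennreal (ln (real n) powr (p / 2)) * risk p \<mu>\<^sub>\<epsilon> T n \<mu>) \<le> ennreal K)"
proof -
  define d where "d = real CARD('n)"
  have d: "d \<ge> 1" unfolding d_def by (simp add: Suc_leI)
  define m where "m = nat \<lceil>p\<rceil>"
  have m: "p \<le> 2 * real m" using p unfolding m_def by linarith
  obtain L where L: "L \<ge> 0" "\<And>v. norm (matrix_inv A *v v) \<le> L * norm v"
    using bounded_linear.nonneg_bounded[OF matrix_vector_mul_bounded_linear[of "matrix_inv A"]]
    by (auto simp: mult.commute)
  \<comment> \<open>chosen such that \<open>d * s * (Suc m * \<beta>)\<^sup>2 \<le> 1 / 4\<close>, the exponent that the deconvolution may cost\<close>
  define \<beta> where "\<beta> = 1 / (2 * real (Suc m) * sqrt (d * s + 1))"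
  have ds: "d * s \<ge> 0" using d s_nonneg by simp
  then have \<beta>: "\<beta> > 0" unfolding \<beta>_def by (auto intro!: divide_pos_pos mult_pos_pos)
  have \<beta>_small: "d * (s * (real (Suc m) * \<beta>)\<^sup>2) \<le> 1 / 4"
  proof -
    have "real (Suc m) * \<beta> = 1 / (2 * sqrt (d * s + 1))"
      by (simp add: \<beta>_def del: of_nat_Suc)
    then have "(real (Suc m) * \<beta>)\<^sup>2 = 1 / (4 * (d * s + 1))"
      using ds by (simp add: power_divide power_mult_distrib)
    then have "d * (s * (real (Suc m) * \<beta>)\<^sup>2) = (d * s) / (4 * (d * s + 1))" by simp
    also have "\<dots> \<le> 1 / 4" using ds by (simp add: field_simps)
    finally show ?thesis .
  qed
  \<comment> \<open>the summand 1 keeps the grid nonempty for \<open>n = 1\<close>\<close>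
  define N where "N n = nat \<lceil>ln (real n)\<rceil> + 1" for n :: nat
  define \<theta> where "\<theta> n = \<beta> * sqrt (ln (real n)) / real (N n)" for n :: nat
  define T where "T n = grid_estimator \<mu>\<^sub>\<epsilon> m (N n) (\<theta> n) A n" for n
  define c1 where "c1 = (1 + 2 powr p) * ((L * d) powr p * d)"
  define c2 where "c2 = 2 powr p * (2 * pi * L * d / \<beta>) powr p * 2 * real (Suc m) ^ CARD('n)"
  define k where "k = p + d"
  have jc: "jackson_const m \<ge> 0" by (simp add: jackson_const_def)
  define K where "K = c1 * (jackson_const m / \<beta> powr p + 3 powr p * \<beta> powr p * M) + c2 * (8 * k) powr k + 1"
  have c: "c1 \<ge> 0" "c2 \<ge> 0" using d by (auto simp: c1_def c2_def)
  have "K > 0" using c jc M unfolding K_def by (intro add_nonneg_pos add_nonneg_nonneg mult_nonneg_nonneg) auto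
  have "estimator T"
    unfolding estimator_def T_def by (intro allI impI grid_estimator_measurable) (simp add: N_def)
  have bound: "ennreal (ln (real n) powr (p / 2)) * risk p \<mu>\<^sub>\<epsilon> T n \<mu> \<le> ennreal K"
    if n: "n \<ge> 1" and \<mu>: "\<mu> \<in> moment_class A M p a" for n \<mu>
  proof (cases "n = 1")
    case True
    then show ?thesis by simp
  next
    case False
    define x where "x = ln (real n)"
    have x: "x > 0" using False n by (simp add: x_def)
    have N1: "real (N n) \<ge> 1" "real (N n) \<ge> x" "real (N n) \<le> x + 2"
      using x unfolding N_def x_def[symmetric] by linarith+
    have \<theta>: "\<theta> n > 0" using \<beta> x N1 by (simp add: \<theta>_def x_def[symmetric])
    have \<theta>N: "\<theta> n * real (N n) = \<beta> * sqrt x" using N1 by (simp add: \<theta>_def x_def)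
    have x_powr: "x powr (p / 2) = sqrt x powr p" using x by (simp add: powr_half_sqrt[symmetric] powr_powr)
    let ?E = "exp (s * (real (Suc m * N n) * \<theta> n)\<^sup>2) ^ CARD('n)"
    define R1 where "R1 = jackson_const m / (\<theta> n * real (N n)) powr p + 3 powr p * \<theta> n powr p * M"
    define R2 where "R2 = (2 * pi * L * d / \<theta> n) powr p * (real (Suc m * N n) ^ CARD('n) *
          (?E / sqrt (real n)))"
    have R1: "x powr (p / 2) * R1 \<le> jackson_const m / \<beta> powr p + 3 powr p * \<beta> powr p * M"
    proof -
      have "x powr (p / 2) * (jackson_const m / (\<theta> n * real (N n)) powr p) = jackson_const m / \<beta> powr p"
        unfolding \<theta>N x_powr using \<beta> x by (simp add: powr_mult)
      moreover have "x powr (p / 2) * (3 powr p * \<theta> n powr p * M) \<le> 3 powr p * \<beta> powr p * M"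
      proof -
        have "sqrt x * \<theta> n = \<beta> * (x / real (N n))" using x by (simp add: \<theta>_def x_def[symmetric])
        also have "\<dots> \<le> \<beta> * 1" using \<beta> N1 by (intro mult_left_mono) auto
        finally have "(sqrt x * \<theta> n) powr p \<le> \<beta> powr p" using p x \<theta> by (intro powr_mono2) auto
        then have "3 powr p * M * (sqrt x powr p * \<theta> n powr p) \<le> 3 powr p * M * \<beta> powr p"
          using M x \<theta> by (intro mult_left_mono) (auto simp: powr_mult)
        then show ?thesis unfolding x_powr by (simp add: mult_ac)
      qed
      ultimately show ?thesis by (simp add: R1_def distrib_left)
    qed
    have R2: "2 powr p * 2 * (x powr (p / 2) * R2) \<le> c2 * (8 * k) powr k"
    proof -
      have "sqrt x * (2 * pi * L * d / \<theta> n) = 2 * pi * L * d / \<beta> * real (N n)"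
        using x \<beta> N1 by (simp add: \<theta>_def x_def[symmetric] field_simps)
      then have e1: "x powr (p / 2) * (2 * pi * L * d / \<theta> n) powr p = (2 * pi * L * d / \<beta>) powr p * real (N n) powr p"
        unfolding x_powr using x L d \<theta> \<beta> N1 by (simp add: powr_mult[symmetric])
      have e2: "?E / sqrt (real n) \<le> exp (- (x / 4))"
      proof -
        have "s * (real (Suc m * N n) * \<theta> n)\<^sup>2 = s * (real (Suc m) * (\<theta> n * real (N n)))\<^sup>2"
          by (simp only: of_nat_mult mult_ac)
        also have "\<dots> = s * (real (Suc m) * \<beta>)\<^sup>2 * x"
          unfolding \<theta>N using x by (simp add: power_mult_distrib)
        finally have "?E = exp (d * (s * (real (Suc m) * \<beta>)\<^sup>2) * x)"
          by (simp only: exp_of_nat_mult[symmetric] d_def mult.assoc)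
        also have "\<dots> \<le> exp (1 / 4 * x)" using \<beta>_small x by (simp del: of_nat_Suc)
        finally have le: "?E \<le> exp (x / 4)" by simp
        have "sqrt (real n) = exp (x / 2)"
        proof -
          have "real n = exp x" using n by (simp add: x_def)
          also have "\<dots> = (exp (x / 2))\<^sup>2" by (simp add: power2_eq_square exp_add[symmetric])
          finally show ?thesis by simp
        qed
        then have "?E / sqrt (real n) \<le> exp (x / 4) / exp (x / 2)"
          using le by (simp add: divide_right_mono del: mult_Suc of_nat_mult)
        also have "\<dots> = exp (- (x / 4))" by (simp flip: exp_diff)
        finally show ?thesis .
      qed
      have e3: "real (Suc m * N n) ^ CARD('n) = real (Suc m) ^ CARD('n) * real (N n) powr d"
        using N1 by (simp add: d_def powr_realpow power_mult_distrib del: of_nat_Suc mult_Suc)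
      have "2 powr p * 2 * (x powr (p / 2) * R2) =
        c2 * (real (N n) powr p * real (N n) powr d *
          (?E / sqrt (real n)))"
        unfolding R2_def c2_def e3 mult.assoc[symmetric, of "x powr (p / 2)"] e1
        by (simp add: mult_ac del: of_nat_Suc mult_Suc)
      also have "\<dots> \<le> c2 * (real (N n) powr p * real (N n) powr d * exp (- (x / 4)))"
        using c e2 by (intro mult_left_mono) auto
      also have "real (N n) powr p * real (N n) powr d = real (N n) powr k"
        by (simp add: k_def powr_add)
      also have "c2 * (real (N n) powr k * exp (- (x / 4))) \<le> c2 * ((x + 2) powr k * exp (- (x / 4)))"
        using c N1 p d by (intro mult_left_mono mult_right_mono powr_mono2) (auto simp: k_def)
      also have "\<dots> \<le> c2 * (8 * k) powr k"
        using c x p d by (intro mult_left_mono poly_times_exp_bound) (auto simp: k_def)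
      finally show ?thesis .
    qed
    have "risk p \<mu>\<^sub>\<epsilon> T n \<mu> \<le> ennreal (c1 * R1 + 2 powr p * 2 * R2)"
    proof -
      have "risk p \<mu>\<^sub>\<epsilon> T n \<mu> \<le> ennreal
       ((1 + 2 powr p) * ((L * real CARD('n)) powr p * real CARD('n) *
          (jackson_const m / (\<theta> n * real (N n)) powr p + 3 powr p * \<theta> n powr p * M)) +
       2 powr p * (2 * pi * L * real CARD('n) / \<theta> n) powr p *
         (2 * (real (Suc m * N n) ^ CARD('n) *
            (?E / sqrt (real n)))))"
        by (rule grid_estimator_risk[OF \<mu> _ \<theta> p m]) (use a M L n N1 in \<open>auto simp: T_def\<close>)
      also have "\<dots> = ennreal (c1 * R1 + 2 powr p * 2 * R2)"
        unfolding c1_def R1_def R2_def d_def by (simp only: mult_ac)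
      finally show ?thesis .
    qed
    then have "ennreal (x powr (p / 2)) * risk p \<mu>\<^sub>\<epsilon> T n \<mu> \<le>
       ennreal (x powr (p / 2)) * ennreal (c1 * R1 + 2 powr p * 2 * R2)"
      by (intro mult_left_mono) auto
    also have "\<dots> = ennreal (c1 * (x powr (p / 2) * R1) + 2 powr p * 2 * (x powr (p / 2) * R2))"
      by (subst ennreal_mult'[symmetric]) (auto simp: algebra_simps)
    also have "\<dots> \<le> ennreal K"
    proof (rule ennreal_leI)
      have "c1 * (x powr (p / 2) * R1) \<le> c1 * (jackson_const m / \<beta> powr p + 3 powr p * \<beta> powr p * M)"
        using c R1 by (intro mult_left_mono) auto
      with R2 show "c1 * (x powr (p / 2) * R1) + 2 powr p * 2 * (x powr (p / 2) * R2) \<le> K"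
        unfolding K_def by linarith
    qed
    finally show ?thesis by (simp add: x_def)
  qed
  show ?thesis
    using \<open>estimator T\<close> \<open>K > 0\<close> bound by (intro exI[of _ T] exI[of _ K] conjI SUP_least) auto
qed

end

section \<open>Two hypotheses and the risk\<close>

text \<open>Jensen's inequality on the closed half-line, from the tangent to \<open>\<lambda>t. t powr p\<close> at the mean \<open>e\<close>,
  which is Young's inequality for \<open>t powr p\<close> and \<open>e powr p\<close>.\<close>

lemma (in prob_space) powr_expectation_le:
  fixes f :: "'a \<Rightarrow> real"
  assumes p: "p \<ge> 1" and [measurable]: "f \<in> borel_measurable M"
    and f: "\<And>x. 0 \<le> f x" "\<And>x. f x \<le> B"
  shows "expectation f powr p \<le> expectation (\<lambda>x. f x powr p)"
proof (cases "expectation f = 0")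
  case True
  moreover have "0 \<le> expectation (\<lambda>x. f x powr p)" by (rule Bochner_Integration.integral_nonneg) simp
  ultimately show ?thesis by simp
next
  case False
  define e where "e = expectation f"
  have e: "e > 0" using False f by (simp add: e_def order_le_neq_trans integral_nonneg)
  have int: "integrable M f" by (rule integrable_const_bound[of _ B]) (use f in auto)
  have intp: "integrable M (\<lambda>x. f x powr p)"
    by (rule integrable_const_bound[of _ "B powr p"]) (use f p in \<open>auto intro!: powr_mono2\<close>)
  have young: "t * e powr (p - 1) \<le> t powr p / p + (1 - 1 / p) * e powr p" if "t \<ge> 0" for t
  proof (cases "t = 0")
    case True
    then show ?thesis using p by simp
  next
    case False
    have "(t powr p) powr (1 / p) * (e powr p) powr (1 - 1 / p) \<le> 1 / p * t powr p + (1 - 1 / p) * e powr p"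
      by (rule Youngs_inequality_0) (use p e that False in \<open>auto simp: field_simps\<close>)
    moreover have "(t powr p) powr (1 / p) = t" using that p by (simp add: powr_powr)
    moreover have "(e powr p) powr (1 - 1 / p) = e powr (p - 1)"
      using p by (simp add: powr_powr right_diff_distrib)
    ultimately show ?thesis by simp
  qed
  have "e powr p = expectation (\<lambda>x. f x * e powr (p - 1))"
    using e by (simp add: powr_mult_base flip: e_def)
  also have "\<dots> \<le> expectation (\<lambda>x. f x powr p / p + (1 - 1 / p) * e powr p)"
    by (intro integral_mono) (use int intp young f in auto)
  also have "\<dots> = expectation (\<lambda>x. f x powr p) / p + (1 - 1 / p) * e powr p"
    using intp by (simp add: prob_space)
  finally have "e powr p / p \<le> expectation (\<lambda>x. f x powr p) / p" by (simp add: left_diff_distrib)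
  then show ?thesis using p unfolding e_def by (simp add: divide_le_cancel)
qed

text \<open>The easy half of Kantorovich duality for \<open>p = 1\<close>, raised to the power \<open>p\<close>. The left-hand side is
  a measurable function of \<open>\<nu>\<close>, which makes it a lower bound for the risk that can be integrated.\<close>

lemma wasserstein_ge_lipschitz_functional:
  fixes h :: "'a::euclidean_space \<Rightarrow> real"
  assumes p: "p \<ge> 1" and [measurable]: "h \<in> borel_measurable borel"
    and bounded: "\<And>x. \<bar>h x\<bar> \<le> B" and lip: "\<And>x y. \<bar>h x - h y\<bar> \<le> norm (x - y)"
  shows "ennreal (\<bar>(\<integral>x. h x \<partial>\<nu>) - (\<integral>x. h x \<partial>\<mu>)\<bar> powr p) \<le> epowr (wasserstein p \<nu> \<mu>) p"
proof -
  define \<Delta> where "\<Delta> = \<bar>(\<integral>x. h x \<partial>\<nu>) - (\<integral>x. h x \<partial>\<mu>)\<bar>"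
  have "ennreal \<Delta> \<le> wasserstein p \<nu> \<mu>"
    unfolding wasserstein_def
  proof (rule INF_greatest)
    fix \<pi> assume "\<pi> \<in> couplings \<nu> \<mu>"
    then have prob: "prob_space \<pi>" and sets: "sets \<pi> = sets borel"
      and \<nu>: "\<nu> = distr \<pi> borel fst" and \<mu>: "\<mu> = distr \<pi> borel snd"
      by (auto simp: couplings_def space_prob_algebra)
    interpret prob_space \<pi> by fact
    have sets': "sets \<pi> = sets (borel \<Otimes>\<^sub>M borel)" unfolding borel_prod by (rule sets)
    note [measurable_cong] = sets'
    have int: "integrable \<pi> (\<lambda>v. h (fst v))" "integrable \<pi> (\<lambda>v. h (snd v))"
      by (rule integrable_const_bound[of _ B]; use bounded in auto)+
    have "(\<integral>x. h x \<partial>\<nu>) = (\<integral>v. h (fst v) \<partial>\<pi>)" "(\<integral>x. h x \<partial>\<mu>) = (\<integral>v. h (snd v) \<partial>\<pi>)"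
      unfolding \<nu> \<mu> by (subst integral_distr; simp)+
    then have "\<Delta> = \<bar>\<integral>v. h (fst v) - h (snd v) \<partial>\<pi>\<bar>" using int by (simp add: \<Delta>_def)
    also have "\<dots> \<le> (\<integral>v. \<bar>h (fst v) - h (snd v)\<bar> \<partial>\<pi>)" by (rule integral_abs_bound)
    finally have "\<Delta> powr p \<le> (\<integral>v. \<bar>h (fst v) - h (snd v)\<bar> \<partial>\<pi>) powr p"
      using p by (intro powr_mono2) (auto simp: \<Delta>_def)
    also have "\<dots> \<le> (\<integral>v. \<bar>h (fst v) - h (snd v)\<bar> powr p \<partial>\<pi>)"
    proof (rule powr_expectation_le[OF p])
      fix v :: "'a \<times> 'a"
      show "\<bar>h (fst v) - h (snd v)\<bar> \<le> 2 * B" using bounded[of "fst v"] bounded[of "snd v"] by linarith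
    qed auto
    finally have "ennreal (\<Delta> powr p) \<le> ennreal (\<integral>v. \<bar>h (fst v) - h (snd v)\<bar> powr p \<partial>\<pi>)"
      by (rule ennreal_leI)
    also have "\<dots> = (\<integral>\<^sup>+v. ennreal (\<bar>h (fst v) - h (snd v)\<bar> powr p) \<partial>\<pi>)"
    proof (rule nn_integral_eq_integral[symmetric])
      have "\<bar>h (fst v) - h (snd v)\<bar> \<le> 2 * B" for v :: "'a \<times> 'a"
        using bounded[of "fst v"] bounded[of "snd v"] by linarith
      then show "integrable \<pi> (\<lambda>v. \<bar>h (fst v) - h (snd v)\<bar> powr p)"
        using p by (intro integrable_const_bound[of _ "(2 * B) powr p"]) (auto intro!: powr_mono2)
    qed auto
    also have "\<dots> \<le> (\<integral>\<^sup>+(x, y). ennreal (norm (x - y) powr p) \<partial>\<pi>)"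
      using p by (intro nn_integral_mono) (auto simp: split_def intro!: ennreal_leI powr_mono2 lip)
    finally have "epowr (ennreal (\<Delta> powr p)) (1 / p) \<le> epowr (\<integral>\<^sup>+(x, y). ennreal (norm (x - y) powr p) \<partial>\<pi>) (1 / p)"
      using p by (intro epowr_mono) auto
    moreover have "epowr (ennreal (\<Delta> powr p)) (1 / p) = ennreal \<Delta>"
      using p by (simp add: epowr_def powr_powr \<Delta>_def)
    ultimately show "ennreal \<Delta> \<le> epowr (\<integral>\<^sup>+(x, y). ennreal (norm (x - y) powr p) \<partial>\<pi>) (1 / p)" by simp
  qed
  then have "epowr (ennreal \<Delta>) p \<le> epowr (wasserstein p \<nu> \<mu>) p" using p by (intro epowr_mono) auto
  then show ?thesis by (simp add: epowr_def \<Delta>_def)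
qed

text \<open>One factor of \<open>c\<close> is lost for each coordinate.\<close>

lemma PiM_domination:
  fixes P Q :: "'a::topological_space measure" and f :: "(nat \<Rightarrow> 'a) \<Rightarrow> ennreal"
  assumes "prob_space P" "prob_space Q" and sets: "sets P = sets borel" "sets Q = sets borel"
    and dom: "\<And>g :: 'a \<Rightarrow> ennreal. g \<in> borel_measurable borel \<Longrightarrow> c * (\<integral>\<^sup>+x. g x \<partial>P) \<le> (\<integral>\<^sup>+x. g x \<partial>Q)"
    and "finite I" "f \<in> borel_measurable (PiM I (\<lambda>_. borel))"
  shows "c ^ card I * (\<integral>\<^sup>+y. f y \<partial>PiM I (\<lambda>_. P)) \<le> (\<integral>\<^sup>+y. f y \<partial>PiM I (\<lambda>_. Q))"
  using \<open>finite I\<close> \<open>f \<in> _\<close>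
proof (induction I arbitrary: f rule: finite_induct)
  case empty
  then show ?case by (simp add: PiM_empty)
next
  case (insert i I)
  interpret P: prob_space P by fact
  interpret Q: prob_space Q by fact
  interpret PP: product_sigma_finite "\<lambda>_. P" ..
  interpret QQ: product_sigma_finite "\<lambda>_. Q" ..
  have setsP: "sets (PiM J (\<lambda>_. P)) = sets (PiM J (\<lambda>_. borel))" for J by (intro sets_PiM_cong) (auto simp: sets)
  have setsQ: "sets (PiM J (\<lambda>_. Q)) = sets (PiM J (\<lambda>_. borel))" for J by (intro sets_PiM_cong) (auto simp: sets)
  have spP: "space P = UNIV" and spQ: "space Q = UNIV" 
    using sets_eq_imp_space_eq[OF sets(1)] sets_eq_imp_space_eq[OF sets(2)] by auto
  have fP: "f \<in> borel_measurable (PiM (insert i I) (\<lambda>_. P))"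
    using insert.prems by (simp add: measurable_cong_sets[OF setsP refl])
  have fQ: "f \<in> borel_measurable (PiM (insert i I) (\<lambda>_. Q))"
    using insert.prems by (simp add: measurable_cong_sets[OF setsQ refl])
  have upd: "(\<lambda>y. f (x(i := y))) \<in> borel_measurable borel" if "x \<in> space (PiM I (\<lambda>_. borel))" for x
    using measurable_comp[OF measurable_component_update[OF that \<open>i \<notin> I\<close>] insert.prems]
    by (simp add: comp_def)
  let ?f = "\<lambda>v. f ((fst v)(i := snd v))"
  have joint: "?f \<in> borel_measurable (PiM I (\<lambda>_. borel) \<Otimes>\<^sub>M borel)"
    using measurable_comp[OF measurable_add_dim insert.prems] by (simp add: comp_def split_def)
  have joint': "(\<lambda>x. \<integral>\<^sup>+y. f (x(i := y)) \<partial>Q) \<in> borel_measurable (PiM I (\<lambda>_. borel))"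
  proof -
    have "?f \<in> borel_measurable (PiM I (\<lambda>_. borel) \<Otimes>\<^sub>M Q)"
      using joint measurable_cong_sets[OF sets_pair_measure_cong[OF refl sets(2)] refl] by blast
    from Q.borel_measurable_nn_integral_fst[OF this] show ?thesis by simp
  qed
  have "c ^ card (insert i I) * (\<integral>\<^sup>+y. f y \<partial>PiM (insert i I) (\<lambda>_. P)) =
     c ^ card I * (c * (\<integral>\<^sup>+x. \<integral>\<^sup>+y. f (x(i := y)) \<partial>P \<partial>PiM I (\<lambda>_. P)))"
    using insert.hyps by (simp add: PP.product_nn_integral_insert[OF insert.hyps fP] mult_ac)
  also have "c * (\<integral>\<^sup>+x. \<integral>\<^sup>+y. f (x(i := y)) \<partial>P \<partial>PiM I (\<lambda>_. P)) =
      (\<integral>\<^sup>+x. c * (\<integral>\<^sup>+y. f (x(i := y)) \<partial>P) \<partial>PiM I (\<lambda>_. P))"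
  proof (rule nn_integral_cmult[symmetric])
    have "?f \<in> borel_measurable (PiM I (\<lambda>_. P) \<Otimes>\<^sub>M P)"
      using joint measurable_cong_sets[OF sets_pair_measure_cong[OF setsP sets(1)] refl] by blast
    from P.borel_measurable_nn_integral_fst[OF this]
    show "(\<lambda>x. \<integral>\<^sup>+y. f (x(i := y)) \<partial>P) \<in> borel_measurable (PiM I (\<lambda>_. P))" by simp
  qed
  also have "\<dots> \<le> (\<integral>\<^sup>+x. \<integral>\<^sup>+y. f (x(i := y)) \<partial>Q \<partial>PiM I (\<lambda>_. P))"
  proof (intro nn_integral_mono dom)
    fix x assume "x \<in> space (PiM I (\<lambda>_. P))"
    then have "x \<in> space (PiM I (\<lambda>_. borel))" by (simp add: space_PiM spP)
    then show "(\<lambda>y. f (x(i := y))) \<in> borel_measurable borel" by (rule upd)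
  qed
  finally have "c ^ card (insert i I) * (\<integral>\<^sup>+y. f y \<partial>PiM (insert i I) (\<lambda>_. P)) \<le>
      c ^ card I * (\<integral>\<^sup>+x. \<integral>\<^sup>+y. f (x(i := y)) \<partial>Q \<partial>PiM I (\<lambda>_. P))"
    by (simp add: mult_left_mono)
  also have "\<dots> \<le> (\<integral>\<^sup>+x. \<integral>\<^sup>+y. f (x(i := y)) \<partial>Q \<partial>PiM I (\<lambda>_. Q))"
    by (rule insert.IH[OF joint'])
  also have "\<dots> = (\<integral>\<^sup>+y. f y \<partial>PiM (insert i I) (\<lambda>_. Q))"
    by (rule QQ.product_nn_integral_insert[OF insert.hyps fQ, symmetric])
  finally show ?case .
qed

text \<open>An estimate cannot be close to both hypotheses, as the integral of \<open>h\<close> separates them. It would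
  have to be close to \<open>\<mu>1\<close> with high probability under the second sample law and to \<open>\<mu>0\<close> under the first,
  which is impossible since the second dominates half of the first.\<close>

lemma two_point_risk_bound:
  fixes \<mu>0 \<mu>1 \<mu>\<^sub>\<epsilon> :: "(real^'n) measure" and h :: "real^'n \<Rightarrow> real"
  assumes p: "p \<ge> 1" and h: "h \<in> borel_measurable borel"
    and bounded: "\<And>x. \<bar>h x\<bar> \<le> B" and lip: "\<And>x y. \<bar>h x - h y\<bar> \<le> norm (x - y)"
    and prob: "prob_space (\<mu>0 \<star> \<mu>\<^sub>\<epsilon>)" "prob_space (\<mu>1 \<star> \<mu>\<^sub>\<epsilon>)"
    and dom: "\<And>g. g \<in> borel_measurable borel \<Longrightarrow>
        ennreal (1 - \<epsilon>) * (\<integral>\<^sup>+y. g y \<partial>(\<mu>0 \<star> \<mu>\<^sub>\<epsilon>)) \<le> (\<integral>\<^sup>+y. g y \<partial>(\<mu>1 \<star> \<mu>\<^sub>\<epsilon>))"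
    and \<epsilon>: "0 \<le> \<epsilon>" "real n * \<epsilon> \<le> 1 / 2" and n: "n \<ge> 1"
    and T: "estimator T"
    and gap: "\<delta> \<ge> 0" "\<bar>(\<integral>x. h x \<partial>\<mu>1) - (\<integral>x. h x \<partial>\<mu>0)\<bar> \<ge> 2 * \<delta>"
  shows "ennreal (\<delta> powr p / 2) \<le> risk p \<mu>\<^sub>\<epsilon> T n \<mu>0 + risk p \<mu>\<^sub>\<epsilon> T n \<mu>1"
proof -
  note [measurable] = h
  define w where "w \<mu> y = ennreal (\<bar>(\<integral>x. h x \<partial>T n y) - (\<integral>x. h x \<partial>\<mu>)\<bar> powr p)" for \<mu> y
  let ?P = "PiM {1..n} (\<lambda>_. \<mu>0 \<star> \<mu>\<^sub>\<epsilon>)" and ?Q = "PiM {1..n} (\<lambda>_. \<mu>1 \<star> \<mu>\<^sub>\<epsilon>)"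
  interpret P: prob_space "\<mu>0 \<star> \<mu>\<^sub>\<epsilon>" by fact
  interpret PP: product_prob_space "\<lambda>_. \<mu>0 \<star> \<mu>\<^sub>\<epsilon>" "{1..n}" ..
  let ?W = "\<lambda>\<mu>. \<integral>\<^sup>+y. w \<mu> y \<partial>?P"
  have risk: "(\<integral>\<^sup>+y. w \<mu> y \<partial>PiM {1..n} (\<lambda>_. \<mu> \<star> \<mu>\<^sub>\<epsilon>)) \<le> risk p \<mu>\<^sub>\<epsilon> T n \<mu>" for \<mu>
    unfolding risk_def w_def
    by (intro nn_integral_mono wasserstein_ge_lipschitz_functional[OF p h bounded lip])
  have Tn: "T n \<in> measurable (PiM {1..n} (\<lambda>_. borel)) (prob_algebra borel)"
    using T n by (simp add: estimator_def)
  have w_meas: "w \<mu> \<in> borel_measurable (PiM {1..n} (\<lambda>_. borel))" for \<mu>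
  proof -
    have "(\<lambda>y. \<integral>x. h x \<partial>T n y) \<in> borel_measurable (PiM {1..n} (\<lambda>_. borel))"
    proof (rule measurable_compose[OF measurable_prob_algebraD[OF Tn]])
      show "(\<lambda>M. integral\<^sup>L M h) \<in> borel_measurable (subprob_algebra borel)"
        by (rule integral_measurable_subprob_algebra[OF h])
    qed
    then show ?thesis unfolding w_def by measurable
  qed
  have sP: "sets ?P = sets (PiM {1..n} (\<lambda>_. borel))" by (intro sets_PiM_cong) auto
  have w_measP: "w \<mu> \<in> borel_measurable ?P" for \<mu>
    using w_meas measurable_cong_sets[OF sP refl] by blast
  \<comment> \<open>Bernoulli's inequality: the likelihood ratio of the samples stays above one half\<close>
  have half: "ennreal (1 / 2) \<le> ennreal (1 - \<epsilon>) ^ n"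
  proof -
    have "\<epsilon> \<le> 1" using \<epsilon> n mult_right_mono[of 1 "real n" \<epsilon>] by simp
    have "1 / 2 \<le> 1 + real n * (- \<epsilon>)" using \<epsilon> by simp
    also have "\<dots> \<le> (1 + (- \<epsilon>)) ^ n" using \<open>\<epsilon> \<le> 1\<close> by (intro Bernoulli_inequality) auto
    finally have "ennreal (1 / 2) \<le> ennreal ((1 + (- \<epsilon>)) ^ n)" by (rule ennreal_leI)
    then show ?thesis using \<open>\<epsilon> \<le> 1\<close> by (subst ennreal_power) auto
  qed
  have "ennreal (\<delta> powr p / 2) = ennreal (1 / 2 * \<delta> powr p)" by simp
  also have "\<dots> = ennreal (1 / 2) * ennreal (\<delta> powr p)" by (rule ennreal_mult) auto
  also have "ennreal (\<delta> powr p) = (\<integral>\<^sup>+y. ennreal (\<delta> powr p) \<partial>?P)"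
    by (simp add: PP.P.emeasure_space_1 del: One_nat_def)
  also have "ennreal (1 / 2) * (\<integral>\<^sup>+y. ennreal (\<delta> powr p) \<partial>?P) \<le>
      ennreal (1 / 2) * (\<integral>\<^sup>+y. w \<mu>0 y + w \<mu>1 y \<partial>?P)"
  proof (intro mult_left_mono nn_integral_mono)
    fix y
    have "\<delta> \<le> \<bar>(\<integral>x. h x \<partial>T n y) - (\<integral>x. h x \<partial>\<mu>0)\<bar> \<or> \<delta> \<le> \<bar>(\<integral>x. h x \<partial>T n y) - (\<integral>x. h x \<partial>\<mu>1)\<bar>"
      using gap by linarith
    then have "ennreal (\<delta> powr p) \<le> w \<mu>0 y \<or> ennreal (\<delta> powr p) \<le> w \<mu>1 y"
      unfolding w_def using p gap(1) by (auto intro!: ennreal_leI powr_mono2)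
    then show "ennreal (\<delta> powr p) \<le> w \<mu>0 y + w \<mu>1 y"
      by (auto intro: add_increasing add_increasing2)
  qed simp
  also have "\<dots> = ennreal (1 / 2) * ?W \<mu>0 + ennreal (1 / 2) * ?W \<mu>1"
    using w_measP by (simp add: nn_integral_add distrib_left del: One_nat_def)
  also have "\<dots> \<le> 1 * ?W \<mu>0 + ennreal (1 - \<epsilon>) ^ card {1..n} * ?W \<mu>1"
  proof (intro add_mono mult_right_mono)
    have "ennreal (1 / 2) \<le> ennreal 1" by (rule ennreal_leI) simp
    then show "ennreal (1 / 2) \<le> 1" by simp
    show "ennreal (1 / 2) \<le> ennreal (1 - \<epsilon>) ^ card {1..n}" using half by simp
  qed auto
  also have "\<dots> \<le> risk p \<mu>\<^sub>\<epsilon> T n \<mu>0 + risk p \<mu>\<^sub>\<epsilon> T n \<mu>1"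
  proof (rule add_mono)
    show "1 * ?W \<mu>0 \<le> risk p \<mu>\<^sub>\<epsilon> T n \<mu>0" using risk[of \<mu>0] by simp
    have "ennreal (1 - \<epsilon>) ^ card {1..n} * ?W \<mu>1 \<le> (\<integral>\<^sup>+y. w \<mu>1 y \<partial>?Q)"
      by (rule PiM_domination[OF prob _ _ dom _ w_meas]) simp_all
    also have "\<dots> \<le> risk p \<mu>\<^sub>\<epsilon> T n \<mu>1" by (rule risk)
    finally show "ennreal (1 - \<epsilon>) ^ card {1..n} * ?W \<mu>1 \<le> risk p \<mu>\<^sub>\<epsilon> T n \<mu>1" .
  qed
  finally show ?thesis .
qed

section \<open>Normal laws with an oscillating density\<close>

text \<open>Both hypotheses in one formula: \<open>b = 0\<close> is the normal law and \<open>b = 1\<close> the oscillating one. As sine is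
  odd, the modulation does not change the total mass.\<close>

definition modulated_normal :: "real \<Rightarrow> real \<Rightarrow> real \<Rightarrow> real measure" where
  "modulated_normal s \<omega> b = density lborel (\<lambda>z. ennreal (normal_density 0 s z * (1 + b * sin (\<omega> * z))))"

lemma integral_normal_sin_cos:
  assumes "\<sigma> > 0"
  shows "integrable lborel (\<lambda>z. normal_density m \<sigma> z * sin (\<omega> * z))"
    and "integrable lborel (\<lambda>z. normal_density m \<sigma> z * cos (\<omega> * z))"
    and "(\<integral>z. normal_density m \<sigma> z * sin (\<omega> * z) \<partial>lborel) = sin (\<omega> * m) * exp (- (\<sigma> * \<omega>)\<^sup>2 / 2)"
    and "(\<integral>z. normal_density m \<sigma> z * cos (\<omega> * z) \<partial>lborel) = cos (\<omega> * m) * exp (- (\<sigma> * \<omega>)\<^sup>2 / 2)"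
proof -
  have int: "integrable lborel (normal_density m \<sigma>)" using assms by simp
  show s: "integrable lborel (\<lambda>z. normal_density m \<sigma> z * sin (\<omega> * z))"
    by (rule Bochner_Integration.integrable_bound[OF int])
       (auto simp: abs_mult normal_density_nonneg intro!: mult_left_le)
  show c: "integrable lborel (\<lambda>z. normal_density m \<sigma> z * cos (\<omega> * z))"
    by (rule Bochner_Integration.integrable_bound[OF int])
       (auto simp: abs_mult normal_density_nonneg intro!: mult_left_le)
  let ?f = "\<lambda>z. complex_of_real (normal_density m \<sigma> z) * cis (\<omega> * z)"
  have intc: "integrable lborel ?f"
    by (rule Bochner_Integration.integrable_bound[OF int]) (auto simp: norm_mult normal_density_nonneg)
  have "char (density lborel (\<lambda>x. ennreal (normal_density m \<sigma> x))) \<omega> = (\<integral>z. ?f z \<partial>lborel)"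
    unfolding char_def
    by (subst integral_density) (auto simp: normal_density_nonneg cis_conv_exp scaleR_conv_of_real)
  then have eq: "(\<integral>z. ?f z \<partial>lborel) = cis (\<omega> * m) * of_real (exp (- (\<sigma> * \<omega>)\<^sup>2 / 2))"
    by (simp only: char_normal[OF assms])
  have "(\<integral>z. Im (?f z) \<partial>lborel) = Im (\<integral>z. ?f z \<partial>lborel)" using intc by (rule integral_Im)
  then show "(\<integral>z. normal_density m \<sigma> z * sin (\<omega> * z) \<partial>lborel) = sin (\<omega> * m) * exp (- (\<sigma> * \<omega>)\<^sup>2 / 2)"
    unfolding eq by simp
  have "(\<integral>z. Re (?f z) \<partial>lborel) = Re (\<integral>z. ?f z \<partial>lborel)" using intc by (rule integral_Re)
  then show "(\<integral>z. normal_density m \<sigma> z * cos (\<omega> * z) \<partial>lborel) = cos (\<omega> * m) * exp (- (\<sigma> * \<omega>)\<^sup>2 / 2)"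
    unfolding eq by simp
qed

lemma modulated_density_nonneg:
  fixes b t :: real
  assumes "\<bar>b\<bar> \<le> 1"
  shows "0 \<le> 1 + b * sin t"
proof -
  have "\<bar>b * sin t\<bar> \<le> 1 * 1" unfolding abs_mult using assms by (intro mult_mono) auto
  then show ?thesis by linarith
qed

lemma nn_integral_normal_modulated:
  assumes "\<sigma> > 0" "\<bar>b\<bar> \<le> 1"
  shows "(\<integral>\<^sup>+z. ennreal (normal_density m \<sigma> z * (1 + b * sin (\<omega> * z))) \<partial>lborel) =
    ennreal (1 + b * (sin (\<omega> * m) * exp (- (\<sigma> * \<omega>)\<^sup>2 / 2)))"
proof -
  have eq: "normal_density m \<sigma> z * (1 + b * sin (\<omega> * z)) = normal_density m \<sigma> z + b * (normal_density m \<sigma> z * sin (\<omega> * z))" for z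
    by (simp add: algebra_simps)
  have "(\<integral>\<^sup>+z. ennreal (normal_density m \<sigma> z * (1 + b * sin (\<omega> * z))) \<partial>lborel) =
    ennreal (\<integral>z. normal_density m \<sigma> z * (1 + b * sin (\<omega> * z)) \<partial>lborel)"
  proof (rule nn_integral_eq_integral)
    show "integrable lborel (\<lambda>z. normal_density m \<sigma> z * (1 + b * sin (\<omega> * z)))"
      unfolding eq using assms(1) integral_normal_sin_cos(1) by simp
  qed (simp add: normal_density_nonneg modulated_density_nonneg[OF assms(2)])
  also have "(\<integral>z. normal_density m \<sigma> z * (1 + b * sin (\<omega> * z)) \<partial>lborel) =
     1 + b * (sin (\<omega> * m) * exp (- (\<sigma> * \<omega>)\<^sup>2 / 2))"
    unfolding eq using assms(1) integral_normal_sin_cos(1,3)[OF assms(1)] by simp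
  finally show ?thesis .
qed

lemma modulated_normal_prob:
  assumes "s > 0" "\<bar>b\<bar> \<le> 1"
  shows "prob_space (modulated_normal s \<omega> b)"
proof (rule prob_spaceI)
  show "emeasure (modulated_normal s \<omega> b) (space (modulated_normal s \<omega> b)) = 1"
    using nn_integral_normal_modulated[OF assms, of 0 \<omega>]
    by (simp add: modulated_normal_def emeasure_density)
qed

lemma sets_modulated_normal [simp, measurable_cong]: "sets (modulated_normal s \<omega> b) = sets borel"
  by (simp add: modulated_normal_def)

text \<open>Completing the square: the joint density of a centred normal \<open>z\<close> and \<open>u\<close>, the sum of \<open>z\<close> and
  independent normal noise, is the marginal density of \<open>u\<close> times the conditional density of \<open>z\<close>.\<close>

lemma normal_density_mult:
  fixes \<sigma> s :: real
  assumes "\<sigma> > 0" "s > 0"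
  shows "normal_density 0 s z * normal_density m \<sigma> (u - z) =
     normal_density m (sqrt (s\<^sup>2 + \<sigma>\<^sup>2)) u *
     normal_density (s\<^sup>2 * (u - m) / (s\<^sup>2 + \<sigma>\<^sup>2)) (sqrt (s\<^sup>2 * \<sigma>\<^sup>2 / (s\<^sup>2 + \<sigma>\<^sup>2))) z"
proof -
  define a b where "a = s\<^sup>2" and "b = \<sigma>\<^sup>2"
  have ab [simp, arith]: "a > 0" "b > 0" using assms by (auto simp: a_def b_def)
  have root: "sqrt (2 * pi * (a + b)) * sqrt (2 * pi * (a * b / (a + b))) = sqrt (2 * pi * a) * sqrt (2 * pi * b)"
    by (simp add: real_sqrt_mult[symmetric])
  define w where "w = u - m"
  have e: "- (z - 0)\<^sup>2 / (2 * a) + - (u - z - m)\<^sup>2 / (2 * b) =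
     - (u - m)\<^sup>2 / (2 * (a + b)) + - (z - a * (u - m) / (a + b))\<^sup>2 / (2 * (a * b / (a + b)))"
  proof -
    have "a + b \<noteq> 0" using ab by linarith
    then have "- z\<^sup>2 / (2 * a) + - (w - z)\<^sup>2 / (2 * b) =
      - w\<^sup>2 / (2 * (a + b)) + - (z - a * w / (a + b))\<^sup>2 / (2 * (a * b / (a + b)))"
      by (simp add: divide_simps power2_eq_square) (simp add: algebra_simps)
    then show ?thesis by (simp add: w_def algebra_simps)
  qed
  have "normal_density 0 s z * normal_density m \<sigma> (u - z) =
     (1 / (sqrt (2 * pi * a) * sqrt (2 * pi * b))) * exp (- (z - 0)\<^sup>2 / (2 * a) + - (u - z - m)\<^sup>2 / (2 * b))"
    unfolding normal_density_def a_def[symmetric] b_def[symmetric] exp_add by simp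
  also have "\<dots> = (1 / (sqrt (2 * pi * (a + b)) * sqrt (2 * pi * (a * b / (a + b))))) *
     exp (- (u - m)\<^sup>2 / (2 * (a + b)) + - (z - a * (u - m) / (a + b))\<^sup>2 / (2 * (a * b / (a + b))))"
    unfolding e root ..
  also have "\<dots> = normal_density m (sqrt (a + b)) u * normal_density (a * (u - m) / (a + b)) (sqrt (a * b / (a + b))) z"
    unfolding normal_density_def exp_add by simp
  finally show ?thesis unfolding a_def b_def .
qed

text \<open>The density of the sum is the normal density times the conditional mean of \<open>1 + b * sin (\<omega> * z)\<close>,
  in which the conditional variance damps the oscillation.\<close>

lemma nn_integral_modulated_plus_normal:
  fixes g :: "real \<Rightarrow> ennreal"
  assumes [measurable]: "g \<in> borel_measurable borel" and s: "s > 0" and \<sigma>: "\<sigma> > 0" and b: "\<bar>b\<bar> \<le> 1"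
  shows "(\<integral>\<^sup>+z. \<integral>\<^sup>+\<eta>. g (z + \<eta>) \<partial>density lborel (\<lambda>x. ennreal (normal_density m \<sigma> x)) \<partial>modulated_normal s \<omega> b) =
    (\<integral>\<^sup>+u. g u * (ennreal (normal_density m (sqrt (s\<^sup>2 + \<sigma>\<^sup>2)) u) *
       ennreal (1 + b * (sin (\<omega> * (s\<^sup>2 * (u - m) / (s\<^sup>2 + \<sigma>\<^sup>2))) *
          exp (- (sqrt (s\<^sup>2 * \<sigma>\<^sup>2 / (s\<^sup>2 + \<sigma>\<^sup>2)) * \<omega>)\<^sup>2 / 2)))) \<partial>lborel)"
proof -
  let ?\<tau> = "sqrt (s\<^sup>2 * \<sigma>\<^sup>2 / (s\<^sup>2 + \<sigma>\<^sup>2))" and ?\<rho> = "sqrt (s\<^sup>2 + \<sigma>\<^sup>2)"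
  let ?m = "\<lambda>u. s\<^sup>2 * (u - m) / (s\<^sup>2 + \<sigma>\<^sup>2)"
  let ?d = "\<lambda>z. ennreal (normal_density 0 s z * (1 + b * sin (\<omega> * z)))" and ?n = "\<lambda>u z. ennreal (normal_density m \<sigma> (u - z))"
    and ?r = "\<lambda>u. ennreal (normal_density m ?\<rho> u)" and ?c = "\<lambda>u z. ennreal (normal_density (?m u) ?\<tau> z * (1 + b * sin (\<omega> * z)))"
    and ?q = "\<lambda>u. ennreal (1 + b * (sin (\<omega> * ?m u) * exp (- (?\<tau> * \<omega>)\<^sup>2 / 2)))"
  have \<tau>: "?\<tau> > 0" using s \<sigma> by (simp add: add_pos_pos)
  have shift: "(\<integral>\<^sup>+\<eta>. ennreal (normal_density m \<sigma> \<eta>) * g (z + \<eta>) \<partial>lborel) =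
      (\<integral>\<^sup>+u. ?n u z * g u \<partial>lborel)" for z
    using nn_integral_real_affine[of "\<lambda>u. ?n u z * g u" 1 z] by simp
  have "(\<integral>\<^sup>+z. \<integral>\<^sup>+\<eta>. g (z + \<eta>) \<partial>density lborel (\<lambda>x. ennreal (normal_density m \<sigma> x)) \<partial>modulated_normal s \<omega> b) =
    (\<integral>\<^sup>+z. ?d z *
       (\<integral>\<^sup>+u. ?n u z * g u \<partial>lborel) \<partial>lborel)"
    unfolding modulated_normal_def by (subst nn_integral_density; simp add: nn_integral_density shift)+
  also have "\<dots> = (\<integral>\<^sup>+z. \<integral>\<^sup>+u. ?d z *
       (?n u z * g u) \<partial>lborel \<partial>lborel)"
    by (intro nn_integral_cong nn_integral_cmult[symmetric]) measurable
  also have "\<dots> = (\<integral>\<^sup>+u. \<integral>\<^sup>+z. ?d z *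
       (?n u z * g u) \<partial>lborel \<partial>lborel)"
    by (rule lborel_pair.Fubini') measurable
  also have "\<dots> = (\<integral>\<^sup>+u. g u * (?r u *
       ?q u) \<partial>lborel)"
  proof (intro nn_integral_cong)
    fix u
    have "(\<integral>\<^sup>+z. ?d z *
       (?n u z * g u) \<partial>lborel) =
      (\<integral>\<^sup>+z. (g u * ?r u) *
          ?c u z \<partial>lborel)"
    proof (intro nn_integral_cong)
      fix z
      have pos: "0 \<le> 1 + b * sin (\<omega> * z)" by (rule modulated_density_nonneg[OF b])
      have "?d z * ?n u z =
        ennreal ((normal_density 0 s z * normal_density m \<sigma> (u - z)) * (1 + b * sin (\<omega> * z)))"
        using pos by (subst ennreal_mult[symmetric]) (auto simp: normal_density_nonneg mult_ac)
      also have "\<dots> = ennreal (normal_density m ?\<rho> u * (normal_density (?m u) ?\<tau> z * (1 + b * sin (\<omega> * z))))"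
        unfolding normal_density_mult[OF \<sigma> s] by (simp only: mult.assoc)
      also have "\<dots> = ?r u * ?c u z"
        using pos by (intro ennreal_mult) (auto simp: normal_density_nonneg)
      finally have E: "?d z * ?n u z =
        ?r u * ?c u z" .
      show "?d z *
          (?n u z * g u) =
        (g u * ?r u) * ?c u z"
        unfolding mult.assoc[symmetric] E by (simp only: mult_ac)
    qed
    also have "\<dots> = (g u * ?r u) *
        (\<integral>\<^sup>+z. ?c u z \<partial>lborel)"
      by (rule nn_integral_cmult) measurable
    also have "\<dots> = (g u * ?r u) *
         ?q u"
      unfolding nn_integral_normal_modulated[OF \<tau> b] ..
    finally show "(\<integral>\<^sup>+z. ?d z *
       (?n u z * g u) \<partial>lborel) =
      g u * (?r u *
         ?q u)"
      by (simp only: mult.assoc)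
  qed
  finally show ?thesis .
qed

lemma modulated_normal_domination:
  fixes g :: "real \<Rightarrow> ennreal" and m :: real
  assumes g: "g \<in> borel_measurable borel" and s: "s > 0" and \<sigma>: "\<sigma> > 0"
    and \<tau>: "\<tau> = sqrt (s\<^sup>2 * \<sigma>\<^sup>2 / (s\<^sup>2 + \<sigma>\<^sup>2))"
  defines "\<nu> \<equiv> density lborel (\<lambda>x. ennreal (normal_density m \<sigma> x))"
  shows "ennreal (1 - exp (- (\<tau> * \<omega>)\<^sup>2 / 2)) * (\<integral>\<^sup>+z. \<integral>\<^sup>+\<eta>. g (z + \<eta>) \<partial>\<nu> \<partial>modulated_normal s \<omega> 0)
    \<le> (\<integral>\<^sup>+z. \<integral>\<^sup>+\<eta>. g (z + \<eta>) \<partial>\<nu> \<partial>modulated_normal s \<omega> 1)"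
proof -
  note [measurable] = g
  let ?s = "\<lambda>u. sin (\<omega> * (s\<^sup>2 * (u - m) / (s\<^sup>2 + \<sigma>\<^sup>2)))"
  let ?e = "exp (- (\<tau> * \<omega>)\<^sup>2 / 2)" and ?\<rho> = "sqrt (s\<^sup>2 + \<sigma>\<^sup>2)"
  have "ennreal (1 - ?e) * (\<integral>\<^sup>+z. \<integral>\<^sup>+\<eta>. g (z + \<eta>) \<partial>\<nu> \<partial>modulated_normal s \<omega> 0) =
    ennreal (1 - ?e) * (\<integral>\<^sup>+u. g u * ennreal (normal_density m ?\<rho> u) \<partial>lborel)"
  proof -
    have "\<bar>0 :: real\<bar> \<le> 1" by simp
    show ?thesis
      unfolding \<nu>_def nn_integral_modulated_plus_normal[OF g s \<sigma> \<open>\<bar>0 :: real\<bar> \<le> 1\<close>] mult_zero_left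
        add_0_right ennreal_1 mult_1_right by (rule refl)
  qed
  also have "\<dots> = (\<integral>\<^sup>+u. ennreal (1 - ?e) * (g u * ennreal (normal_density m ?\<rho> u)) \<partial>lborel)"
    by (rule nn_integral_cmult[symmetric]) measurable
  also have "\<dots> \<le> (\<integral>\<^sup>+u. g u * (ennreal (normal_density m ?\<rho> u) *
       ennreal (1 + 1 * (?s u * ?e))) \<partial>lborel)"
  proof (intro nn_integral_mono)
    fix u
    have "\<bar>?s u * ?e\<bar> \<le> 1 * ?e"
      unfolding abs_mult by (intro mult_mono) auto
    then have "1 - ?e \<le> 1 + 1 * (?s u * ?e)"
      by linarith
    then have "ennreal (1 - ?e) \<le> ennreal (1 + 1 * (?s u * ?e))"
      by (rule ennreal_leI)
    from mult_left_mono[OF this, of "g u * ennreal (normal_density m ?\<rho> u)"]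
    show "ennreal (1 - ?e) * (g u * ennreal (normal_density m ?\<rho> u)) \<le>
       g u * (ennreal (normal_density m ?\<rho> u) * ennreal (1 + 1 * (?s u * ?e)))"
      by (simp only: mult_ac zero_le)
  qed
  also have "\<dots> = (\<integral>\<^sup>+z. \<integral>\<^sup>+\<eta>. g (z + \<eta>) \<partial>\<nu> \<partial>modulated_normal s \<omega> 1)"
    unfolding \<nu>_def by (subst nn_integral_modulated_plus_normal[OF g s \<sigma>]) (simp_all add: \<tau>)
  finally show ?thesis .
qed

text \<open>As \<open>sin\<^sup>2\<close> has mean close to one half at high frequencies, \<open>sin (\<omega> * z)\<close> sees the modulation.\<close>

lemma modulated_normal_sin_integral:
  assumes s: "s > 0" and b: "\<bar>b\<bar> \<le> 1"
  shows "(\<integral>z. sin (\<omega> * z) \<partial>modulated_normal s \<omega> b) = b * (1 - exp (- 2 * (s * \<omega>)\<^sup>2)) / 2"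
proof -
  have int: "integrable lborel (normal_density 0 s)" using s by simp
  have eq: "normal_density 0 s z * (1 + b * sin (\<omega> * z)) * sin (\<omega> * z) =
     normal_density 0 s z * sin (\<omega> * z) + b / 2 * (normal_density 0 s z - normal_density 0 s z * cos (2 * \<omega> * z))" for z
  proof -
    have c: "cos (2 * \<omega> * z) = 1 - 2 * (sin (\<omega> * z))\<^sup>2" using cos_double_sin[of "\<omega> * z"] by (simp add: mult.assoc)
    show ?thesis unfolding c by (simp add: power2_eq_square algebra_simps)
  qed
  have "(\<integral>z. sin (\<omega> * z) \<partial>modulated_normal s \<omega> b) =
     (\<integral>z. normal_density 0 s z * (1 + b * sin (\<omega> * z)) * sin (\<omega> * z) \<partial>lborel)"
    unfolding modulated_normal_def
    by (subst integral_density) (auto simp: normal_density_nonneg modulated_density_nonneg[OF b])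
  also have "\<dots> = b / 2 * (1 - exp (- (s * (2 * \<omega>))\<^sup>2 / 2))"
    unfolding eq using int integral_normal_sin_cos[OF s, of 0] s by simp
  finally show ?thesis by (simp add: power_mult_distrib field_simps)
qed

text \<open>Uniform in \<open>\<omega>\<close>, since the modulation factor is at most 2; the moment of order \<open>r \<ge> 1\<close> scales like
  \<open>s powr r \<le> s\<close>. So a small \<open>s\<close> brings \<open>1 + \<bar>z\<bar> powr r\<close> below any bound larger than 1.\<close>

lemma modulated_normal_moment:
  "\<exists>C>0. \<forall>s \<omega> b r. 0 < s \<and> s \<le> 1 \<and> \<bar>b\<bar> \<le> 1 \<and> 1 \<le> r \<and> r \<le> R \<longrightarrow>
     (\<integral>\<^sup>+z. ennreal (1 + \<bar>z\<bar> powr r) \<partial>modulated_normal s \<omega> b) \<le> ennreal (1 + s * C)"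
proof -
  define k where "k = nat \<lceil>\<bar>R\<bar>\<rceil>"
  define C0 where "C0 = (\<integral>x. std_normal_density x * (1 + \<bar>x\<bar> ^ k) \<partial>lborel)"
  have int: "integrable lborel (\<lambda>x. std_normal_density x * (1 + \<bar>x\<bar> ^ k))"
    unfolding distrib_left using integrable_std_normal_moment_abs[of k] by simp
  have C0: "C0 \<ge> 0" unfolding C0_def by (intro Bochner_Integration.integral_nonneg) (simp add: normal_density_nonneg)
  have "(\<integral>\<^sup>+z. ennreal (1 + \<bar>z\<bar> powr r) \<partial>modulated_normal s \<omega> b) \<le> ennreal (1 + s * (2 * C0 + 1))"
    if s: "0 < s" "s \<le> 1" and b: "\<bar>b\<bar> \<le> 1" and r: "1 \<le> r" "r \<le> R" for s \<omega> b r
  proof -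
    let ?N = "modulated_normal s \<omega> b"
    interpret prob_space ?N by (rule modulated_normal_prob[OF s(1) b])
    let ?f = "\<lambda>x. normal_density 0 s (0 + s * x) * \<bar>0 + s * x\<bar> powr r"
    have "(\<integral>\<^sup>+z. ennreal (\<bar>z\<bar> powr r) \<partial>?N) =
       (\<integral>\<^sup>+z. ennreal (normal_density 0 s z * (1 + b * sin (\<omega> * z))) * ennreal (\<bar>z\<bar> powr r) \<partial>lborel)"
      unfolding modulated_normal_def by (rule nn_integral_density) measurable
    also have "\<dots> \<le> (\<integral>\<^sup>+z. ennreal (2 * (normal_density 0 s z * \<bar>z\<bar> powr r)) \<partial>lborel)"
    proof (intro nn_integral_mono)
      fix z
      have "\<bar>b * sin (\<omega> * z)\<bar> \<le> 1 * 1" unfolding abs_mult using b by (intro mult_mono) auto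
      then have "1 + b * sin (\<omega> * z) \<le> 2" by linarith
      then have "(normal_density 0 s z * \<bar>z\<bar> powr r) * (1 + b * sin (\<omega> * z)) \<le> (normal_density 0 s z * \<bar>z\<bar> powr r) * 2"
        by (intro mult_left_mono) (auto simp: normal_density_nonneg)
      then show "ennreal (normal_density 0 s z * (1 + b * sin (\<omega> * z))) * ennreal (\<bar>z\<bar> powr r) \<le>
          ennreal (2 * (normal_density 0 s z * \<bar>z\<bar> powr r))"
        using modulated_density_nonneg[OF b]
        by (subst ennreal_mult[symmetric]) (auto simp: normal_density_nonneg mult_ac intro!: ennreal_leI)
    qed
    also have "\<dots> = ennreal \<bar>s\<bar> * (\<integral>\<^sup>+x. ennreal (2 * ?f x) \<partial>lborel)"
      by (rule nn_integral_real_affine) (use s in auto)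
    also have "\<dots> = (\<integral>\<^sup>+x. ennreal \<bar>s\<bar> * ennreal (2 * ?f x) \<partial>lborel)"
      by (rule nn_integral_cmult[symmetric]) measurable
    also have "\<dots> \<le> (\<integral>\<^sup>+x. ennreal (2 * s * (std_normal_density x * (1 + \<bar>x\<bar> ^ k))) \<partial>lborel)"
    proof (intro nn_integral_mono)
      fix x
      have dens: "s * normal_density 0 s (s * x) = std_normal_density x"
        using s by (simp add: normal_density_def real_sqrt_mult power_mult_distrib field_simps)
      have "\<bar>s * x\<bar> powr r = s powr r * \<bar>x\<bar> powr r" using s by (simp add: abs_mult powr_mult)
      also have "\<dots> \<le> s * (1 + \<bar>x\<bar> ^ k)"
      proof (rule mult_mono)
        show "s powr r \<le> s" using powr_mono'[of 1 r s] s r by simp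
        show "\<bar>x\<bar> powr r \<le> 1 + \<bar>x\<bar> ^ k"
        proof (cases "\<bar>x\<bar> \<le> 1")
          case True
          then have "\<bar>x\<bar> powr r \<le> 1" using r by (intro powr_le1) auto
          then show ?thesis by (simp add: add_increasing2)
        next
          case False
          have "r \<le> real k" using r unfolding k_def by linarith
          then have "\<bar>x\<bar> powr r \<le> \<bar>x\<bar> powr real k" using False by (intro powr_mono) auto
          then show ?thesis using False by (subst (asm) powr_realpow) auto
        qed
      qed (use s in auto)
      finally have "2 * std_normal_density x * \<bar>s * x\<bar> powr r \<le> 2 * std_normal_density x * (s * (1 + \<bar>x\<bar> ^ k))"
        by (intro mult_left_mono) (auto simp: normal_density_nonneg)
      then have le: "s * (2 * ?f x) \<le> 2 * s * (std_normal_density x * (1 + \<bar>x\<bar> ^ k))"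
        unfolding dens[symmetric] by (simp add: mult_ac)
      have "ennreal \<bar>s\<bar> * ennreal (2 * ?f x) =
         ennreal (s * (2 * ?f x))"
        using s by (subst ennreal_mult[symmetric]) (auto simp: normal_density_nonneg)
      then show "ennreal \<bar>s\<bar> * ennreal (2 * ?f x) \<le>
          ennreal (2 * s * (std_normal_density x * (1 + \<bar>x\<bar> ^ k)))"
        using ennreal_leI[OF le] by simp
    qed
    also have "\<dots> = ennreal (\<integral>x. 2 * s * (std_normal_density x * (1 + \<bar>x\<bar> ^ k)) \<partial>lborel)"
      using int s by (intro nn_integral_eq_integral) (auto simp: normal_density_nonneg)
    also have "(\<integral>x. 2 * s * (std_normal_density x * (1 + \<bar>x\<bar> ^ k)) \<partial>lborel) = 2 * s * C0"
      unfolding C0_def by (rule integral_mult_right_zero)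
    finally have le: "(\<integral>\<^sup>+z. ennreal (\<bar>z\<bar> powr r) \<partial>?N) \<le> ennreal (2 * s * C0)" .
    have "(\<integral>\<^sup>+z. ennreal (1 + \<bar>z\<bar> powr r) \<partial>?N) =
      (\<integral>\<^sup>+z. 1 + ennreal (\<bar>z\<bar> powr r) \<partial>?N)"
      by (intro nn_integral_cong) simp
    also have "\<dots> = 1 + (\<integral>\<^sup>+z. ennreal (\<bar>z\<bar> powr r) \<partial>?N)"
      by (subst nn_integral_add) (simp_all add: emeasure_space_1)
    also have "\<dots> \<le> ennreal 1 + ennreal (2 * s * C0)" using le by (simp add: add_left_mono)
    also have "\<dots> = ennreal (1 + 2 * s * C0)" using s C0 by (intro ennreal_plus[symmetric]) auto
    also have "\<dots> \<le> ennreal (1 + s * (2 * C0 + 1))" using s by (intro ennreal_leI) (simp add: algebra_simps)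
    finally show ?thesis .
  qed
  then show ?thesis using C0 by (intro exI[of _ "2 * C0 + 1"]) auto
qed

section \<open>The lower bound\<close>

lemma sin_lipschitz: "\<bar>sin x - sin y\<bar> \<le> \<bar>x - y :: real\<bar>"
proof -
  have "\<bar>sin x - sin y\<bar> = 2 * \<bar>sin ((x - y) / 2)\<bar> * \<bar>cos ((x + y) / 2)\<bar>"
    by (simp add: sin_diff_sin abs_mult)
  also have "\<dots> \<le> 2 * \<bar>(x - y) / 2\<bar> * 1"
    by (intro mult_mono abs_sin_x_le_abs_x) auto
  finally show ?thesis by simp
qed

lemma gaussian_vector_prob: "gaussian_vector \<nu> \<Longrightarrow> prob_space \<nu> \<and> sets \<nu> = sets borel"
  by (simp add: gaussian_vector_def space_prob_algebra)

lemma gaussian_coordinate: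
  fixes A :: "real^'n^'n"
  assumes "gaussian_vector \<nu>"
  shows "gaussian_real (distr \<nu> borel (\<lambda>x. (A *v x) $ l))"
proof -
  have "(\<lambda>x. (A *v x) $ l) = (\<lambda>x. A $ l \<bullet> x)"
    by (simp add: matrix_vector_mult_def inner_vec_def fun_eq_iff)
  then show ?thesis using assms by (simp add: gaussian_vector_def)
qed

text \<open>Otherwise all coordinates of \<open>A *v x\<close>, hence \<open>x\<close> itself, would be almost surely constant.\<close>

lemma nondegenerate_coordinate:
  fixes A :: "real^'n^'n"
  assumes gauss: "gaussian_vector \<nu>" and cov: "covariance_matrix \<nu> \<noteq> 0" and A: "invertible A"
  shows "\<exists>j m \<sigma>. \<sigma> > 0 \<and> distr \<nu> borel (\<lambda>x. (A *v x) $ j) = density lborel (\<lambda>x. ennreal (normal_density m \<sigma> x))"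
proof (rule ccontr)
  assume neg: "\<not> ?thesis"
  interpret prob_space \<nu> using gaussian_vector_prob[OF gauss] by blast
  have [measurable_cong]: "sets \<nu> = sets borel" using gaussian_vector_prob[OF gauss] by blast
  have "\<exists>m. distr \<nu> borel (\<lambda>x. (A *v x) $ l) = return borel m" for l
    using gaussian_coordinate[OF gauss, of A l] neg unfolding gaussian_real_def by blast
  then obtain m where m: "\<And>l. distr \<nu> borel (\<lambda>x. (A *v x) $ l) = return borel (m l)" by metis
  have "AE x in \<nu>. (A *v x) $ l = m l" for l
  proof -
    have "AE t in return borel (m l). t = m l" by (subst AE_return) auto
    then have "AE t in distr \<nu> borel (\<lambda>x. (A *v x) $ l). t = m l" unfolding m .
    then show ?thesis by (subst (asm) AE_distr_iff) auto
  qed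
  then have "AE x in \<nu>. \<forall>l\<in>UNIV. (A *v x) $ l = m l" by (intro AE_finite_allI) auto
  then have const: "AE x in \<nu>. x = matrix_inv A *v (\<chi> l. m l)"
  proof eventually_elim
    case (elim x)
    then have "A *v x = (\<chi> l. m l)" by (simp add: vec_eq_iff)
    then show ?case using matrix_inv_left_cancel[OF A, of x] by simp
  qed
  define x0 where "x0 = matrix_inv A *v (\<chi> l. m l)"
  have mean: "(\<integral>y. y $ i \<partial>\<nu>) = x0 $ i" for i
  proof -
    have "(\<integral>y. y $ i \<partial>\<nu>) = (\<integral>y. x0 $ i \<partial>\<nu>)"
      by (rule integral_cong_AE) (use const in \<open>auto simp: x0_def\<close>)
    then show ?thesis by (simp add: prob_space)
  qed
  have "covariance_matrix \<nu> $ i $ j = 0" for i j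
  proof -
    have "covariance_matrix \<nu> $ i $ j = (\<integral>x. (x $ i - x0 $ i) * (x $ j - x0 $ j) \<partial>\<nu>)"
      by (simp add: covariance_matrix_def mean)
    also have "\<dots> = (\<integral>x. 0 \<partial>\<nu>)"
      by (rule integral_cong_AE) (use const in \<open>auto simp: x0_def\<close>)
    finally show ?thesis by simp
  qed
  then have "covariance_matrix \<nu> = 0" by (simp add: vec_eq_iff)
  with cov show False ..
qed

text \<open>The vector whose \<open>A\<close>-coordinates are those of the \<open>j\<close>-th unit vector.\<close>

definition axis_direction :: "real^'n^'n \<Rightarrow> 'n \<Rightarrow> real^'n" where
  "axis_direction A j = matrix_inv A *v axis j 1"

lemma axis_direction_coordinate:
  assumes "invertible A"
  shows "(A *v (t *\<^sub>R axis_direction A j)) $ l = (if l = j then t else 0)"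
  using assms by (simp add: matrix_vector_mult_scaleR axis_direction_def matrix_inv_right_cancel axis_def)

text \<open>The law of the noise with its \<open>j\<close>-th \<open>A\<close>-coordinate set to zero.\<close>

definition transversal_noise :: "(real^'n) measure \<Rightarrow> real^'n^'n \<Rightarrow> 'n \<Rightarrow> (real^'n) measure" where
  "transversal_noise \<nu> A j = distr \<nu> borel (\<lambda>e. e - (A *v e) $ j *\<^sub>R axis_direction A j)"

text \<open>The transversal part is a function of the coordinates other than \<open>j\<close>. The \<open>j\<close>-th coordinate
  appears as a multiple of a vector, so that both parts take values in the same space.\<close>

lemma transversal_noise_indep:
  fixes A :: "real^'n^'n"
  assumes "prob_space \<nu>" and [measurable_cong]: "sets \<nu> = sets borel" and A: "invertible A"
    and indep: "prob_space.indep_vars \<nu> (\<lambda>_. borel) (\<lambda>j x. (A *v x) $ j) UNIV"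
  shows "prob_space.indep_var \<nu> borel (\<lambda>e. (A *v e) $ j *\<^sub>R axis_direction A j)
     borel (\<lambda>e. e - (A *v e) $ j *\<^sub>R axis_direction A j)"
proof -
  interpret prob_space \<nu> by fact
  define rest where "rest y = matrix_inv A *v (\<chi> l. if l = j then 0 else y l)" for y :: "'n \<Rightarrow> real"
  have rest_eq: "rest (restrict (\<lambda>i. (A *v e) $ i) (UNIV - {j})) = e - (A *v e) $ j *\<^sub>R axis_direction A j" for e
  proof -
    have "A *v (e - (A *v e) $ j *\<^sub>R axis_direction A j) = (\<chi> l. if l = j then 0 else (A *v e) $ l)"
      by (simp add: vec_eq_iff matrix_vector_mult_diff_distrib axis_direction_coordinate[OF A])
    then have "e - (A *v e) $ j *\<^sub>R axis_direction A j = matrix_inv A *v (\<chi> l. if l = j then 0 else (A *v e) $ l)"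
      using matrix_inv_left_cancel[OF A] by metis
    also have "\<dots> = rest (restrict (\<lambda>i. (A *v e) $ i) (UNIV - {j}))"
      unfolding rest_def by (intro arg_cong[of _ _ "\<lambda>v. matrix_inv A *v v"]) (simp add: vec_eq_iff)
    finally show ?thesis ..
  qed
  have comp: "(\<lambda>y. rest y $ i) \<in> borel_measurable (PiM (UNIV - {j}) (\<lambda>_. borel))" for i
  proof -
    have m: "(\<lambda>y. if l = j then 0 else y l) \<in> borel_measurable (PiM (UNIV - {j}) (\<lambda>_. borel))" for l :: 'n
      by (cases "l = j") auto
    show ?thesis unfolding rest_def matrix_vector_mult_def
      by (simp only: vec_lambda_beta) (intro borel_measurable_sum borel_measurable_times borel_measurable_const m)
  qed
  have rest_meas: "rest \<in> measurable (PiM (UNIV - {j}) (\<lambda>_. borel)) borel"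
  proof (rule borel_measurable_euclidean_space[THEN iffD2, rule_format])
    fix b :: "real^'n" assume "b \<in> Basis"
    then obtain i where "b = axis i 1" by (auto simp: Basis_vec_def)
    then show "(\<lambda>x. rest x \<bullet> b) \<in> borel_measurable (PiM (UNIV - {j}) (\<lambda>_. borel))"
      using comp[of i] by (simp add: inner_axis)
  qed
  have "indep_var (PiM {j} (\<lambda>_. borel)) (\<lambda>e. restrict (\<lambda>i. (A *v e) $ i) {j})
      (PiM (UNIV - {j}) (\<lambda>_. borel)) (\<lambda>e. restrict (\<lambda>i. (A *v e) $ i) (UNIV - {j}))"
    by (rule indep_var_restrict[OF indep]) auto
  then have "indep_var borel ((\<lambda>y. y j *\<^sub>R axis_direction A j) \<circ> (\<lambda>e. restrict (\<lambda>i. (A *v e) $ i) {j}))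
      borel (rest \<circ> (\<lambda>e. restrict (\<lambda>i. (A *v e) $ i) (UNIV - {j})))"
    by (rule indep_var_compose) (auto intro: rest_meas)
  then show ?thesis by (simp add: comp_def rest_eq)
qed

text \<open>Conditionally on the transversal part \<open>r\<close> of the noise, the observation is the one-dimensional
  convolution model along the line through \<open>r\<close>.\<close>

lemma nn_integral_line_plus_noise:
  fixes A :: "real^'n^'n" and g :: "real^'n \<Rightarrow> ennreal"
  assumes prob: "prob_space \<nu>" and sets: "sets \<nu> = sets borel" and A: "invertible A"
    and indep: "prob_space.indep_vars \<nu> (\<lambda>_. borel) (\<lambda>j x. (A *v x) $ j) UNIV"
    and \<rho>: "prob_space \<rho>" "sets \<rho> = sets borel" and [measurable]: "g \<in> borel_measurable borel"
  shows "(\<integral>\<^sup>+y. g y \<partial>(distr \<rho> borel (\<lambda>z. z *\<^sub>R axis_direction A j) \<star> \<nu>)) =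
    (\<integral>\<^sup>+r. \<integral>\<^sup>+z. \<integral>\<^sup>+\<eta>. g ((z + \<eta>) *\<^sub>R axis_direction A j + r)
      \<partial>distr \<nu> borel (\<lambda>x. (A *v x) $ j) \<partial>\<rho> \<partial>transversal_noise \<nu> A j)"
proof -
  interpret N: prob_space \<nu> by fact
  interpret R: prob_space \<rho> by fact
  note [measurable_cong] = sets \<rho>(2)
  let ?v = "axis_direction A j"
  let ?X = "\<lambda>e. (A *v e) $ j" and ?R = "\<lambda>e. e - (A *v e) $ j *\<^sub>R axis_direction A j"
  let ?V = "\<lambda>e. ?X e *\<^sub>R ?v"
  let ?E = "distr \<nu> borel ?X" and ?D = "distr \<nu> borel ?R" and ?W = "distr \<nu> borel ?V"
  have ind: "N.indep_var borel ?V borel ?R" by (rule transversal_noise_indep[OF prob sets A indep])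
  interpret E: prob_space ?E by (rule N.prob_space_distr) measurable
  interpret W: prob_space ?W by (rule N.prob_space_distr) measurable
  interpret D: prob_space ?D by (rule N.prob_space_distr) measurable
  interpret WD: pair_sigma_finite ?W ?D ..
  interpret RD: pair_sigma_finite \<rho> ?D ..
  have pair: "?W \<Otimes>\<^sub>M ?D = distr \<nu> (borel \<Otimes>\<^sub>M borel) (\<lambda>e. (?V e, ?R e))"
    using ind unfolding N.indep_var_distribution_eq by simp
  have split: "(\<integral>\<^sup>+e. g (z *\<^sub>R ?v + e) \<partial>\<nu>) = (\<integral>\<^sup>+r. \<integral>\<^sup>+\<eta>. g ((z + \<eta>) *\<^sub>R ?v + r) \<partial>?E \<partial>?D)" for z
  proof -
    have "(\<integral>\<^sup>+e. g (z *\<^sub>R ?v + e) \<partial>\<nu>) = (\<integral>\<^sup>+e. g (z *\<^sub>R ?v + fst (?V e, ?R e) + snd (?V e, ?R e)) \<partial>\<nu>)"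
      by (simp add: algebra_simps)
    also have "\<dots> = (\<integral>\<^sup>+w. g (z *\<^sub>R ?v + fst w + snd w) \<partial>(?W \<Otimes>\<^sub>M ?D))"
      unfolding pair by (rule nn_integral_distr[symmetric]) measurable
    also have "\<dots> = (\<integral>\<^sup>+r. \<integral>\<^sup>+w. g (z *\<^sub>R ?v + fst (w, r) + snd (w, r)) \<partial>?W \<partial>?D)"
      by (rule WD.nn_integral_snd[symmetric]) measurable
    also have "\<dots> = (\<integral>\<^sup>+r. \<integral>\<^sup>+e. g (z *\<^sub>R ?v + ?V e + r) \<partial>\<nu> \<partial>?D)"
      by (simp add: nn_integral_distr)
    also have "\<dots> = (\<integral>\<^sup>+r. \<integral>\<^sup>+\<eta>. g ((z + \<eta>) *\<^sub>R ?v + r) \<partial>?E \<partial>?D)"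
      by (simp add: nn_integral_distr scaleR_add_left)
    finally show ?thesis .
  qed
  have "(\<integral>\<^sup>+y. g y \<partial>(distr \<rho> borel (\<lambda>z. z *\<^sub>R ?v) \<star> \<nu>)) =
     (\<integral>\<^sup>+x. \<integral>\<^sup>+e. g (x + e) \<partial>\<nu> \<partial>distr \<rho> borel (\<lambda>z. z *\<^sub>R ?v))"
    by (rule nn_integral_convolution)
       (auto intro!: prob_space.finite_measure R.prob_space_distr prob simp: sets)
  also have "\<dots> = (\<integral>\<^sup>+z. \<integral>\<^sup>+e. g (z *\<^sub>R ?v + e) \<partial>\<nu> \<partial>\<rho>)"
    by (rule nn_integral_distr) measurable
  also have "\<dots> = (\<integral>\<^sup>+z. \<integral>\<^sup>+r. \<integral>\<^sup>+\<eta>. g ((z + \<eta>) *\<^sub>R ?v + r) \<partial>?E \<partial>?D \<partial>\<rho>)"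
    unfolding split ..
  also have "\<dots> = (\<integral>\<^sup>+r. \<integral>\<^sup>+z. \<integral>\<^sup>+\<eta>. g ((z + \<eta>) *\<^sub>R ?v + r) \<partial>?E \<partial>\<rho> \<partial>?D)"
    by (rule RD.Fubini'[symmetric]) measurable
  finally show ?thesis unfolding transversal_noise_def .
qed

text \<open>All coordinates but the \<open>j\<close>-th vanish, so every product in the definition of the class has only
  one factor different from 1.\<close>

lemma line_law_in_moment_class:
  fixes A :: "real^'n^'n"
  assumes A: "invertible A" and \<rho>: "prob_space \<rho>" and [measurable_cong]: "sets \<rho> = sets borel"
    and moments: "\<And>r. r = a \<or> r = 2 * p + a \<Longrightarrow> (\<integral>\<^sup>+z. ennreal (1 + \<bar>z\<bar> powr r) \<partial>\<rho>) \<le> ennreal M"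
  shows "distr \<rho> borel (\<lambda>z. z *\<^sub>R axis_direction A j) \<in> moment_class A M p a"
proof -
  interpret prob_space \<rho> by fact
  let ?v = "axis_direction A j"
  let ?f = "\<lambda>l x. (1 + \<bar>(A *v x) $ l\<bar> powr (2 * p + a)) * (\<Prod>k\<in>UNIV - {l}. 1 + \<bar>(A *v x) $ k\<bar> powr a)"
  have delta: "1 + \<bar>if k = j then z else 0\<bar> powr a = (if k = j then 1 + \<bar>z\<bar> powr a else 1)" for k z by simp
  have f: "?f l (z *\<^sub>R ?v) = 1 + \<bar>z\<bar> powr (if l = j then 2 * p + a else a)" for l z
    unfolding axis_direction_coordinate[OF A] delta by (cases "l = j") (auto simp: prod.delta)
  have "(\<integral>\<^sup>+x. ennreal (?f l x) \<partial>distr \<rho> borel (\<lambda>z. z *\<^sub>R ?v)) \<le> ennreal M" for l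
  proof -
    have "(\<integral>\<^sup>+x. ennreal (?f l x) \<partial>distr \<rho> borel (\<lambda>z. z *\<^sub>R ?v)) = (\<integral>\<^sup>+z. ennreal (?f l (z *\<^sub>R ?v)) \<partial>\<rho>)"
      by (rule nn_integral_distr) measurable
    also have "\<dots> \<le> ennreal M" unfolding f by (rule moments) auto
    finally show ?thesis .
  qed
  moreover have "prob_space (distr \<rho> borel (\<lambda>z. z *\<^sub>R ?v))" by (rule prob_space_distr) measurable
  ultimately show ?thesis unfolding moment_class_def by (auto simp: space_prob_algebra intro!: SUP_least)
qed

text \<open>The frequency \<open>\<omega>\<close> is of order \<open>sqrt (ln n)\<close>, just large enough for the oscillation in the observed
  density to be, relative to that density, at most \<open>1 / (2 n)\<close>. The two laws differ by an amount of order \<open>1 / \<omega>\<close> on the 1-Lipschitz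
  function \<open>h\<close>.\<close>

lemma log_rate_lower_bound:
  fixes A :: "real^'n^'n"
  assumes gauss: "gaussian_vector \<mu>\<^sub>\<epsilon>" and cov: "covariance_matrix \<mu>\<^sub>\<epsilon> \<noteq> 0" and A: "invertible A"
    and indep: "prob_space.indep_vars \<mu>\<^sub>\<epsilon> (\<lambda>_. borel) (\<lambda>j x. (A *v x) $ j) UNIV"
    and M: "M > 1" and p: "p \<ge> 1" and a: "a > 1"
  shows "\<exists>C>0. \<forall>T. estimator T \<longrightarrow>
    liminf (\<lambda>n. ennreal (ln (real n) powr (p / 2)) * (SUP \<mu>\<in>moment_class A M p a. risk p \<mu>\<^sub>\<epsilon> T n \<mu>)) \<ge> ennreal C"
proof -
  have prob: "prob_space \<mu>\<^sub>\<epsilon>" and sets: "sets \<mu>\<^sub>\<epsilon> = sets borel" using gaussian_vector_prob[OF gauss] by auto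
  interpret E: prob_space \<mu>\<^sub>\<epsilon> by fact
  note [measurable_cong] = sets
  obtain j m \<sigma> where \<sigma>: "\<sigma> > 0"
    and noise_j: "distr \<mu>\<^sub>\<epsilon> borel (\<lambda>x. (A *v x) $ j) = density lborel (\<lambda>x. ennreal (normal_density m \<sigma> x))"
    using nondegenerate_coordinate[OF gauss cov A] by blast
  let ?v = "axis_direction A j"
  obtain C0 where C0: "C0 > 0" and moment: "\<And>s \<omega> b r. 0 < s \<Longrightarrow> s \<le> 1 \<Longrightarrow> \<bar>b\<bar> \<le> 1 \<Longrightarrow> 1 \<le> r \<Longrightarrow> r \<le> 2 * p + a \<Longrightarrow>
     (\<integral>\<^sup>+z. ennreal (1 + \<bar>z\<bar> powr r) \<partial>modulated_normal s \<omega> b) \<le> ennreal (1 + s * C0)"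
    using modulated_normal_moment[of "2 * p + a"] by blast
  \<comment> \<open>the envelope is so narrow that the laws satisfy the moment condition\<close>
  define s where "s = min 1 ((M - 1) / C0)"
  have s: "0 < s" "s \<le> 1" "1 + s * C0 \<le> M"
  proof -
    have "s \<le> (M - 1) / C0" by (simp add: s_def)
    then show "1 + s * C0 \<le> M" using C0 by (simp add: field_simps)
  qed (use M C0 in \<open>auto simp: s_def\<close>)
  define \<tau> where "\<tau> = sqrt (s\<^sup>2 * \<sigma>\<^sup>2 / (s\<^sup>2 + \<sigma>\<^sup>2))"
  have \<tau>: "\<tau> > 0" using s \<sigma> by (simp add: \<tau>_def add_pos_pos)
  have \<tau>_le_s: "\<tau>\<^sup>2 \<le> s\<^sup>2"
  proof -
    have "\<tau>\<^sup>2 = s\<^sup>2 * (\<sigma>\<^sup>2 / (s\<^sup>2 + \<sigma>\<^sup>2))" by (simp add: \<tau>_def)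
    also have "\<dots> \<le> s\<^sup>2 * 1" using s \<sigma> by (intro mult_left_mono) (auto simp: divide_le_eq add_pos_pos)
    finally show ?thesis by simp
  qed
  obtain K where K: "K > 0" "\<And>x. \<bar>(A *v x) $ j\<bar> \<le> K * norm x"
  proof -
    obtain K where "K > 0" "\<And>x. norm (A *v x) \<le> norm x * K"
      using bounded_linear.pos_bounded[OF matrix_vector_mul_bounded_linear[of A]] by auto
    then show ?thesis
      using that component_le_norm_cart[of "A *v x" j for x] by (metis mult.commute order_trans)
  qed
  define C where "C = (\<tau> / (16 * K)) powr p / 4"
  have "C > 0" using \<tau> K by (simp add: C_def)
  have bound: "ennreal C \<le> ennreal (ln (real n) powr (p / 2)) * (SUP \<mu>\<in>moment_class A M p a. risk p \<mu>\<^sub>\<epsilon> T n \<mu>)"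
    if T: "estimator T" and n: "n \<ge> 2" for T n
  proof -
    define x where "x = ln (2 * real n)"
    have x1: "x \<ge> 1"
    proof -
      have "exp 1 \<le> 2 * real n" using n exp_le by linarith
      then show ?thesis using n by (simp add: x_def ln_ge_iff)
    qed
    have x_le: "x \<le> 2 * ln (real n)"
    proof -
      have "x \<le> ln (real n * real n)" unfolding x_def using n by (subst ln_le_cancel_iff) auto
      then show ?thesis using n by (simp add: ln_mult)
    qed
    define \<omega> where "\<omega> = sqrt (2 * x) / \<tau>"
    have \<omega>: "\<omega> > 0" using x1 \<tau> by (simp add: \<omega>_def)
    have \<tau>\<omega>: "(\<tau> * \<omega>)\<^sup>2 = 2 * x" using \<tau> x1 by (simp add: \<omega>_def)
    \<comment> \<open>the frequency makes the relative perturbation of the observed density exactly \<open>1 / (2 n)\<close>\<close>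
    have eps: "exp (- (\<tau> * \<omega>)\<^sup>2 / 2) = 1 / (2 * real n)"
      unfolding \<tau>\<omega> using n by (simp add: x_def exp_minus inverse_eq_divide)
    let ?D = "modulated_normal s \<omega>"
    define \<nu> where "\<nu> b = distr (?D b) borel (\<lambda>z. z *\<^sub>R ?v)" for b
    have mod: "prob_space (?D b)" if "\<bar>b\<bar> \<le> 1" for b
      by (rule modulated_normal_prob[OF s(1) that])
    have class_mem: "\<nu> b \<in> moment_class A M p a" if b: "\<bar>b\<bar> \<le> 1" for b
      unfolding \<nu>_def
    proof (rule line_law_in_moment_class[OF A mod[OF b]])
      fix r assume "r = a \<or> r = 2 * p + a"
      then have "(\<integral>\<^sup>+z. ennreal (1 + \<bar>z\<bar> powr r) \<partial>?D b) \<le> ennreal (1 + s * C0)"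
        using p a by (intro moment s b) auto
      also have "\<dots> \<le> ennreal M" by (intro ennreal_leI s)
      finally show "(\<integral>\<^sup>+z. ennreal (1 + \<bar>z\<bar> powr r) \<partial>?D b) \<le> ennreal M" .
    qed simp
    have conv_prob: "prob_space (\<nu> b \<star> \<mu>\<^sub>\<epsilon>)" if b: "\<bar>b\<bar> \<le> 1" for b
      using moment_classD[OF class_mem[OF b]] by (intro convolution_prob prob sets) auto
    have dom: "ennreal (1 - 1 / (2 * real n)) * (\<integral>\<^sup>+y. g y \<partial>(\<nu> 0 \<star> \<mu>\<^sub>\<epsilon>)) \<le> (\<integral>\<^sup>+y. g y \<partial>(\<nu> 1 \<star> \<mu>\<^sub>\<epsilon>))"
      if g [measurable]: "g \<in> borel_measurable borel" for g :: "real^'n \<Rightarrow> ennreal"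
    proof -
      let ?T = "transversal_noise \<mu>\<^sub>\<epsilon> A j"
      let ?N = "density lborel (\<lambda>x. ennreal (normal_density m \<sigma> x))"
      let ?J = "\<lambda>b r. \<integral>\<^sup>+z. \<integral>\<^sup>+\<eta>. g ((z + \<eta>) *\<^sub>R ?v + r) \<partial>?N \<partial>?D b"
      have eq: "(\<integral>\<^sup>+y. g y \<partial>(\<nu> b \<star> \<mu>\<^sub>\<epsilon>)) = (\<integral>\<^sup>+r. ?J b r \<partial>?T)" if "\<bar>b\<bar> \<le> 1" for b
        unfolding \<nu>_def using nn_integral_line_plus_noise[OF prob sets A indep mod[OF that] _ g, of j]
        by (simp add: noise_j)
      interpret Z: prob_space "?D 0" by (rule mod) simp
      interpret N: prob_space ?N by (rule prob_space_normal_density[OF \<sigma>])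
      have [measurable]: "(\<lambda>r. ?J 0 r) \<in> borel_measurable borel" by measurable
      have [measurable_cong]: "sets (?T) = sets borel" by (simp add: transversal_noise_def)
      have "ennreal (1 - 1 / (2 * real n)) * (\<integral>\<^sup>+r. ?J 0 r \<partial>?T) =
        (\<integral>\<^sup>+r. ennreal (1 - 1 / (2 * real n)) * ?J 0 r \<partial>?T)"
        by (rule nn_integral_cmult[symmetric]) measurable
      also have "\<dots> \<le> (\<integral>\<^sup>+r. ?J 1 r \<partial>?T)"
      proof (rule nn_integral_mono)
        fix r
        have "(\<lambda>t. g (t *\<^sub>R ?v + r)) \<in> borel_measurable borel" by measurable
        from modulated_normal_domination[OF this s(1) \<sigma> \<tau>_def, of \<omega> m]
        show "ennreal (1 - 1 / (2 * real n)) * ?J 0 r \<le> ?J 1 r" unfolding eps .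
      qed
      finally show ?thesis by (simp add: eq)
    qed
    define h where "h y = sin (\<omega> * (A *v y) $ j) / (\<omega> * K)" for y
    have h_meas [measurable]: "h \<in> borel_measurable borel" unfolding h_def by measurable
    have h_bound: "\<bar>h y\<bar> \<le> 1 / (\<omega> * K)" for y
      using \<omega> K by (simp add: h_def abs_mult divide_right_mono)
    have h_lip: "\<bar>h y - h y'\<bar> \<le> norm (y - y')" for y y'
    proof -
      have "\<bar>sin (\<omega> * (A *v y) $ j) - sin (\<omega> * (A *v y') $ j)\<bar> \<le> \<bar>\<omega> * (A *v y) $ j - \<omega> * (A *v y') $ j\<bar>"
        by (rule sin_lipschitz)
      also have "\<dots> = \<omega> * \<bar>(A *v (y - y')) $ j\<bar>"
        using \<omega> by (simp add: matrix_vector_mult_diff_distrib abs_mult right_diff_distrib[symmetric])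
      also have "\<dots> \<le> \<omega> * (K * norm (y - y'))" using \<omega> K by (intro mult_left_mono) auto
      finally show ?thesis using \<omega> K
        by (simp add: h_def diff_divide_distrib[symmetric] divide_le_eq mult_ac)
    qed
    have h_int: "(\<integral>y. h y \<partial>\<nu> b) = b * (1 - exp (- 2 * (s * \<omega>)\<^sup>2)) / (2 * \<omega> * K)" if "\<bar>b\<bar> \<le> 1" for b
    proof -
      have "(\<integral>y. h y \<partial>\<nu> b) = (\<integral>z. h (z *\<^sub>R ?v) \<partial>modulated_normal s \<omega> b)"
        unfolding \<nu>_def by (rule integral_distr) measurable
      also have "\<dots> = (\<integral>z. sin (\<omega> * z) \<partial>modulated_normal s \<omega> b) / (\<omega> * K)"
        by (simp add: h_def axis_direction_coordinate[OF A])
      finally show ?thesis using modulated_normal_sin_integral[OF s(1) that, of \<omega>] by simp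
    qed
    define \<delta> where "\<delta> = 1 / (8 * \<omega> * K)"
    have gap: "2 * \<delta> \<le> \<bar>(\<integral>y. h y \<partial>\<nu> 1) - (\<integral>y. h y \<partial>\<nu> 0)\<bar>"
    proof -
      have "2 \<le> 2 * x" using x1 by simp
      also have "\<dots> = \<tau>\<^sup>2 * \<omega>\<^sup>2" using \<tau>\<omega> by (simp add: power_mult_distrib)
      also have "\<dots> \<le> s\<^sup>2 * \<omega>\<^sup>2" using \<tau>_le_s by (intro mult_right_mono) auto
      finally have "1 \<le> 2 * (s * \<omega>)\<^sup>2" by (simp add: power_mult_distrib)
      moreover have "1 + 2 * (s * \<omega>)\<^sup>2 \<le> exp (2 * (s * \<omega>)\<^sup>2)" by (rule exp_ge_add_one_self)
      ultimately have "2 \<le> exp (2 * (s * \<omega>)\<^sup>2)" by linarith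
      then have "exp (- 2 * (s * \<omega>)\<^sup>2) \<le> 1 / 2" by (simp add: exp_minus field_simps)
      then have "1 / 2 / (2 * \<omega> * K) \<le> 1 * (1 - exp (- 2 * (s * \<omega>)\<^sup>2)) / (2 * \<omega> * K)"
        using \<omega> K by (intro divide_right_mono) auto
      moreover have "(\<integral>y. h y \<partial>\<nu> 1) - (\<integral>y. h y \<partial>\<nu> 0) = 1 * (1 - exp (- 2 * (s * \<omega>)\<^sup>2)) / (2 * \<omega> * K)"
        by (simp add: h_int)
      moreover have "2 * \<delta> = 1 / 2 / (2 * \<omega> * K)" by (simp add: \<delta>_def)
      ultimately show ?thesis by linarith
    qed
    let ?ln = "ln (real n) powr (p / 2)"
    have "ennreal (\<delta> powr p / 2) \<le> risk p \<mu>\<^sub>\<epsilon> T n (\<nu> 0) + risk p \<mu>\<^sub>\<epsilon> T n (\<nu> 1)"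
      by (rule two_point_risk_bound[OF p h_meas h_bound h_lip _ _ dom _ _ _ T _ gap])
         (use n \<omega> K in \<open>auto simp: conv_prob \<delta>_def\<close>)
    also have "\<dots> \<le> 2 * (SUP \<mu>\<in>moment_class A M p a. risk p \<mu>\<^sub>\<epsilon> T n \<mu>)" (is "_ \<le> 2 * ?S")
      unfolding mult_2 by (intro add_mono SUP_upper class_mem) auto
    finally have "ennreal (\<delta> powr p / 2) \<le> 2 * ?S" .
    then have "ennreal (1 / 2 * ?ln) * ennreal (\<delta> powr p / 2) \<le>
      ennreal (1 / 2 * ?ln) * (2 * ?S)"
      by (rule mult_left_mono) simp
    also have "\<dots> = ennreal (?ln) * ?S"
    proof -
      have "ennreal (1 / 2 * ?ln) * 2 = ennreal (1 / 2 * ?ln) * ennreal 2" by simp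
      also have "\<dots> = ennreal (1 / 2 * ?ln * 2)" by (rule ennreal_mult[symmetric]) auto
      finally show ?thesis by (simp add: mult.assoc[symmetric])
    qed
    also have "ennreal (1 / 2 * ?ln) * ennreal (\<delta> powr p / 2) =
       ennreal (1 / 2 * ?ln * (\<delta> powr p / 2))"
      by (rule ennreal_mult[symmetric]) auto
    finally have risk_ge: "ennreal (1 / 2 * ?ln * (\<delta> powr p / 2)) \<le>
       ennreal (?ln) * ?S" .
    have "C \<le> 1 / 2 * ?ln * (\<delta> powr p / 2)"
    proof -
      have ln_pos: "ln (real n) > 0" using n by simp
      have "sqrt (2 * x) \<le> sqrt (4 * ln (real n))" using x_le by (intro real_sqrt_le_mono) auto
      also have "\<dots> = 2 * sqrt (ln (real n))" by (simp add: real_sqrt_mult)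
      finally have "\<omega> * \<tau> \<le> 2 * sqrt (ln (real n))" using \<tau> by (simp add: \<omega>_def)
      then have "\<tau> / (16 * K) \<le> sqrt (ln (real n)) * \<delta>"
        using \<omega> K by (simp add: \<delta>_def field_simps)
      then have "(\<tau> / (16 * K)) powr p \<le> (sqrt (ln (real n)) * \<delta>) powr p"
        using p \<tau> K by (intro powr_mono2) auto
      also have "\<dots> = ?ln * \<delta> powr p"
      proof -
        have "\<delta> > 0" using \<omega> K by (simp add: \<delta>_def)
        then show ?thesis using ln_pos by (simp add: powr_mult powr_half_sqrt[symmetric] powr_powr)
      qed
      finally show ?thesis by (simp add: C_def)
    qed
    then have "ennreal C \<le> ennreal (1 / 2 * ?ln * (\<delta> powr p / 2))" by (rule ennreal_leI)
    then show ?thesis using risk_ge by (rule order_trans)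
  qed
  show ?thesis
  proof (intro exI[of _ C] conjI allI impI)
    fix T :: "nat \<Rightarrow> (nat \<Rightarrow> real^'n) \<Rightarrow> (real^'n) measure" assume "estimator T"
    then show "ennreal C \<le> liminf (\<lambda>n. ennreal (ln (real n) powr (p / 2)) * (SUP \<mu>\<in>moment_class A M p a. risk p \<mu>\<^sub>\<epsilon> T n \<mu>))"
      by (intro Liminf_bounded eventually_sequentiallyI[of 2] bound)
  qed fact
qed

section \<open>The minimax rate\<close>

theorem theorem1:
  fixes \<mu>\<^sub>\<epsilon> :: "(real ^ 'n) measure"
    and A :: "real ^ 'n ^ 'n"
    and M p a :: real
  assumes "gaussian_vector \<mu>\<^sub>\<epsilon>"
    and "covariance_matrix \<mu>\<^sub>\<epsilon> \<noteq> 0"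
    and "invertible A"
    and "prob_space.indep_vars \<mu>\<^sub>\<epsilon> (\<lambda>_. borel) (\<lambda>j x. (A *v x) $ j) UNIV"
    and "M > 0" and "p \<ge> 1" and "a > 1"
  shows "(M > 1 \<longrightarrow>
           (\<exists>C>0. \<forall>T. estimator T \<longrightarrow>
              liminf (\<lambda>n. ennreal (ln (real n) powr (p / 2)) *
                          (SUP \<mu>\<in>moment_class A M p a. risk p \<mu>\<^sub>\<epsilon> T n \<mu>)) \<ge> ennreal C)) \<and>
         (\<exists>T. estimator T \<and>
           (\<exists>K>0. (SUP n\<in>{1..}. SUP \<mu>\<in>moment_class A M p a.
                     ennreal (ln (real n) powr (p / 2)) * risk p \<mu>\<^sub>\<epsilon> T n \<mu>) \<le> ennreal K))"
proof (intro conjI impI)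
  have prob: "prob_space \<mu>\<^sub>\<epsilon>" and sets: "sets \<mu>\<^sub>\<epsilon> = sets borel"
    using gaussian_vector_prob[OF assms(1)] by auto
  have "\<exists>s\<ge>0. \<forall>t. exp (- (s * t\<^sup>2)) \<le> cmod (noise_char \<mu>\<^sub>\<epsilon> A l t)" for l
    unfolding noise_char_def by (rule gaussian_char_lower_bound[OF gaussian_coordinate[OF assms(1)]])
  then obtain s where s: "\<And>l. s l \<ge> 0" "\<And>l t. exp (- (s l * t\<^sup>2)) \<le> cmod (noise_char \<mu>\<^sub>\<epsilon> A l t)"
    by metis
  have "exp (- ((\<Sum>l\<in>UNIV. s l) * t\<^sup>2)) \<le> cmod (noise_char \<mu>\<^sub>\<epsilon> A l t)" for l t
  proof -
    have "s l \<le> (\<Sum>l\<in>UNIV. s l)" by (rule member_le_sum) (use s(1) in auto)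
    then have "exp (- ((\<Sum>l\<in>UNIV. s l) * t\<^sup>2)) \<le> exp (- (s l * t\<^sup>2))" by (simp add: mult_right_mono)
    also note s(2)
    finally show ?thesis .
  qed
  then interpret decoupled_noise \<mu>\<^sub>\<epsilon> A "\<Sum>l\<in>UNIV. s l"
    by (intro decoupled_noise.intro prob sets assms(3,4) sum_nonneg s(1))
  show "\<exists>C>0. \<forall>T. estimator T \<longrightarrow>
      liminf (\<lambda>n. ennreal (ln (real n) powr (p / 2)) *
        (SUP \<mu>\<in>moment_class A M p a. risk p \<mu>\<^sub>\<epsilon> T n \<mu>)) \<ge> ennreal C" if "M > 1"
    by (rule log_rate_lower_bound) (use assms that in auto)
  show "\<exists>T. estimator T \<and> (\<exists>K>0. (SUP n\<in>{1..}. SUP \<mu>\<in>moment_class A M p a.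
      ennreal (ln (real n) powr (p / 2)) * risk p \<mu>\<^sub>\<epsilon> T n \<mu>) \<le> ennreal K)"
    by (rule log_rate_estimator) (use assms in auto)
qed

end
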